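(* There exist two non-geometric arithmetically equivalent siblings $K$ and $K'$ over $\mathbb{F}_2(T)$ with Galois group $C_8\rtimes V_4$ such that they are not arithmetically equivalent over $\mathbb{F}_4(T)$. They are defined (as the fields generated over $\mathbb{F}_2(T)$ by a root) by the polynomials $$X^8 + TX^6 + TX^5 + (T^5 + T^4 + T^3 + T^2 + T + 1)X^4 + TX^3 + (T^7 + T^5 + T^3 + T^2)X^2 + (T^7 + T^4)X + (T^{10} + T^8 + T^6)$$ for $K$, and $$X^8 + TX^6 + TX^5 + (T^5 + T^3 + T^2 + T + 1)X^4 + TX^3+(T^5 + T^4 + T^3 + T^2)X^2 + T^4X + (T^{12} + T^{11} + T^9 + T^7 + T^6)$$ for $K'$.
   Context: For a finite separable extension $K$ of $\mathbb{F}_q(T)$, let $\mathcal{O}_K$ be the integral closure of $\mathbb{F}_q[T]$ in $K$; the splitting type $f_K(\mathfrak{p})$ of a non-zero prime $\mathfrak{p}$ of $\mathbb{F}_q[T]$ is the non-decreasing tuple of inertia degrees over $\mathfrak{p}$ of the primes of $\mathcal{O}_K$ above $\mathfrak{p}$. Two finite separable extensions $K,L$ of $\mathbb{F}_q(T)$ are arithmetically equivalent over $\mathbb{F}_q(T)$ if $f_K(\mathfrak{p})=f_L(\mathfrak{p})$ for all non-zero primes $\mathfrak{p}$ of $\mathbb{F}_q[T]$ outside a set of Dirichlet density zero; they are arithmetically equivalent siblings over $\mathbb{F}_q(T)$ if they are arithmetically equivalent over $\mathbb{F}_q(T)$ but not isomorphic as extensions of $\mathbb{F}_q(T)$. An extension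 of $\mathbb{F}_q(T)$ is geometric if its field of constants is $\mathbb{F}_q$, and non-geometric otherwise. The Galois group of an extension means the Galois group of its Galois closure. $C_8$ is the cyclic group of order 8, $V_4$ the Klein four-group, and $C_8\rtimes V_4$ is the transitive group 8T15, i.e. the semidirect product $(\mathbb{Z}/8\mathbb{Z})\rtimes(\mathbb{Z}/8\mathbb{Z})^*$ with the natural action. The fields $K$ and $K'$ contain $\mathbb{F}_4(T)$ and may be considered as extensions of it. *)

theory Defs
  imports
    "HOL-Algebra.Algebraic_Closure_Type"
    "HOL-Algebra.Generated_Rings"
    "HOL-Algebra.Generated_Fields"
    "HOL-Algebra.Finite_Extensions"
    "HOL-Algebra.Bij"
    "HOL-Analysis.Infinite_Sum"
    "HOL-Number_Theory.Residues"
    "HOL-Library.Z2"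
begin

text \<open>
  All fields live inside one algebraically closed field \<open>'a\<close>; subfields and subrings are sets of
  elements of \<open>'a\<close>. A rational function field \<open>F(t)\<close> is given by its finite constant field \<open>F\<close>
  and a transcendental element \<open>t\<close>, so \<open>F\<^sub>2(T)\<close> and \<open>F\<^sub>4(T)\<close> can be treated in the same
  ambient field.
\<close>

abbreviation amb :: "'a::alg_closed_field ring" where
  "amb \<equiv> ring_of_type_algebra"

abbreviation sub_of :: "'a::alg_closed_field set \<Rightarrow> 'a ring" where
  "sub_of A \<equiv> amb\<lparr>carrier := A\<rparr>"

definition GF :: "nat \<Rightarrow> 'a::alg_closed_field set" where
  "GF q = {x. x ^ q = x}"
  \<comment> \<open>the subfield of order \<open>q\<close>, for \<open>q\<close> a power of the characteristic\<close>

definition poly_subring :: "'a::alg_closed_field set \<Rightarrow> 'a \<Rightarrow> 'a set" where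
  "poly_subring F t = generate_ring amb (insert t F)"

definition rat_subfield :: "'a::alg_closed_field set \<Rightarrow> 'a \<Rightarrow> 'a set" where
  "rat_subfield F t = generate_field amb (insert t F)"


definition is_min_poly :: "'a::alg_closed_field set \<Rightarrow> 'a \<Rightarrow> 'a poly \<Rightarrow> bool" where
  "is_min_poly k x p \<longleftrightarrow>
     set (coeffs p) \<subseteq> k \<and> lead_coeff p = 1 \<and> poly p x = 0 \<and>
     (\<forall>q. set (coeffs q) \<subseteq> k \<longrightarrow> q \<noteq> 0 \<longrightarrow> poly q x = 0 \<longrightarrow>
        Polynomial.degree p \<le> Polynomial.degree q)"

definition separable_elt :: "'a::alg_closed_field set \<Rightarrow> 'a \<Rightarrow> bool" where
  "separable_elt k x \<longleftrightarrow> (\<exists>p. is_min_poly k x p \<and> rsquarefree p)"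
  \<comment> \<open>\<open>rsquarefree\<close> says that \<open>p\<close> has only simple roots in the algebraically closed field \<open>'a\<close>\<close>

definition finite_separable :: "'a::alg_closed_field set \<Rightarrow> 'a set \<Rightarrow> bool" where
  "finite_separable k K \<longleftrightarrow>
     subfield k amb \<and> subfield K amb \<and> k \<subseteq> K \<and>
     ring.finite_dimension amb k K \<and> (\<forall>x\<in>K. separable_elt k x)"

definition isomorphic_over :: "'a::alg_closed_field set \<Rightarrow> 'a set \<Rightarrow> 'a set \<Rightarrow> bool" where
  "isomorphic_over k K L \<longleftrightarrow> (\<exists>\<phi> \<in> ring_iso (sub_of K) (sub_of L). \<forall>x\<in>k. \<phi> x = x)"


definition integral_closure :: "'a::alg_closed_field set \<Rightarrow> 'a set \<Rightarrow> 'a set" where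
  "integral_closure A K =
     {x \<in> K. \<exists>p. lead_coeff p = 1 \<and> set (coeffs p) \<subseteq> A \<and> poly p x = 0}"

definition nz_primes :: "'a::alg_closed_field set \<Rightarrow> 'a set set" where
  "nz_primes A = {P. primeideal P (sub_of A) \<and> P \<noteq> {0}}"

definition primes_above ::
    "'a::alg_closed_field set \<Rightarrow> 'a set \<Rightarrow> 'a set \<Rightarrow> 'a set set" where
  "primes_above A B p = {P \<in> nz_primes B. P \<inter> A = p}"

definition inertia_degree ::
    "'a::alg_closed_field set \<Rightarrow> 'a set \<Rightarrow> 'a set \<Rightarrow> nat" where
  "inertia_degree A B P =
     ring.dim (sub_of B Quot P)
       ((\<lambda>a. P +>\<^bsub>sub_of B\<^esub> a) ` A) (carrier (sub_of B Quot P))"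
  \<comment> \<open>the image of \<open>A\<close> in \<open>B / P\<close> is the residue field \<open>A / (P \<inter> A)\<close>\<close>

text \<open>
  The primes above a given prime form a finite set, so \<open>mset_set\<close> does not degenerate. Ramification
  indices play no role: each prime contributes its inertia degree once.
\<close>

definition splitting_type ::
    "'a::alg_closed_field set \<Rightarrow> 'a \<Rightarrow> 'a set \<Rightarrow> 'a set \<Rightarrow> nat list" where
  "splitting_type F t K p =
     (let A = poly_subring F t; B = integral_closure A K
      in sorted_list_of_multiset
           (image_mset (inertia_degree A B) (mset_set (primes_above A B p))))"


definition ideal_norm :: "'a::alg_closed_field set \<Rightarrow> 'a set \<Rightarrow> nat" where
  "ideal_norm A p = card (carrier (sub_of A Quot p))"

text \<open>
  For \<open>A = F[t]\<close> with \<open>F\<close> finite, both series converge absolutely for every real \<open>s > 1\<close>, so the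
  unconditional sums are the intended ones.
\<close>

definition has_dirichlet_density ::
    "'a::alg_closed_field set \<Rightarrow> 'a set set \<Rightarrow> real \<Rightarrow> bool" where
  "has_dirichlet_density A S \<delta> \<longleftrightarrow>
     ((\<lambda>s::real. (\<Sum>\<^sub>\<infinity>p\<in>S. real (ideal_norm A p) powr (- s)) /
                 (\<Sum>\<^sub>\<infinity>p\<in>nz_primes A. real (ideal_norm A p) powr (- s)))
        \<longlongrightarrow> \<delta>) (at_right 1)"

definition arith_equivalent ::
    "'a::alg_closed_field set \<Rightarrow> 'a \<Rightarrow> 'a set \<Rightarrow> 'a set \<Rightarrow> bool" where
  "arith_equivalent F t K L \<longleftrightarrow>
     (\<exists>S \<subseteq> nz_primes (poly_subring F t).
        has_dirichlet_density (poly_subring F t) S 0 \<and>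
        (\<forall>p \<in> nz_primes (poly_subring F t) - S.
           splitting_type F t K p = splitting_type F t L p))"

definition arith_equivalent_siblings ::
    "'a::alg_closed_field set \<Rightarrow> 'a \<Rightarrow> 'a set \<Rightarrow> 'a set \<Rightarrow> bool" where
  "arith_equivalent_siblings F t K L \<longleftrightarrow>
     finite_separable (rat_subfield F t) K \<and> finite_separable (rat_subfield F t) L \<and>
     arith_equivalent F t K L \<and> \<not> isomorphic_over (rat_subfield F t) K L"

definition field_of_constants :: "'a::alg_closed_field set \<Rightarrow> 'a set \<Rightarrow> 'a set" where
  "field_of_constants F K = {x \<in> K. ring.algebraic amb F x}"

definition geometric :: "'a::alg_closed_field set \<Rightarrow> 'a set \<Rightarrow> bool" where
  "geometric F K \<longleftrightarrow> field_of_constants F K = F"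


definition normal_over :: "'a::alg_closed_field set \<Rightarrow> 'a set \<Rightarrow> bool" where
  "normal_over k N \<longleftrightarrow>
     (\<forall>x\<in>N. \<exists>p. is_min_poly k x p \<and> (\<forall>y. poly p y = 0 \<longrightarrow> y \<in> N))"

text \<open>The smallest normal extension of \<open>k\<close> containing \<open>K\<close>, used for separable \<open>K\<close>.\<close>

definition galois_closure :: "'a::alg_closed_field set \<Rightarrow> 'a set \<Rightarrow> 'a set" where
  "galois_closure k K = \<Inter>{N. subfield N amb \<and> K \<subseteq> N \<and> normal_over k N}"

definition aut_group ::
    "'a::alg_closed_field set \<Rightarrow> 'a set \<Rightarrow> ('a \<Rightarrow> 'a) monoid" where
  "aut_group k N = BijGroup N
     \<lparr>carrier := {\<sigma> \<in> Bij N. \<sigma> \<in> ring_hom (sub_of N) (sub_of N) \<and> (\<forall>x\<in>k. \<sigma> x = x)}\<rparr>"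

definition galois_group ::
    "'a::alg_closed_field set \<Rightarrow> 'a set \<Rightarrow> ('a \<Rightarrow> 'a) monoid" where
  "galois_group k K = aut_group k (galois_closure k K)"

text \<open>
  The semidirect product of \<open>\<int>/n\<close> with its unit group \<open>(\<int>/n)\<^sup>*\<close> acting by multiplication;
  \<open>(a, u)\<close> stands for the affine map \<open>x \<mapsto> a + u x\<close>. For \<open>n = 8\<close> the unit group is
  \<open>{1, 3, 5, 7}\<close>, a Klein four-group.
\<close>

definition affine_group_mod :: "int \<Rightarrow> (int \<times> int) monoid" where
  "affine_group_mod n = (let R = residue_ring n in
     \<lparr>carrier = carrier R \<times> Units R,
      monoid.mult = (\<lambda>(a, u) (b, v). (a \<oplus>\<^bsub>R\<^esub> u \<otimes>\<^bsub>R\<^esub> b, u \<otimes>\<^bsub>R\<^esub> v)),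
      one = (\<zero>\<^bsub>R\<^esub>, \<one>\<^bsub>R\<^esub>)\<rparr>)"


type_synonym Omega = "bit poly fract alg_closure"

definition T :: Omega where
  "T = to_ac (to_fract [:0, 1:])"

abbreviation F2 :: "Omega set" where "F2 \<equiv> GF 2"
abbreviation F4 :: "Omega set" where "F4 \<equiv> GF 4"

definition polK :: "Omega poly" where
  "polK = [: T^10 + T^8 + T^6, T^7 + T^4, T^7 + T^5 + T^3 + T^2, T,
             T^5 + T^4 + T^3 + T^2 + T + 1, T, T, 0, 1 :]"

definition polK' :: "Omega poly" where
  "polK' = [: T^12 + T^11 + T^9 + T^7 + T^6, T^4, T^5 + T^4 + T^3 + T^2, T,
              T^5 + T^3 + T^2 + T + 1, T, T, 0, 1 :]"

definition generated_by_root ::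
    "'a::alg_closed_field set \<Rightarrow> 'a poly \<Rightarrow> 'a set \<Rightarrow> bool" where
  "generated_by_root k f K \<longleftrightarrow> (\<exists>\<alpha>. poly f \<alpha> = 0 \<and> K = generate_field amb (insert \<alpha> k))"

end

theory Submission
  imports Defs
begin

text \<open>
  Let \<open>w\<^sup>2 + w = 1\<close> and \<open>y\<^sup>2 + y = w T\<close>. The roots of the two octics are the solutions \<open>x\<close> of
  \<open>x\<^sup>2 + x = (w T + T\<^sup>2) y\<close> and of \<open>x\<^sup>2 + x = (w T + T\<^sup>2) y + T\<^sup>3\<close>; each of them generates \<open>w\<close> and
  \<open>y\<close>. So both fields are towers of Artin--Schreier extensions, unramified at the finite primes, with
  integral closure \<open>F\<^sub>2[T][w, y, x]\<close>, and the primes over a root \<open>t\<close> correspond to Frobenius orbits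
  of points of the fibre over \<open>t\<close>. With \<open>s\<^sup>2 + s = T\<close> and \<open>d\<^sup>2 + d = T\<^sup>3\<close> the common Galois closure
  is \<open>F\<^sub>2(T)(w, y, x, s, d)\<close>, and the solution of the second equation is \<open>x + d\<close>.

  One of \<open>t\<close>, \<open>t\<^sup>3\<close>, \<open>t + t\<^sup>3\<close> has trace zero in \<open>F\<^sub>2(t)\<close>, and each case yields a bijection of the two
  fibres that is defined over \<open>F\<^sub>2(t)\<close>; hence all splitting types over \<open>F\<^sub>2(T)\<close> agree. Over
  \<open>F\<^sub>4(T)\<close> the value of \<open>w\<close> is fixed and these bijections are no longer available: trace conditions on
  \<open>w t\<close>, \<open>t\<close> and \<open>t\<^sup>3\<close> that hold for a positive proportion of all \<open>t\<close> force one field, but not the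
  other, to have a prime of inertia degree one. The latter also excludes an isomorphism: \<open>K'\<close> would
  be generated by a root of the octic of \<open>K\<close>, and hence fail to be arithmetically equivalent to itself.
\<close>

section \<open>Characteristic two\<close>

text \<open>Write (a,u) for the map x -> a + u x of Z/8. Then \<open>K\<close> is the fixed field of
  {(0,1), (0,3), (0,5), (0,7)} and \<open>K'\<close> of {(0,1), (4,3), (4,5), (0,7)}: translation by
  4 sends x to x + 1, and the units 3 and 5 send d to d + 1. Translation by 2 conjugates (0,3) to
  (4,3) and translation by 1 conjugates (0,5) to (4,5), but no translation does both. So every
  Frobenius element sees the same orbits, and the three bijections of fibres are the translations by
  0, 1 and 2, corrected by d. Odd translations move w, hence over F_4(T) the element (0,5) loses its
  partner, and there the splitting types separate. The roots are arbitrary, so \<open>K\<close> and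
  \<open>K'\<close> may carry equal or conjugate values of w. Over F_4(T) these are different
  situations, each with its own condition on t. Chebotarev's theorem is avoided: Artin-Schreier
  equations turn splitting into trace conditions, which are counted in each finite field, and a
  fixed proportion of the primes of every large degree contradicts density zero.\<close>

lemma Omega_add_self [simp]: "(x::Omega) + x = 0"
proof -
  have "(1::bit poly) + 1 = 0" by (simp add: one_pCons)
  hence "to_ac (to_fract ((1::bit poly) + 1)) = (0::Omega)" by (simp only: to_fract_0 to_ac_0)
  hence "(1::Omega) + 1 = 0" by (simp only: to_fract_add to_ac_add to_fract_1 to_ac_1)
  hence "x * (1 + 1) = 0" by (simp only: mult_zero_right)
  thus ?thesis by (simp only: distrib_left mult_1_right)
qed

text \<open>AC-normalised sums nest to the right, so cancellation is needed in this form as well as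
  in \<open>Omega_add_self\<close>. Together the rules let \<open>algebra_simps\<close> verify
  polynomial identities in characteristic two.\<close>

lemma Omega_add_self_left [simp]: "(x::Omega) + (x + y) = y"
  by (simp flip: add.assoc)

lemma Omega_uminus [simp]: "- (x::Omega) = x"
  by (metis Omega_add_self add_eq_0_iff)

lemma Omega_diff [simp]: "(x::Omega) - y = x + y"
  by (metis Omega_uminus diff_minus_eq_add)

lemma Omega_two [simp]: "(2::Omega) = 0"
  by (metis Omega_add_self one_add_one)

lemma Omega_add_eq_0 [simp]: "(x::Omega) + y = 0 \<longleftrightarrow> x = y"
  by (metis Omega_add_self add_right_cancel)

lemma Omega_power2_add: "((x::Omega) + y)\<^sup>2 = x\<^sup>2 + y\<^sup>2"
  by (simp add: power2_sum)

lemma Omega_frob_add: "((x::Omega) + y) ^ (2 ^ n) = x ^ (2 ^ n) + y ^ (2 ^ n)"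
  by (induction n) (simp_all add: power_mult mult.commute[of 2] Omega_power2_add)

lemma AS_roots:
  assumes "(x::Omega)\<^sup>2 + x = a" "y\<^sup>2 + y = a" shows "y = x \<or> y = x + 1"
proof -
  have "(x + y) * (x + y + 1) = (x\<^sup>2 + x) + (y\<^sup>2 + y)"
    by (simp add: algebra_simps power2_eq_square)
  also have "\<dots> = 0" using assms by simp
  finally have "x + y = 0 \<or> x + y + 1 = 0" by simp
  moreover have "x + (x + y) = y" by simp
  ultimately show ?thesis by (metis Omega_add_eq_0 add.right_neutral)
qed

lemma alg_closed_AS: "\<exists>x::Omega. x\<^sup>2 + x = a"
proof -
  have "\<exists>x. poly [:a, 1, 1:] x = 0" by (rule alg_closed_imp_poly_has_root) auto
  then obtain x where "a + (x + x * x) = 0" by (auto simp: algebra_simps)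
  hence "x\<^sup>2 + x = a" unfolding Omega_add_eq_0 by (simp add: power2_eq_square add.commute)
  thus ?thesis ..
qed

section \<open>Subfields of the ambient field\<close>

lemma amb_simps [simp]:
  "carrier (amb::'a::alg_closed_field ring) = UNIV"
  "x \<otimes>\<^bsub>amb\<^esub> y = x * y" "x \<oplus>\<^bsub>amb\<^esub> y = x + y" "\<one>\<^bsub>amb\<^esub> = 1" "\<zero>\<^bsub>amb\<^esub> = 0"
  by (simp_all add: ring_of_type_algebra_def)

lemma amb_field: "field (amb::'a::alg_closed_field ring)" by (rule field_from_type_algebra)

interpretation amb: cring "amb::'a::alg_closed_field ring" by (rule cring_from_type_algebra)

lemma amb_uminus [simp]: "\<ominus>\<^bsub>amb\<^esub> x = - (x::'a::alg_closed_field)"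
  by (rule amb.minus_equality) auto

lemma amb_inv [simp]: "x \<noteq> 0 \<Longrightarrow> inv\<^bsub>amb\<^esub> x = inverse (x::'a::alg_closed_field)"
  by (rule amb.comm_inv_char) auto

text \<open>Negation is the identity in characteristic two, so closure under sums already gives an
  additive group. The set-theoretic form keeps later arguments free of ring records.\<close>

definition is_subring :: "Omega set \<Rightarrow> bool" where
  "is_subring A \<longleftrightarrow> 0 \<in> A \<and> 1 \<in> A \<and> (\<forall>x\<in>A. \<forall>y\<in>A. x + y \<in> A \<and> x * y \<in> A)"

definition is_subfield :: "Omega set \<Rightarrow> bool" where
  "is_subfield A \<longleftrightarrow> is_subring A \<and> (\<forall>x\<in>A. inverse x \<in> A)"

lemma is_subringD:
  assumes "is_subring A"
  shows "0 \<in> A" "1 \<in> A" "x \<in> A \<Longrightarrow> y \<in> A \<Longrightarrow> x + y \<in> A" "x \<in> A \<Longrightarrow> y \<in> A \<Longrightarrow> x * y \<in> A"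
  using assms by (auto simp: is_subring_def)

lemma is_subring_power: "is_subring A \<Longrightarrow> x \<in> A \<Longrightarrow> x ^ n \<in> A"
  by (induction n) (auto simp: is_subringD)

lemma is_subring_sum: "is_subring A \<Longrightarrow> (\<And>i. i \<in> I \<Longrightarrow> f i \<in> A) \<Longrightarrow> sum f I \<in> A"
  by (induction I rule: infinite_finite_induct) (auto simp: is_subringD)

lemma is_subring_prod: "is_subring A \<Longrightarrow> (\<And>i. i \<in> I \<Longrightarrow> f i \<in> A) \<Longrightarrow> prod f I \<in> A"
  by (induction I rule: infinite_finite_induct) (auto simp: is_subringD)

lemma is_subfieldD:
  assumes "is_subfield A"
  shows "0 \<in> A" "1 \<in> A" "x \<in> A \<Longrightarrow> y \<in> A \<Longrightarrow> x + y \<in> A" "x \<in> A \<Longrightarrow> y \<in> A \<Longrightarrow> x * y \<in> A"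
    "x \<in> A \<Longrightarrow> inverse x \<in> A" "x \<in> A \<Longrightarrow> y \<in> A \<Longrightarrow> x / y \<in> A" "is_subring A"
  using assms by (auto simp: is_subfield_def is_subring_def divide_inverse)

lemma subring_amb_iff: "subring A (amb::Omega ring) \<longleftrightarrow> is_subring A"
proof
  assume "subring A (amb::Omega ring)"
  then show "is_subring A"
    using subringE[of A "amb::Omega ring"] by (auto simp: is_subring_def)
next
  assume "is_subring A"
  thus "subring A (amb::Omega ring)"
    by (intro amb.subringI) (auto simp: is_subring_def)
qed

lemma subfield_amb_iff: "subfield A (amb::Omega ring) \<longleftrightarrow> is_subfield A"
proof
  assume *: "subfield A (amb::Omega ring)"
  have "inverse x \<in> A" if "x \<in> A" for x
  proof (cases "x = 0")
    case False
    then show ?thesis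
      using amb.subfield_m_inv(1)[OF *, of x] that by auto
  qed (use that in auto)
  thus "is_subfield A"
    using subfieldE(1)[OF *] by (auto simp: is_subfield_def subring_amb_iff)
next
  assume *: "is_subfield A"
  hence "subring A (amb::Omega ring)" by (simp add: subring_amb_iff is_subfield_def)
  thus "subfield A (amb::Omega ring)"
    using * by (intro field.subfieldI'[OF amb_field]) (auto simp: is_subfield_def)
qed

lemma is_subfield_generate_field: "is_subfield (generate_field (amb::Omega ring) H)"
  unfolding subfield_amb_iff[symmetric] by (rule field.generate_field_is_subfield[OF amb_field]) auto

lemma generate_field_least:
  "is_subfield E \<Longrightarrow> H \<subseteq> E \<Longrightarrow> generate_field (amb::Omega ring) H \<subseteq> E"
  by (rule field.generate_field_min_subfield1[OF amb_field]) (auto simp: subfield_amb_iff)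

lemma is_subring_generate_ring: "is_subring (generate_ring (amb::Omega ring) H)"
  unfolding subring_amb_iff[symmetric] by (rule amb.generate_ring_is_subring) auto

lemma generate_ring_least:
  "is_subring E \<Longrightarrow> H \<subseteq> E \<Longrightarrow> generate_ring (amb::Omega ring) H \<subseteq> E"
  by (rule amb.generate_ring_min_subring1) (auto simp: subring_amb_iff)

lemma cring_sub_of: "is_subring A \<Longrightarrow> cring (sub_of (A::Omega set))"
  by (rule amb.subcring_iff[THEN iffD1, OF _ amb.subcringI'])
     (auto simp: subring_amb_iff amb.cring_axioms)

section \<open>Polynomials with coefficients in a subring\<close>

definition polys :: "Omega set \<Rightarrow> Omega poly set" where
  "polys F = {p. \<forall>i. coeff p i \<in> F}"

lemma set_coeffs_subset_iff: "is_subring F \<Longrightarrow> set (coeffs p) \<subseteq> F \<longleftrightarrow> p \<in> polys F"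
proof -
  assume F: "is_subring F"
  have "p \<in> polys F \<longleftrightarrow> range (coeff p) \<subseteq> F" by (auto simp: polys_def)
  thus ?thesis using is_subringD(1)[OF F] by (simp add: range_coeff)
qed

lemma polys_mono: "F \<subseteq> G \<Longrightarrow> polys F \<subseteq> polys G"
  by (auto simp: polys_def)

lemma polys_closed:
  assumes F: "is_subring F"
  shows "0 \<in> polys F" "1 \<in> polys F" "c \<in> F \<Longrightarrow> [:c:] \<in> polys F"
    "p \<in> polys F \<Longrightarrow> q \<in> polys F \<Longrightarrow> p + q \<in> polys F"
    "p \<in> polys F \<Longrightarrow> q \<in> polys F \<Longrightarrow> p - q \<in> polys F"
    "p \<in> polys F \<Longrightarrow> q \<in> polys F \<Longrightarrow> p * q \<in> polys F"
    "c \<in> F \<Longrightarrow> p \<in> polys F \<Longrightarrow> smult c p \<in> polys F"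
    "c \<in> F \<Longrightarrow> monom c n \<in> polys F"
    "c \<in> F \<Longrightarrow> p \<in> polys F \<Longrightarrow> pCons c p \<in> polys F"
  using is_subringD[OF F]
  by (auto simp: polys_def coeff_mult coeff_pCons split: nat.splits intro!: is_subring_sum[OF F])

lemma polys_power: "is_subring F \<Longrightarrow> p \<in> polys F \<Longrightarrow> p ^ n \<in> polys F"
  by (induction n) (auto simp: polys_closed)

lemma polys_eval: "is_subring F \<Longrightarrow> p \<in> polys F \<Longrightarrow> x \<in> F \<Longrightarrow> poly p x \<in> F"
  unfolding poly_altdef by (intro is_subring_sum) (auto simp: polys_def is_subring_power is_subringD)

text \<open>Long division carried out inside the subfield \<open>F\<close>: leading terms cancel
  with a factor from \<open>F\<close>, so quotient and remainder keep their coefficients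
  there.\<close>

lemma polys_division:
  assumes F: "is_subfield F" and "m \<in> polys F" "m \<noteq> 0" "p \<in> polys F"
  shows "\<exists>q r. q \<in> polys F \<and> r \<in> polys F \<and> p = q * m + r \<and> (r = 0 \<or> degree r < degree m)"
  using assms(4)
proof (induction "degree p" arbitrary: p rule: less_induct)
  case less
  note Fr = is_subfieldD(7)[OF F]
  show ?case
  proof (cases "p = 0 \<or> degree p < degree m")
    case True
    thus ?thesis using less.prems by (intro exI[of _ 0] exI[of _ p]) (auto simp: polys_closed Fr)
  next
    case False
    define c where "c = lead_coeff p / lead_coeff m"
    define p' where "p' = p - monom c (degree p - degree m) * m"
    have c: "c \<in> F" using less.prems assms(2) is_subfieldD(6)[OF F] by (auto simp: c_def polys_def)
    hence p': "p' \<in> polys F" unfolding p'_def using less.prems assms(2)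
      by (intro polys_closed Fr)
    have "p' = 0 \<or> degree p' < degree p"
    \<comment> \<open>For constants the degree cannot drop, but the difference is then zero.\<close>
    proof (cases "degree p = 0")
      case True
      hence "degree m = 0" using False by auto
      with True obtain a b where "p = [:a:]" "m = [:b:]" by (metis degree_eq_zeroE)
      thus ?thesis using \<open>m \<noteq> 0\<close> by (simp add: p'_def c_def monom_0)
    next
      case d: False
      have "degree p' < degree p"
      proof (rule degree_lessI)
        show "p' \<noteq> 0 \<or> 0 < degree p" using d by simp
        show "\<forall>k\<ge>degree p. coeff p' k = 0"
        proof safe
          fix k assume k: "k \<ge> degree p"
          show "coeff p' k = 0"
          proof (cases "k = degree p")
            case True
            then show ?thesis using False \<open>m \<noteq> 0\<close>
              by (simp add: p'_def coeff_monom_mult c_def)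
          next
            case False2: False
            have "coeff p k = 0" "coeff m (k - (degree p - degree m)) = 0"
              using k False2 False by (auto intro!: coeff_eq_0)
            then show ?thesis by (simp add: p'_def coeff_monom_mult)
          qed
        qed
      qed
      thus ?thesis ..
    qed
    then consider "p' = 0" | "degree p' < degree p" by blast
    then obtain q r where qr: "q \<in> polys F" "r \<in> polys F" "p' = q * m + r" "r = 0 \<or> degree r < degree m"
    proof cases
      case 1
      then show ?thesis using that[of 0 0] by (auto simp: polys_closed Fr)
    next
      case 2
      from less.hyps[OF this p'] that show ?thesis by blast
    qed
    show ?thesis
      by (rule exI[of _ "q + monom c (degree p - degree m)"], rule exI[of _ r])
         (use qr c p'_def in \<open>auto simp: polys_closed Fr algebra_simps\<close>)
  qed
qed

text \<open>The alternative \<open>p = 0\<close> makes the count right for \<open>n = 0\<close>,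
  since the zero polynomial has degree 0.\<close>

lemma bij_betw_polys_below:
  assumes F: "is_subring F"
  shows "bij_betw (\<lambda>p. \<lambda>i\<in>{..<n}. coeff p i) {p \<in> polys F. p = 0 \<or> degree p < n} ({..<n} \<rightarrow>\<^sub>E F)"
proof (rule bij_betwI')
  fix p q assume "p \<in> {p \<in> polys F. p = 0 \<or> degree p < n}" "q \<in> {p \<in> polys F. p = 0 \<or> degree p < n}"
  hence "coeff p i = 0 \<and> coeff q i = 0" if "i \<ge> n" for i
    using that by (cases "p = 0"; cases "q = 0") (auto intro!: coeff_eq_0)
  thus "((\<lambda>i\<in>{..<n}. coeff p i) = (\<lambda>i\<in>{..<n}. coeff q i)) = (p = q)"
    by (auto simp: poly_eq_iff fun_eq_iff restrict_def) (metis leI)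
next
  fix p assume "p \<in> {p \<in> polys F. p = 0 \<or> degree p < n}"
  thus "(\<lambda>i\<in>{..<n}. coeff p i) \<in> {..<n} \<rightarrow>\<^sub>E F" by (auto simp: polys_def)
next
  fix f assume f: "f \<in> {..<n} \<rightarrow>\<^sub>E F"
  define p where "p = (\<Sum>i<n. monom (f i) i)"
  have c: "coeff p i = (if i < n then f i else 0)" for i
    by (simp add: p_def coeff_sum)
  have "p \<in> polys F" using f is_subringD(1)[OF F] by (auto simp: polys_def c)
  moreover have "p = 0 \<or> degree p < n"
    by (metis c leI leading_coeff_0_iff)
  moreover have "f = (\<lambda>i\<in>{..<n}. coeff p i)"
    using f by (auto simp: fun_eq_iff c PiE_def extensional_def)
  ultimately show "\<exists>p\<in>{p \<in> polys F. p = 0 \<or> degree p < n}. f = (\<lambda>i\<in>{..<n}. coeff p i)" by blast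
qed

lemma card_polys_below:
  assumes "is_subring F" "finite F"
  shows "card {p \<in> polys F. p = 0 \<or> degree p < n} = card F ^ n"
    and "finite {p \<in> polys F. p = 0 \<or> degree p < n}"
  using bij_betw_same_card[OF bij_betw_polys_below[OF assms(1), of n]]
    bij_betw_finite[OF bij_betw_polys_below[OF assms(1), of n]] assms(2)
  by (auto simp: card_PiE finite_PiE)

section \<open>Transcendental elements and rational functions\<close>

definition Pol :: "Omega set \<Rightarrow> Omega \<Rightarrow> Omega set" where
  "Pol F t = (\<lambda>p. poly p t) ` polys F"

definition Rat :: "Omega set \<Rightarrow> Omega \<Rightarrow> Omega set" where
  "Rat F t = {a / b | a b. a \<in> Pol F t \<and> b \<in> Pol F t \<and> b \<noteq> 0}"

definition transc :: "Omega set \<Rightarrow> Omega \<Rightarrow> bool" where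
  "transc F t \<longleftrightarrow> (\<forall>p \<in> polys F. poly p t = 0 \<longrightarrow> p = 0)"

lemma is_subring_Pol: "is_subring F \<Longrightarrow> is_subring (Pol F t)"
proof -
  assume F: "is_subring F"
  show ?thesis
    unfolding is_subring_def
  proof (intro conjI ballI)
    have *: "poly a t \<in> Pol F t" if "a \<in> polys F" for a
      using that unfolding Pol_def by (rule imageI)
    show "0 \<in> Pol F t" "1 \<in> Pol F t"
      using *[OF polys_closed(1)[OF F]] *[OF polys_closed(2)[OF F]] by simp_all
    fix x y assume "x \<in> Pol F t" "y \<in> Pol F t"
    then obtain a b where ab: "x = poly a t" "y = poly b t" "a \<in> polys F" "b \<in> polys F"
      unfolding Pol_def by blast
    show "x + y \<in> Pol F t" "x * y \<in> Pol F t"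
      using *[OF polys_closed(4)[OF F ab(3,4)]] *[OF polys_closed(6)[OF F ab(3,4)]] ab(1,2) by simp_all
  qed
qed

lemma Pol_contains: "is_subring F \<Longrightarrow> F \<subseteq> Pol F t" "is_subring F \<Longrightarrow> t \<in> Pol F t"
proof -
  assume F: "is_subring F"
  show "F \<subseteq> Pol F t"
  proof
    fix x assume "x \<in> F"
    thus "x \<in> Pol F t" unfolding Pol_def by (intro image_eqI[of _ _ "[:x:]"]) (auto simp: polys_closed F)
  qed
  show "t \<in> Pol F t"
    unfolding Pol_def by (intro image_eqI[of _ _ "[:0,1:]"]) (auto simp: polys_closed F is_subringD)
qed

lemma Pol_least: "is_subring E \<Longrightarrow> F \<subseteq> E \<Longrightarrow> t \<in> E \<Longrightarrow> Pol F t \<subseteq> E"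
  unfolding Pol_def by (rule image_subsetI) (rule polys_eval, auto dest: polys_mono)

lemma poly_subring_eq_Pol:
  assumes "is_subring F"
  shows "poly_subring F t = Pol F t"
  unfolding poly_subring_def
proof
  show "generate_ring amb (insert t F) \<subseteq> Pol F t"
    using Pol_contains[OF assms] by (intro generate_ring_least is_subring_Pol assms) auto
  show "Pol F t \<subseteq> generate_ring amb (insert t F)"
    by (intro Pol_least is_subring_generate_ring subsetI generate_ring.incl) auto
qed

lemma is_subfield_Rat:
  assumes "is_subring F"
  shows "is_subfield (Rat F t)"
proof -
  note P = is_subring_Pol[OF assms, of t]
  note D = is_subringD[OF P]
  have "x + y \<in> Rat F t \<and> x * y \<in> Rat F t" if xy: "x \<in> Rat F t" "y \<in> Rat F t" for x y
  proof -
    from xy obtain a b c d where *: "x = a / b" "y = c / d" "a \<in> Pol F t" "b \<in> Pol F t"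
      "c \<in> Pol F t" "d \<in> Pol F t" "b \<noteq> 0" "d \<noteq> 0" by (auto simp: Rat_def)
    have "x + y = (a * d + c * b) / (b * d)" "x * y = (a * c) / (b * d)"
      using * by (auto simp: field_simps)
    thus ?thesis unfolding Rat_def mem_Collect_eq using * D
      by (metis (no_types, lifting) mult_eq_0_iff)
  qed
  moreover have "inverse x \<in> Rat F t" if "x \<in> Rat F t" for x
  proof (cases "x = 0")
    case False
    from that obtain a b where *: "x = a / b" "a \<in> Pol F t" "b \<in> Pol F t" "b \<noteq> 0" by (auto simp: Rat_def)
    with False have "inverse x = b / a" "a \<noteq> 0" by auto
    thus ?thesis using * unfolding Rat_def by blast
  qed (use that in auto)
  moreover have "0 \<in> Rat F t" "1 \<in> Rat F t"
    unfolding Rat_def mem_Collect_eq using D(1,2) by (metis div_by_1 zero_neq_one)+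
  ultimately show ?thesis by (auto simp: is_subfield_def is_subring_def)
qed

lemma Pol_subset_Rat: "is_subring F \<Longrightarrow> Pol F t \<subseteq> Rat F t"
  using is_subringD(2)[OF is_subring_Pol] by (force simp: Rat_def)

lemma Rat_least: "is_subfield E \<Longrightarrow> F \<subseteq> E \<Longrightarrow> t \<in> E \<Longrightarrow> Rat F t \<subseteq> E"
  using Pol_least[of E F t] is_subfieldD(6,7)[of E] unfolding Rat_def by blast

lemma rat_subfield_eq_Rat:
  assumes "is_subring F"
  shows "rat_subfield F t = Rat F t"
  unfolding rat_subfield_def
proof
  show "generate_field amb (insert t F) \<subseteq> Rat F t"
    using Pol_contains[OF assms] Pol_subset_Rat[OF assms]
    by (intro generate_field_least is_subfield_Rat assms) blast
  show "Rat F t \<subseteq> generate_field amb (insert t F)"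
    by (intro Rat_least is_subfield_generate_field subsetI generate_field.incl) auto
qed

lemma finite_Pol_algebraic:
  assumes F: "is_subfield F" "finite F" and p: "p \<in> polys F" "p \<noteq> 0" "poly p z = 0"
  shows "finite (Pol F z)"
proof (rule finite_subset)
  show "Pol F z \<subseteq> (\<lambda>p. poly p z) ` {r \<in> polys F. r = 0 \<or> degree r < degree p}"
  proof
    fix y assume "y \<in> Pol F z"
    then obtain a where "a \<in> polys F" "y = poly a z" by (auto simp: Pol_def)
    with polys_division[OF F(1) p(1,2), of a] p(3)
    obtain r where "r \<in> polys F" "r = 0 \<or> degree r < degree p" "y = poly r z" by auto
    thus "y \<in> (\<lambda>p. poly p z) ` {r \<in> polys F. r = 0 \<or> degree r < degree p}" by blast
  qed
  show "finite ((\<lambda>p. poly p z) ` {r \<in> polys F. r = 0 \<or> degree r < degree p})"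
    using card_polys_below(2)[OF is_subfieldD(7)[OF F(1)] F(2)] by auto
qed

text \<open>If z were algebraic over the finite field \<open>F\<close>, then F[z] would be finite
  and could not contain infinitely many powers of u. With u = T this makes every z transcendental in
  which T is a polynomial.\<close>

lemma transc_if_Pol_contains:
  assumes F: "is_subfield F" "finite F" and "u \<in> Pol F z" and "inj (\<lambda>n. u ^ n)"
  shows "transc F z"
  unfolding transc_def
proof (intro ballI impI, rule ccontr)
  fix p assume "p \<in> polys F" "poly p z = 0" "p \<noteq> 0"
  hence "finite (Pol F z)" using finite_Pol_algebraic F by blast
  moreover have "range (\<lambda>n. u ^ n) \<subseteq> Pol F z"
    using is_subring_power[OF is_subring_Pol[OF is_subfieldD(7)[OF F(1)]] assms(3)] by auto
  ultimately show False using assms(4) finite_subset range_inj_infinite by metis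
qed

lemma T_power_inj: "inj (\<lambda>n. T ^ n)"
proof (rule injI)
  fix m n assume "T ^ m = T ^ n"
  moreover have pow: "to_fract (p ^ k) = to_fract p ^ k" for p :: "bit poly" and k
    by (induction k) auto
  hence "T ^ k = to_ac (to_fract ([:0,1:] ^ k))" for k
    by (simp add: T_def)
  ultimately have "([:0,1:] :: bit poly) ^ m = [:0,1:] ^ n" by simp
  hence "degree (([:0,1:] :: bit poly) ^ m) = degree (([:0,1:]:: bit poly) ^ n)" by simp
  thus "m = n" by (simp add: degree_power_eq)
qed

lemma transc_T: "is_subfield F \<Longrightarrow> finite F \<Longrightarrow> transc F T"
  by (rule transc_if_Pol_contains[of F T]) (auto simp: Pol_contains is_subfieldD T_power_inj)

text \<open>For z = a/b in lowest or any other terms, clearing denominators gives a (a + b) = h b^2.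
  If deg a > deg b, the left side has degree 2 deg a, against the odd degree of h; otherwise its
  degree is at most 2 deg b, which forces deg h = 0. This is the criterion of an odd pole order at
  infinity.\<close>

lemma AS_odd_degree:
  assumes F: "is_subfield F" and t: "transc F t" and h: "h \<in> polys F" "odd (degree h)"
    and z: "z \<in> Rat F t"
  shows "z\<^sup>2 + z \<noteq> poly h t"
proof
  assume eq: "z\<^sup>2 + z = poly h t"
  note Fr = is_subfieldD(7)[OF F]
  from z obtain a b where ab: "a \<in> polys F" "b \<in> polys F" "poly b t \<noteq> 0" "z = poly a t / poly b t"
    by (auto simp: Rat_def Pol_def)
  have "poly a t * poly a t + poly a t * poly b t = poly h t * (poly b t * poly b t)"
    using eq ab(3) unfolding ab(4) by (simp add: field_simps power2_eq_square)
  hence "poly (a * a + a * b + h * (b * b)) t = 0" by simp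
  moreover have "a * a + a * b + h * (b * b) \<in> polys F"
    by (intro polys_closed Fr ab h)
  ultimately have "a * a + a * b + h * (b * b) = 0" using t by (auto simp: transc_def)
  hence "a * (a + b) + h * (b * b) = 0" by (simp only: distrib_left)
  hence e: "a * (a + b) = - (h * (b * b))" by (simp only: eq_neg_iff_add_eq_0)
  have b0: "b \<noteq> 0" using ab by auto
  have h0: "h \<noteq> 0" using h by auto
  have R: "degree (- (h * (b * b))) = degree h + 2 * degree b" using b0 h0 by (simp add: degree_mult_eq)
  have "- (h * (b * b)) \<noteq> 0" using b0 h0 by simp
  hence a0: "a \<noteq> 0" "a + b \<noteq> 0" using e by auto
  have L: "degree (a * (a + b)) = degree a + degree (a + b)" using a0 by (simp add: degree_mult_eq)
  have E: "degree a + degree (a + b) = degree h + 2 * degree b" using e L R by metis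
  show False
  proof (cases "degree a > degree b")
    case True
    hence "degree (a + b) = degree a" by (simp add: degree_add_eq_left)
    with E have "2 * degree a = degree h + 2 * degree b" by simp
    with h(2) show False by presburger
  next
    case False
    hence "degree (a + b) \<le> degree b" by (intro degree_add_le) auto
    with E False have "degree h = 0" by simp
    with h(2) show False by simp
  qed
qed

section \<open>Finite fields\<close>

text \<open>Over an algebraically closed field the roots form a multiset of size deg p, and a
  repeated root would also be a root of the derivative.\<close>

lemma card_roots_alg_closed:
  fixes p :: "'a :: alg_closed_field poly"
  assumes "p \<noteq> 0" and "\<And>x. poly p x = 0 \<Longrightarrow> poly (pderiv p) x \<noteq> 0"
  shows "card {x. poly p x = 0} = degree p"
proof -
  obtain A where A: "size A = degree p" "p = smult (lead_coeff p) (\<Prod>x\<in>#A. [:-x, 1:])"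
    using alg_closed_imp_factorization[OF assms(1)] by blast
  have c: "lead_coeff p \<noteq> 0" using assms(1) by simp
  have roots: "{x. poly p x = 0} = set_mset A"
  proof -
    have "poly p x = lead_coeff p * (\<Prod>y\<in>#A. x - y)" for x
      by (subst A(2)) (simp add: poly_prod_mset)
    thus ?thesis using c by (auto simp: image_iff)
  qed
  have "count A x \<le> 1" for x
  proof (rule ccontr)
    assume "\<not> count A x \<le> 1"
    hence "count A x \<ge> 2" by simp
    hence "A = add_mset x (add_mset x (A - {#x, x#}))"
      by (intro multiset_eqI) auto
    then obtain B where B: "A = add_mset x (add_mset x B)" ..
    define L where L: "L = [:-x, 1:]"
    have "p = smult (lead_coeff p) (L * (L * (\<Prod>x\<in>#B. [:-x, 1:])))"
      using A(2) unfolding B L image_mset_add_mset prod_mset.add_mset .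
    then obtain r where pL: "p = L * (L * r)" by (metis mult_smult_right)
    have "poly L x = 0" by (simp add: L)
    hence "poly p x = 0" "poly (pderiv p) x = 0" unfolding pL by (simp_all add: pderiv_mult)
    with assms(2) show False by blast
  qed
  hence "count A x = 1" if "x \<in># A" for x
    using that by (metis count_greater_eq_one_iff le_antisym)
  hence "size A = (\<Sum>x\<in>set_mset A. 1)"
    unfolding size_multiset_overloaded_eq by (intro sum.cong) auto
  hence "card (set_mset A) = size A" by simp
  thus ?thesis using roots A by simp
qed

lemma is_subfield_GF: "is_subfield (GF (2 ^ k) :: Omega set)"
  unfolding is_subfield_def is_subring_def
  by (auto simp: GF_def Omega_frob_add power_mult_distrib power_inverse)

lemma is_subring_GF: "is_subring (GF (2 ^ k) :: Omega set)"
  using is_subfield_GF is_subfieldD(7) by blast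

text \<open>The set is the zero set of X^(2^k) + X, whose derivative is the constant 1 because 2^k
  vanishes for k > 0.\<close>

lemma card_GF:
  assumes "k > 0"
  shows "card (GF (2 ^ k) :: Omega set) = 2 ^ k" "finite (GF (2 ^ k) :: Omega set)"
proof -
  define p :: "Omega poly" where "p = monom 1 (2 ^ k) + [:0, 1:]"
  have k: "2 ^ k > (1::nat)" using assms one_less_power[of "2::nat" k] by simp
  have deg: "degree p = 2 ^ k"
    unfolding p_def using k by (subst degree_add_eq_left) (auto simp: degree_monom_eq)
  have "pderiv p = [:1:]"
    using assms by (simp add: p_def pderiv_add pderiv_monom pderiv_pCons)
  moreover have "GF (2 ^ k) = {x. poly p x = 0}"
    by (auto simp: GF_def p_def poly_monom)
  moreover have "p \<noteq> 0" using deg k by auto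
  ultimately show "card (GF (2 ^ k) :: Omega set) = 2 ^ k"
    using card_roots_alg_closed[of p] deg by simp
  thus "finite (GF (2 ^ k) :: Omega set)" by (metis card.infinite power_not_zero zero_neq_numeral)
qed

lemma GF2_eq: "GF 2 = {0, 1::Omega}"
proof -
  have "x \<in> GF 2 \<longleftrightarrow> x * (x + 1) = 0" for x :: Omega
    unfolding GF_def by (simp add: power2_eq_square algebra_simps)
  thus ?thesis by auto
qed

lemma GF4_eq:
  assumes "(w::Omega)\<^sup>2 + w = 1"
  shows "GF 4 = {0, 1, w, w + 1}"
proof -
  have "x \<in> GF 4 \<longleftrightarrow> x * (x + 1) * (x\<^sup>2 + x + 1) = 0" for x :: Omega
    unfolding GF_def by (simp add: power2_eq_square power4_eq_xxxx algebra_simps)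
  moreover have "x\<^sup>2 + x + 1 = 0 \<longleftrightarrow> x\<^sup>2 + x = 1" for x :: Omega by simp
  moreover have "(w + 1)\<^sup>2 + (w + 1) = w\<^sup>2 + w" by (simp add: Omega_power2_add ac_simps)
  with assms have "(w + 1)\<^sup>2 + (w + 1) = 1" by simp
  ultimately show ?thesis using AS_roots[OF assms] assms by auto
qed

lemma Omega_frob_add': "((x::Omega) + y) ^ ((2 ^ k) ^ i) = x ^ ((2 ^ k) ^ i) + y ^ ((2 ^ k) ^ i)"
  using Omega_frob_add[of x y "k * i"] by (simp add: power_mult)

lemma poly_frob:
  assumes "a \<in> polys (GF (2 ^ k))"
  shows "poly a x ^ ((2 ^ k) ^ i) = poly a (x ^ ((2 ^ k) ^ i))"
proof -
  have 1: "poly a x ^ (2 ^ k) = poly a (x ^ (2 ^ k))" for x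
  proof -
    have fsum: "(sum f A) ^ (2 ^ k) = (\<Sum>i\<in>A. f i ^ (2 ^ k))" for f :: "nat \<Rightarrow> Omega" and A
      by (induction A rule: infinite_finite_induct) (auto simp: Omega_frob_add)
    show ?thesis unfolding poly_altdef fsum using assms
      by (intro sum.cong) (auto simp: polys_def GF_def power_mult_distrib simp flip: power_mult, simp_all add: mult.commute)
  qed
  show ?thesis
  proof (induction i)
    case (Suc i)
    have "poly a x ^ ((2 ^ k) ^ Suc i) = (poly a x ^ ((2 ^ k) ^ i)) ^ (2 ^ k)"
      by (simp flip: power_mult add: mult.commute)
    also have "\<dots> = poly a ((x ^ ((2 ^ k) ^ i)) ^ (2 ^ k))" using Suc 1 by simp
    finally show ?case by (simp flip: power_mult add: mult.commute)
  qed auto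
qed

section \<open>Absolute traces and the additive form of Hilbert 90\<close>

definition tr :: "nat \<Rightarrow> Omega \<Rightarrow> Omega" where
  "tr n u = (\<Sum>i<n. u ^ (2 ^ i))"

lemma tr_add: "tr n (u + v) = tr n u + tr n v"
  by (simp add: tr_def Omega_frob_add sum.distrib)

lemma tr_square: "u \<in> GF (2 ^ n) \<Longrightarrow> tr n (u\<^sup>2) = tr n u"
proof -
  assume u: "u \<in> GF (2 ^ n)"
  have "tr n (u\<^sup>2) + u = (\<Sum>i<n. u ^ (2 ^ Suc i)) + u ^ (2 ^ 0)"
    by (simp add: tr_def flip: power_mult)
  also have "\<dots> = (\<Sum>i<Suc n. u ^ (2 ^ i))"
    by (subst sum.lessThan_Suc_shift) (rule add.commute)
  also have "\<dots> = tr n u + u" using u by (simp add: tr_def GF_def)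
  finally show ?thesis by simp
qed

text \<open>Iterating r^2 = r + u collects the conjugates of u. For u in \<open>GF (2 ^ n)\<close>
  this is additive Hilbert 90: the Frobenius map fixes r if u has trace zero and sends r to r + 1
  otherwise.\<close>

lemma AS_frob: "r\<^sup>2 + r = u \<Longrightarrow> r ^ (2 ^ n) = r + tr n u"
proof (induction n)
  case (Suc n)
  have "r ^ (2 ^ Suc n) = (r\<^sup>2) ^ (2 ^ n)" by (simp flip: power_mult)
  also have "r\<^sup>2 = r + u" using Suc.prems by (metis Omega_add_self_left add.commute)
  also have "(r + u) ^ (2 ^ n) = r + tr n u + u ^ (2 ^ n)" using Suc by (simp add: Omega_frob_add)
  finally show ?case by (simp add: tr_def add.assoc)
qed (simp add: tr_def)

lemma AS_in_GF_iff: "r\<^sup>2 + r = u \<Longrightarrow> r \<in> GF (2 ^ n) \<longleftrightarrow> tr n u = 0"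
  using AS_frob[of r u n] by (auto simp: GF_def)

lemma tr_in: "u \<in> GF (2 ^ n) \<Longrightarrow> tr n u = 0 \<or> tr n u = 1"
proof -
  assume u: "u \<in> GF (2 ^ n)"
  have "(tr n u)\<^sup>2 = tr n (u\<^sup>2)"
    unfolding tr_def by (induction n) (auto simp: Omega_power2_add simp flip: power_mult, simp_all add: mult.commute)
  also have "\<dots> = tr n u" using tr_square[OF u] .
  finally have "tr n u * (tr n u + 1) = 0" by (simp add: power2_eq_square algebra_simps)
  thus ?thesis by auto
qed

text \<open>The trace is a polynomial function of degree at most 2^(n-1), so it cannot vanish at all
  2^n elements.\<close>

lemma tr_surj:
  assumes "n > 0" shows "\<exists>u \<in> GF (2 ^ n). tr n u = 1"
proof (rule ccontr)
  assume *: "\<not> ?thesis"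
  define p :: "Omega poly" where "p = (\<Sum>i<n. monom 1 (2 ^ i))"
  have "coeff p (2 ^ 0) = 1"
    unfolding p_def coeff_sum using assms by (subst sum.remove[of _ 0]) (auto intro!: sum.neutral)
  hence p0: "p \<noteq> 0" by auto
  have "GF (2 ^ n) \<subseteq> {u. poly p u = 0}"
    using * tr_in by (force simp: p_def poly_sum poly_monom tr_def)
  hence "card (GF (2 ^ n) :: Omega set) \<le> card {u. poly p u = 0}"
    by (intro card_mono poly_roots_finite p0)
  also have "\<dots> \<le> degree p" by (rule card_poly_roots_bound[OF p0])
  also have "\<dots> \<le> 2 ^ (n - 1)"
    unfolding p_def by (intro degree_sum_le) (auto intro!: order.trans[OF degree_monom_le])
  finally show False using card_GF(1)[OF assms] assms by simp
qed

section \<open>Elements of finite fields and their Frobenius orbits\<close>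

definition alg2 :: "Omega \<Rightarrow> bool" where
  "alg2 x \<longleftrightarrow> (\<exists>n>0. x \<in> GF (2 ^ n))"

lemma alg2_if_finite_Pol:
  assumes "is_subring F" "finite (Pol F z)" shows "alg2 z"
proof -
  have "range (\<lambda>i. z ^ (2 ^ i)) \<subseteq> Pol F z"
    using is_subring_power[OF is_subring_Pol Pol_contains(2)] assms(1) by auto
  hence "\<not> inj (\<lambda>i::nat. z ^ (2 ^ i))" using assms(2) finite_subset range_inj_infinite by metis
  then obtain i j :: nat where ij: "i < j" "z ^ (2 ^ i) = z ^ (2 ^ j)"
    by (metis (no_types, lifting) injI linorder_neqE_nat)
  have "(z ^ (2 ^ (j - i))) ^ (2 ^ i) = z ^ (2 ^ j)" using ij(1) by (simp flip: power_mult power_add)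
  hence "(z ^ (2 ^ (j - i)) + z) ^ (2 ^ i) = 0" using ij(2) by (simp add: Omega_frob_add)
  hence "z ^ (2 ^ (j - i)) = z" by simp
  thus ?thesis unfolding alg2_def GF_def using ij(1) by (intro exI[of _ "j - i"]) auto
qed

text \<open>The degree of z over the field of 2^k elements, introduced as the period of z under its
  Frobenius map; \<open>Pol_GF\<close> identifies it with the degree of the field generated by
  z.\<close>

definition fdeg :: "nat \<Rightarrow> Omega \<Rightarrow> nat" where
  "fdeg k z = (LEAST m. m > 0 \<and> z ^ ((2 ^ k) ^ m) = z)"

lemma fdeg:
  assumes "alg2 z" "k > 0"
  shows "fdeg k z > 0" "z \<in> GF ((2 ^ k) ^ fdeg k z)"
    "m > 0 \<Longrightarrow> z \<in> GF ((2 ^ k) ^ m) \<Longrightarrow> fdeg k z \<le> m"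
proof -
  from assms obtain n where n: "n > 0" "z ^ (2 ^ n) = z" by (auto simp: alg2_def GF_def)
  have "z ^ ((2 ^ n) ^ j) = z" for j
    by (induction j) (use n(2) in \<open>simp_all add: power_mult mult.commute\<close>)
  from this[of k] have "z ^ ((2 ^ k) ^ n) = z" by (simp flip: power_mult add: mult.commute)
  with n(1) have *: "n > 0 \<and> z ^ ((2 ^ k) ^ n) = z" by simp
  show "fdeg k z > 0" "z \<in> GF ((2 ^ k) ^ fdeg k z)"
    using LeastI[of "\<lambda>m. m > 0 \<and> z ^ ((2 ^ k) ^ m) = z", OF *] by (simp_all add: fdeg_def GF_def)
  show "m > 0 \<Longrightarrow> z \<in> GF ((2 ^ k) ^ m) \<Longrightarrow> fdeg k z \<le> m"
    unfolding fdeg_def by (rule Least_le) (auto simp: GF_def)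
qed

lemma fdeg_conj_inj:
  assumes "alg2 z" "k > 0"
  shows "inj_on (\<lambda>i. z ^ ((2 ^ k) ^ i)) {..<fdeg k z}"
proof (rule inj_onI)
  have *: False if "i < j" "j < fdeg k z" "z ^ ((2 ^ k) ^ i) = z ^ ((2 ^ k) ^ j)" for i j
  proof -
    have "(z ^ ((2 ^ k) ^ (j - i))) ^ ((2 ^ k) ^ i) = z ^ ((2 ^ k) ^ j)" using that(1)
      by (simp flip: power_mult power_add distrib_left)
    hence "(z ^ ((2 ^ k) ^ (j - i)) + z) ^ ((2 ^ k) ^ i) = 0" using that(3)
      by (simp add: Omega_frob_add')
    hence "z ^ ((2 ^ k) ^ (j - i)) = z" by simp
    hence "fdeg k z \<le> j - i" using that(1) by (intro fdeg(3) assms) (auto simp: GF_def)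
    with that show False by simp
  qed
  fix i j assume "i \<in> {..<fdeg k z}" "j \<in> {..<fdeg k z}" "z ^ ((2 ^ k) ^ i) = z ^ ((2 ^ k) ^ j)"
  thus "i = j" using *[of i j] *[of j i] by (cases i j rule: linorder_cases) auto
qed

text \<open>Polynomial values at z are fixed by the m-th Frobenius power because z is, where m is
  the period. Conversely, polynomials of degree below m take different values at z, since their
  difference would vanish at all m conjugates. The two cardinalities meet.\<close>

lemma Pol_GF:
  assumes "alg2 z" "k > 0"
  shows "Pol (GF (2 ^ k)) z = GF ((2 ^ k) ^ fdeg k z)"
proof (rule card_seteq)
  let ?m = "fdeg k z" and ?F = "GF (2 ^ k) :: Omega set"
  let ?S = "{p \<in> polys ?F. p = 0 \<or> degree p < ?m}"
  have km: "k * ?m > 0" using assms fdeg(1) by simp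
  show fin: "finite (GF ((2 ^ k) ^ ?m) :: Omega set)"
    using card_GF(2)[OF km] by (simp add: power_mult)
  show sub: "Pol ?F z \<subseteq> GF ((2 ^ k) ^ ?m)"
  proof
    fix y assume "y \<in> Pol ?F z"
    then obtain a where "a \<in> polys ?F" "y = poly a z" by (auto simp: Pol_def)
    thus "y \<in> GF ((2 ^ k) ^ ?m)" using poly_frob[of a k z ?m] fdeg(2)[OF assms] by (auto simp: GF_def)
  qed
  have "inj_on (\<lambda>p. poly p z) ?S"
  proof (rule inj_onI)
    fix p q assume pq: "p \<in> ?S" "q \<in> ?S" "poly p z = poly q z"
    show "p = q"
    proof (rule ccontr)
      assume "p \<noteq> q"
      hence d0: "p - q \<noteq> 0" by simp
      have "p - q \<in> polys ?F" using pq by (auto intro: polys_closed is_subring_GF)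
      hence "poly (p - q) (z ^ ((2 ^ k) ^ i)) = 0" for i
        using poly_frob[of "p - q" k z i] pq(3) by (simp add: zero_power)
      hence "card ((\<lambda>i. z ^ ((2 ^ k) ^ i)) ` {..<?m}) \<le> card {x. poly (p - q) x = 0}"
        by (intro card_mono poly_roots_finite d0) auto
      also have "\<dots> \<le> degree (p - q)" by (rule card_poly_roots_bound[OF d0])
      also have "\<dots> < ?m"
        using pq d0 by (cases "p = 0"; cases "q = 0") (auto intro: degree_diff_less)
      finally show False using card_image[OF fdeg_conj_inj[OF assms]] by simp
    qed
  qed
  hence "card ((\<lambda>p. poly p z) ` ?S) = (2 ^ k) ^ ?m"
    using card_polys_below(1)[OF is_subring_GF card_GF(2)[OF assms(2)], of ?m] card_GF(1)[OF assms(2)]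
    by (simp add: card_image)
  moreover have "card ((\<lambda>p. poly p z) ` ?S) \<le> card (Pol ?F z)"
    using finite_subset[OF sub fin] by (intro card_mono) (auto simp: Pol_def)
  ultimately show "card (GF ((2 ^ k) ^ ?m) :: Omega set) \<le> card (Pol ?F z)"
    using card_GF(1)[OF km] by (simp add: power_mult)
qed

text \<open>Raising all coefficients to the power 2^k moves each root to the next one in the
  Frobenius cycle. The product does not change, so its coefficients are fixed.\<close>

lemma conj_polynomial:
  assumes "alg2 z" "k > 0"
  shows "(\<Prod>i<fdeg k z. [:z ^ ((2 ^ k) ^ i), 1:]) \<in> polys (GF (2 ^ k))"
proof -
  define P where "P = (\<Prod>i<fdeg k z. [:z ^ ((2 ^ k) ^ i), 1:])"
  define fr where "fr = map_poly (\<lambda>c::Omega. c ^ (2 ^ k))"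
  have 0: "(0::Omega) ^ (2 ^ k) = 0" by simp
  have fr_mult: "fr (p * q) = fr p * fr q" for p q
  proof -
    have fsum: "(sum f A) ^ (2 ^ k) = (\<Sum>i\<in>A. f i ^ (2 ^ k))" for f :: "nat \<Rightarrow> Omega" and A
      by (induction A rule: infinite_finite_induct) (auto simp: Omega_frob_add)
    show ?thesis by (rule poly_eqI) (simp add: fr_def coeff_map_poly coeff_mult fsum power_mult_distrib)
  qed
  have fr1: "fr 1 = 1" by (simp add: fr_def)
  have fr_prod: "fr (prod f A) = (\<Prod>i\<in>A. fr (f i))" for f :: "nat \<Rightarrow> Omega poly" and A
    by (induction A rule: infinite_finite_induct) (auto simp: fr_mult fr1)
  have fr_lin: "fr [:c, 1:] = [:c ^ (2 ^ k), 1:]" for c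
    by (simp add: fr_def map_poly_pCons)
  obtain m where m: "fdeg k z = Suc m" using fdeg(1)[OF assms] by (metis gr0_implies_Suc)
  have "fr P = (\<Prod>i<fdeg k z. [:z ^ ((2 ^ k) ^ Suc i), 1:])"
    unfolding P_def fr_prod fr_lin by (simp flip: power_mult add: mult.commute)
  also have "\<dots> = (\<Prod>i<m. [:z ^ ((2 ^ k) ^ Suc i), 1:]) * [:z ^ ((2 ^ k) ^ fdeg k z), 1:]"
    by (simp add: m)
  also have "z ^ ((2 ^ k) ^ fdeg k z) = z" using fdeg(2)[OF assms] by (simp add: GF_def)
  also have "(\<Prod>i<m. [:z ^ ((2 ^ k) ^ Suc i), 1:]) * [:z, 1:] = P"
    unfolding P_def m prod.lessThan_Suc_shift by (simp add: mult.commute)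
  finally have "coeff P i ^ (2 ^ k) = coeff P i" for i
    by (metis fr_def coeff_map_poly 0)
  thus ?thesis unfolding P_def by (auto simp: polys_def GF_def)
qed

section \<open>Polynomial functions and specialisation\<close>

text \<open>
  Elements of all rings involved are values of polynomial functions over the prime field at a generic
  point; ring homomorphisms evaluate the same functions at another point. Coordinate \<open>0\<close> is the
  transcendental variable, and the coordinates \<open>6, 2, 3, 4, 5\<close> are the Artin--Schreier generators
  \<open>w, y, x, s, d\<close>.
\<close>

type_synonym env = "nat \<Rightarrow> Omega"

inductive_set PF :: "nat set \<Rightarrow> (env \<Rightarrow> Omega) set" for I where
  PF_0 [simp]: "(\<lambda>e. 0) \<in> PF I"
| PF_1 [simp]: "(\<lambda>e. 1) \<in> PF I"
| PF_var [simp]: "i \<in> I \<Longrightarrow> (\<lambda>e. e i) \<in> PF I"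
| PF_add [simp]: "f \<in> PF I \<Longrightarrow> g \<in> PF I \<Longrightarrow> (\<lambda>e. f e + g e) \<in> PF I"
| PF_mult [simp]: "f \<in> PF I \<Longrightarrow> g \<in> PF I \<Longrightarrow> (\<lambda>e. f e * g e) \<in> PF I"

lemma PF_power [simp]: "f \<in> PF I \<Longrightarrow> (\<lambda>e. f e ^ n) \<in> PF I"
  by (induction n) auto

lemma PF_subst:
  "f \<in> PF I \<Longrightarrow> (\<And>i. i \<in> I \<Longrightarrow> (\<lambda>e. s e i) \<in> PF J) \<Longrightarrow> (\<lambda>e. f (s e)) \<in> PF J"
  by (induction rule: PF.induct) auto

lemma PF_mono: "f \<in> PF I \<Longrightarrow> I \<subseteq> J \<Longrightarrow> f \<in> PF J"
  by (induction rule: PF.induct) auto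

lemma PF_cong: "f \<in> PF I \<Longrightarrow> (\<And>i. i \<in> I \<Longrightarrow> e i = e' i) \<Longrightarrow> f e = f e'"
  by (induction rule: PF.induct) auto

definition Rv :: "nat set \<Rightarrow> env \<Rightarrow> Omega set" where "Rv I e = (\<lambda>f. f e) ` PF I"

definition Fr :: "nat set \<Rightarrow> env \<Rightarrow> Omega set" where
  "Fr I e = {a / b | a b. a \<in> Rv I e \<and> b \<in> Rv {0} e \<and> b \<noteq> 0}"

lemma RvI: "f \<in> PF I \<Longrightarrow> f e \<in> Rv I e" by (auto simp: Rv_def)

lemma RvE: "z \<in> Rv I e \<Longrightarrow> (\<And>f. f \<in> PF I \<Longrightarrow> z = f e \<Longrightarrow> P) \<Longrightarrow> P" by (auto simp: Rv_def)

lemma Rv_var: "i \<in> I \<Longrightarrow> e i \<in> Rv I e" using RvI[OF PF_var] .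

lemma is_subring_Rv: "is_subring (Rv I e)"
  unfolding is_subring_def
proof (intro conjI ballI)
  show "0 \<in> Rv I e" "1 \<in> Rv I e" using RvI[OF PF_0] RvI[OF PF_1] by auto
  fix x y assume "x \<in> Rv I e" "y \<in> Rv I e"
  then obtain f g where "f \<in> PF I" "g \<in> PF I" "x = f e" "y = g e" by (auto elim!: RvE)
  thus "x + y \<in> Rv I e" "x * y \<in> Rv I e"
    using RvI[OF PF_add] RvI[OF PF_mult] by auto
qed

lemmas Rv_closed = is_subringD[OF is_subring_Rv]

lemma Rv_mono: "I \<subseteq> J \<Longrightarrow> Rv I e \<subseteq> Rv J e"
  using PF_mono by (auto simp: Rv_def)

lemma Rv_least:
  assumes "is_subring E" "\<And>i. i \<in> I \<Longrightarrow> e i \<in> E" shows "Rv I e \<subseteq> E"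
proof
  fix z assume "z \<in> Rv I e"
  then obtain f where "f \<in> PF I" "z = f e" by (rule RvE)
  moreover have "f e \<in> E" if "f \<in> PF I" for f
    using that by induction (use assms in \<open>auto simp: is_subringD\<close>)
  ultimately show "z \<in> E" by simp
qed

lemma FrI: "f \<in> PF I \<Longrightarrow> g \<in> PF {0} \<Longrightarrow> g e \<noteq> 0 \<Longrightarrow> f e / g e \<in> Fr I e"
  by (auto simp: Fr_def Rv_def)

lemma Rv_subset_Fr: "Rv I e \<subseteq> Fr I e"
proof
  fix z assume "z \<in> Rv I e"
  thus "z \<in> Fr I e" unfolding Fr_def by (intro CollectI exI[of _ z] exI[of _ 1]) (simp add: Rv_closed)
qed

lemma is_subring_Fr:
  assumes "0 \<in> I"
  shows "is_subring (Fr I e)"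
  unfolding is_subring_def
proof (intro conjI ballI)
  show "0 \<in> Fr I e" "1 \<in> Fr I e" using Rv_subset_Fr Rv_closed by blast+
  fix x y assume "x \<in> Fr I e" "y \<in> Fr I e"
  then obtain a b c d where *: "x = a / b" "y = c / d" "a \<in> Rv I e" "b \<in> Rv {0} e"
      "c \<in> Rv I e" "d \<in> Rv {0} e" "b \<noteq> 0" "d \<noteq> 0" by (auto simp: Fr_def)
  have "b \<in> Rv I e" "d \<in> Rv I e" using *(4,6) Rv_mono[of "{0}" I e] assms by auto
  hence "a * d + c * b \<in> Rv I e" "a * c \<in> Rv I e" "b * d \<in> Rv {0} e" "b * d \<noteq> 0"
    using * by (auto intro!: Rv_closed)
  moreover have "x + y = (a * d + c * b) / (b * d)" "x * y = (a * c) / (b * d)"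
    using * by (auto simp: field_simps)
  ultimately show "x + y \<in> Fr I e" "x * y \<in> Fr I e" unfolding Fr_def by blast+
qed

lemma Fr_mono: "I \<subseteq> J \<Longrightarrow> Fr I e \<subseteq> Fr J e"
proof
  assume IJ: "I \<subseteq> J"
  fix z assume "z \<in> Fr I e"
  then obtain a b where "z = a / b" "a \<in> Rv I e" "b \<in> Rv {0} e" "b \<noteq> 0" by (auto simp: Fr_def)
  moreover have "a \<in> Rv J e" using Rv_mono[OF IJ, of e] \<open>a \<in> Rv I e\<close> by (rule subsetD)
  ultimately show "z \<in> Fr J e" unfolding Fr_def by (intro CollectI exI[of _ a] exI[of _ b]) simp
qed

lemma Fr_least:
  assumes "is_subfield E" "\<And>i. i \<in> I \<Longrightarrow> e i \<in> E" "0 \<in> I" shows "Fr I e \<subseteq> E"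
proof -
  have "Rv I e \<subseteq> E" using assms by (intro Rv_least is_subfieldD(7)) auto
  moreover have "Rv {0} e \<subseteq> E" using assms by (intro Rv_least is_subfieldD(7)) auto
  ultimately show ?thesis using is_subfieldD(6)[OF assms(1)] by (auto simp: Fr_def)
qed

lemma PF_poly: "p \<in> polys {0, 1} \<Longrightarrow> (\<lambda>e. poly p (e 0)) \<in> PF {0}"
proof (induction p)
  case (pCons a p)
  have "p \<in> polys {0,1}" "a \<in> {0,1}"
    using pCons.prems by (auto simp: polys_def coeff_pCons split: nat.splits)
  hence "(\<lambda>e. poly p (e 0)) \<in> PF {0}" "(\<lambda>e. a) \<in> PF {0}" using pCons.IH by auto
  hence "(\<lambda>e. a + e 0 * poly p (e 0)) \<in> PF {0}" by simp
  thus ?case by simp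
qed auto

lemma is_subfield_F2: "is_subfield {0, 1::Omega}"
  by (auto simp: is_subfield_def is_subring_def)

lemma PF0_poly: "f \<in> PF {0} \<Longrightarrow> \<exists>p \<in> polys {0, 1}. \<forall>e. f e = poly p (e 0)"
proof (induction rule: PF.induct)
  case (PF_var i)
  thus ?case by (intro bexI[of _ "[:0,1:]"]) (auto simp: polys_closed is_subfieldD(7)[OF is_subfield_F2])
next
  case (PF_add f g)
  then obtain p q where "p \<in> polys {0,1}" "\<forall>e. f e = poly p (e 0)" "q \<in> polys {0,1}" "\<forall>e. g e = poly q (e 0)" by auto
  thus ?case by (intro bexI[of _ "p + q"]) (auto intro: polys_closed is_subfieldD(7)[OF is_subfield_F2])
next
  case (PF_mult f g)
  then obtain p q where "p \<in> polys {0,1}" "\<forall>e. f e = poly p (e 0)" "q \<in> polys {0,1}" "\<forall>e. g e = poly q (e 0)" by auto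
  thus ?case by (intro bexI[of _ "p * q"]) (auto intro: polys_closed is_subfieldD(7)[OF is_subfield_F2])
next
  case PF_0
  show ?case by (rule bexI[of _ 0]) (auto simp: polys_closed is_subfieldD(7)[OF is_subfield_F2])
next
  case PF_1
  show ?case by (rule bexI[of _ 1]) (auto simp: polys_closed is_subfieldD(7)[OF is_subfield_F2])
qed

lemma Rv0_eq: "Rv {0} e = Pol {0, 1} (e 0)"
proof -
  have "z \<in> Pol {0,1} (e 0)" if "z \<in> Rv {0} e" for z
    using that PF0_poly by (fastforce simp: Rv_def Pol_def)
  moreover have "z \<in> Rv {0} e" if "z \<in> Pol {0,1} (e 0)" for z
    using that RvI[OF PF_poly] by (auto simp: Pol_def)
  ultimately show ?thesis by blast
qed

lemma Fr0_eq: "Fr {0} e = Rat {0, 1} (e 0)"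
  by (simp add: Fr_def Rat_def Rv0_eq)

section \<open>Towers of Artin--Schreier extensions\<close>

text \<open>Squares of coordinate j are eliminated by its Artin-Schreier relation. The same u and v
  serve at every point satisfying the relation, so a normal form found at the generic point can be
  specialised.\<close>

lemma AS_normal_form:
  assumes "f \<in> PF (insert j I)" "h \<in> PF I"
  shows "\<exists>u\<in>PF I. \<exists>v\<in>PF I. \<forall>p. p j ^ 2 + p j = h p \<longrightarrow> f p = u p + v p * p j"
  using assms(1)
proof induction
  case PF_0
  show ?case by (rule bexI[of _ "\<lambda>_. 0"], rule bexI[of _ "\<lambda>_. 0"]) auto
next
  case PF_1
  show ?case by (rule bexI[of _ "\<lambda>_. 1"], rule bexI[of _ "\<lambda>_. 0"]) auto
next
  case (PF_var i)
  show ?case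
  proof (cases "i = j")
    case True
    show ?thesis by (rule bexI[of _ "\<lambda>_. 0"], rule bexI[of _ "\<lambda>_. 1"]) (auto simp: True)
  next
    case False
    with PF_var show ?thesis
      by (intro bexI[of _ "\<lambda>p. p i"] bexI[of _ "\<lambda>_. 0"]) auto
  qed
next
  case (PF_add f g)
  then obtain u v u' v' where *: "u \<in> PF I" "v \<in> PF I" "u' \<in> PF I" "v' \<in> PF I"
    "\<forall>p. p j ^ 2 + p j = h p \<longrightarrow> f p = u p + v p * p j"
    "\<forall>p. p j ^ 2 + p j = h p \<longrightarrow> g p = u' p + v' p * p j" by blast
  show ?case
    by (rule bexI[of _ "\<lambda>p. u p + u' p"], rule bexI[of _ "\<lambda>p. v p + v' p"])
       (use * in \<open>auto simp: algebra_simps\<close>)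
next
  case (PF_mult f g)
  then obtain u v u' v' where *: "u \<in> PF I" "v \<in> PF I" "u' \<in> PF I" "v' \<in> PF I"
    "\<forall>p. p j ^ 2 + p j = h p \<longrightarrow> f p = u p + v p * p j"
    "\<forall>p. p j ^ 2 + p j = h p \<longrightarrow> g p = u' p + v' p * p j" by blast
  have "(u p + v p * p j) * (u' p + v' p * p j)
       = (u p * u' p + v p * v' p * h p) + (u p * v' p + v p * u' p + v p * v' p) * p j"
    if "p j ^ 2 + p j = h p" for p
    unfolding that[symmetric] by (simp add: algebra_simps power2_eq_square)
  thus ?case
    by (intro bexI[of _ "\<lambda>p. u p * u' p + v p * v' p * h p"]
              bexI[of _ "\<lambda>p. u p * v' p + v p * u' p + v p * v' p"])
       (use * assms(2) in auto)
qed

text \<open>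
  Complete integral closedness passes up an Artin--Schreier step by an elementary computation, and it
  replaces a theory of integral dependence.
\<close>

definition almost_integral :: "nat set \<Rightarrow> env \<Rightarrow> Omega \<Rightarrow> bool" where
  "almost_integral I e z \<longleftrightarrow> (\<exists>d\<in>Rv {0} e. d \<noteq> 0 \<and> (\<forall>n. d * z ^ n \<in> Rv I e))"

text \<open>The condition on functions says that e is a generic point of \<open>Z\<close>: relations
  valid at e hold on all of \<open>Z\<close>, which makes evaluation at any such point well defined.
  \<open>Z\<close> contains the equations of all generators from the start, so it stays fixed while
  the set \<open>I\<close> of adjoined coordinates grows.\<close>

definition tower :: "nat set \<Rightarrow> (env \<Rightarrow> bool) \<Rightarrow> env \<Rightarrow> bool" where
  "tower I Z e \<longleftrightarrow> 0 \<in> I \<and> Z e \<and> (\<forall>f\<in>PF I. f e = 0 \<longrightarrow> (\<forall>p. Z p \<longrightarrow> f p = 0)) \<and>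
     is_subfield (Fr I e) \<and> (\<forall>z\<in>Fr I e. almost_integral I e z \<longrightarrow> z \<in> Rv I e)"

lemma towerD:
  assumes "tower I Z e"
  shows "0 \<in> I" "Z e" "f \<in> PF I \<Longrightarrow> f e = 0 \<Longrightarrow> Z p \<Longrightarrow> f p = 0" "is_subfield (Fr I e)"
    "z \<in> Fr I e \<Longrightarrow> almost_integral I e z \<Longrightarrow> z \<in> Rv I e"
  using assms by (auto simp: tower_def)

lemma almost_integral_Rv: "z \<in> Rv I e \<Longrightarrow> almost_integral I e z"
  unfolding almost_integral_def
  by (rule bexI[of _ 1]) (auto intro: is_subring_power is_subring_Rv Rv_closed)

text \<open>The product of the two multipliers clears every term of the binomial expansion of (z +
  y)^n at once.\<close>

lemma almost_integral_add:
  assumes "almost_integral I e z" "almost_integral I e y" "0 \<in> I"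
  shows "almost_integral I e (z + y)"
proof -
  from assms obtain a b where *: "a \<in> Rv {0} e" "b \<in> Rv {0} e" "a \<noteq> 0" "b \<noteq> 0"
    "\<And>n. a * z ^ n \<in> Rv I e" "\<And>n. b * y ^ n \<in> Rv I e" by (auto simp: almost_integral_def)
  have "(a * b) * (z + y) ^ n \<in> Rv I e" for n
  proof -
    have "(a * b) * (z + y) ^ n = (\<Sum>k\<le>n. of_nat (n choose k) * ((a * z ^ k) * (b * y ^ (n - k))))"
      unfolding binomial_ring sum_distrib_left by (intro sum.cong) (auto simp: mult_ac)
    moreover have "of_nat m \<in> Rv I e" for m by (induction m) (auto intro: Rv_closed)
    ultimately show ?thesis by (simp only:) (intro is_subring_sum is_subring_Rv Rv_closed(4) *(5,6))
  qed
  thus ?thesis unfolding almost_integral_def using *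
    by (intro bexI[of _ "a * b"]) (auto intro: Rv_closed)
qed

text \<open>The equation rewrites high powers of z = a/b through lower ones, so the power of b that
  clears the exponents up to the degree of the equation clears all of them.\<close>

lemma almost_integral_integral:
  assumes z: "z \<in> Fr I e" and "0 \<in> I" and p: "lead_coeff p = 1" "p \<in> polys (Rv I e)" "poly p z = 0"
  shows "almost_integral I e z"
proof -
  define m where "m = degree p"
  from z obtain a b where ab: "z = a / b" "a \<in> Rv I e" "b \<in> Rv {0} e" "b \<noteq> 0" by (auto simp: Fr_def)
  have b: "b \<in> Rv I e" using ab(3) Rv_mono[of "{0}" I e] assms(2) by auto
  have bm: "b ^ m \<in> Rv {0} e" "b ^ m \<noteq> 0" using ab by (auto intro: is_subring_power is_subring_Rv)
  have "b ^ m * z ^ n \<in> Rv I e" for n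
  proof (induction n rule: less_induct)
    case (less n)
    show ?case
    proof (cases "n \<le> m")
      case True
      hence "b ^ m * z ^ n = b ^ (m - n) * (b * z) ^ n"
        by (simp add: power_mult_distrib flip: power_add mult.assoc)
      also have "b * z = a" using ab by simp
      finally have "b ^ m * z ^ n = b ^ (m - n) * a ^ n" .
      thus ?thesis using ab b by (auto intro!: Rv_closed is_subring_power is_subring_Rv)
    next
      case False
      have "0 = (\<Sum>i\<le>m. coeff p i * z ^ i)" using p(3) by (simp add: poly_altdef m_def)
      also have "\<dots> = (\<Sum>i<m. coeff p i * z ^ i) + z ^ m" using p(1)
        by (simp add: m_def flip: lessThan_Suc_atMost)
      finally have "z ^ m = (\<Sum>i<m. coeff p i * z ^ i)" by (metis Omega_add_eq_0)
      hence "b ^ m * z ^ n = b ^ m * ((\<Sum>i<m. coeff p i * z ^ i) * z ^ (n - m))"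
        using False by (metis le_add_diff_inverse nat_le_linear power_add)
      also have "\<dots> = (\<Sum>i<m. coeff p i * (b ^ m * z ^ (i + (n - m))))"
        by (simp add: sum_distrib_left sum_distrib_right power_add mult_ac)
      also have "\<dots> \<in> Rv I e"
      proof (rule is_subring_sum[OF is_subring_Rv], rule Rv_closed(4))
        fix i assume "i \<in> {..<m}"
        thus "b ^ m * z ^ (i + (n - m)) \<in> Rv I e" using False by (intro less) auto
        show "coeff p i \<in> Rv I e" using p(2) by (simp add: polys_def)
      qed
      finally show ?thesis .
    qed
  qed
  thus ?thesis unfolding almost_integral_def using bm by blast
qed

text \<open>For the integral closedness of F_2[t], the polynomial part of a/b is split off. If a
  proper fraction r/b remained, multiples of its powers by a fixed polynomial \<open>D\<close> would
  eventually have negative degree, so they could not all be polynomials.\<close>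

lemma tower_base:
  assumes t: "transc {0, 1} (e 0)" and Z: "Z e"
  shows "tower {0} Z e"
  unfolding tower_def
proof (intro conjI ballI impI allI)
  show "0 \<in> {0::nat}" "Z e" using Z by auto
  show "is_subfield (Fr {0} e)"
    unfolding Fr0_eq by (intro is_subfield_Rat is_subfieldD(7)[OF is_subfield_F2])
next
  fix f p assume f: "f \<in> PF {0}" "f e = 0"
  obtain q where "q \<in> polys {0,1}" "\<forall>e. f e = poly q (e 0)" using PF0_poly[OF f(1)] by blast
  thus "f p = 0" using f(2) t by (auto simp: transc_def)
next
  fix z assume z: "z \<in> Fr {0} e" and ai: "almost_integral {0} e z"
  note F = is_subfield_F2 and Fr = is_subfieldD(7)[OF is_subfield_F2]
  from z obtain a b where ab: "z = poly a (e 0) / poly b (e 0)" "a \<in> polys {0,1}" "b \<in> polys {0,1}" "poly b (e 0) \<noteq> 0"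
    by (auto simp: Fr_def Rv0_eq Pol_def)
  have b0: "b \<noteq> 0" using ab by auto
  obtain q r where qr: "q \<in> polys {0,1}" "r \<in> polys {0,1}" "a = q * b + r" "r = 0 \<or> degree r < degree b"
    using polys_division[OF F ab(3) b0 ab(2)] by blast
  have q: "poly q (e 0) \<in> Rv {0} e" using qr(1) by (auto simp: Rv0_eq Pol_def)
  define z' where "z' = poly r (e 0) / poly b (e 0)"
  have zz': "z = poly q (e 0) + z'" using ab(4) unfolding ab(1) z'_def qr(3) by (simp add: add_divide_distrib)
  hence z'z: "z' = z + poly q (e 0)" by (simp add: add.commute)
  have "almost_integral {0} e z'"
    unfolding z'z using ai almost_integral_Rv[OF q] by (intro almost_integral_add) auto
  then obtain D where D: "D \<in> polys {0,1}" "poly D (e 0) \<noteq> 0" "\<And>n. poly D (e 0) * z' ^ n \<in> Rv {0} e"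
    by (auto simp: almost_integral_def Rv0_eq Pol_def)
  have "r = 0"
  proof (rule ccontr)
    assume r0: "r \<noteq> 0"
    \<comment> \<open>Each factor r/b lowers the degree by at least one, so one factor more than deg
      D suffices.\<close>
    define n where "n = Suc (degree D)"
    from D(3)[of n] obtain c where c: "c \<in> polys {0,1}" "poly D (e 0) * z' ^ n = poly c (e 0)"
      by (auto simp: Rv0_eq Pol_def)
    hence "poly (D * r ^ n - c * b ^ n) (e 0) = 0"
      using ab(4) by (simp add: z'_def field_simps)
    moreover have "D * r ^ n - c * b ^ n \<in> polys {0,1}"
      using c D qr ab by (intro polys_closed polys_power Fr)
    ultimately have eq: "D * r ^ n = c * b ^ n" using t by (auto simp: transc_def)
    have D0: "D \<noteq> 0" using D by auto
    with r0 eq have c0: "c \<noteq> 0" by auto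
    have "degree D + n * degree r = degree c + n * degree b"
      using arg_cong[OF eq, of degree] D0 r0 c0 b0 by (simp add: degree_mult_eq degree_power_eq)
    moreover have "n * degree r + n \<le> n * degree b" using qr(4) r0 by (metis Suc_leI add.commute mult_Suc_right mult_le_mono2)
    ultimately show False by (simp add: n_def)
  qed
  thus "z \<in> Rv {0} e" using zz' q by (simp add: z'_def)
qed

locale AS_step =
  fixes I Z e j h
  assumes tower: "tower I Z e" and h: "h \<in> PF I"
    and rel: "\<And>p. Z p \<Longrightarrow> p j ^ 2 + p j = h p" and new: "e j \<notin> Fr I e"
begin

lemma zero: "0 \<in> I" using towerD(1)[OF tower] .

lemma je: "e j ^ 2 + e j = h e" using rel towerD(2)[OF tower] by blast

lemma h_in: "h e \<in> Rv I e" "h e \<in> Fr I e" using h RvI Rv_subset_Fr by blast+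

lemma Fr_field: "is_subfield (Fr I e)" using towerD(4)[OF tower] .

lemmas Fr_closed = is_subfieldD[OF Fr_field]

lemma unique:
  assumes "u + v * e j = u' + v' * e j" "u \<in> Fr I e" "v \<in> Fr I e" "u' \<in> Fr I e" "v' \<in> Fr I e"
  shows "u = u' \<and> v = v'"
proof -
  have eq: "(v + v') * e j = u + u'"
    using assms(1) by (metis (no_types, lifting) Omega_add_self_left add.assoc add.commute distrib_right)
  have "v = v'"
  proof (rule ccontr)
    assume "v \<noteq> v'"
    hence "v + v' \<noteq> 0" by simp
    with eq have "e j = (u + u') / (v + v')" by (simp add: field_simps)
    moreover have "(u + u') / (v + v') \<in> Fr I e" using assms by (intro Fr_closed(3,6))
    ultimately show False using new by simp
  qed
  thus ?thesis using assms(1) by simp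
qed

lemma Rv_insert: "Rv (insert j I) e = {u + v * e j | u v. u \<in> Rv I e \<and> v \<in> Rv I e}"
proof (intro equalityI subsetI)
  fix z assume "z \<in> Rv (insert j I) e"
  then obtain f where f: "f \<in> PF (insert j I)" "z = f e" by (rule RvE)
  from AS_normal_form[OF f(1) h] je f(2)
  show "z \<in> {u + v * e j | u v. u \<in> Rv I e \<and> v \<in> Rv I e}" by (blast intro: RvI)
next
  fix z assume "z \<in> {u + v * e j | u v. u \<in> Rv I e \<and> v \<in> Rv I e}"
  thus "z \<in> Rv (insert j I) e"
    using Rv_mono[of I "insert j I" e] by (auto intro!: Rv_closed Rv_var)
qed

lemma Fr_insert: "Fr (insert j I) e = {u + v * e j | u v. u \<in> Fr I e \<and> v \<in> Fr I e}"
proof (intro equalityI subsetI)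
  fix z assume "z \<in> Fr (insert j I) e"
  then obtain u v b where "z = (u + v * e j) / b" "u \<in> Rv I e" "v \<in> Rv I e" "b \<in> Rv {0} e" "b \<noteq> 0"
    by (auto simp: Fr_def Rv_insert)
  hence "z = u / b + (v / b) * e j" "u / b \<in> Fr I e" "v / b \<in> Fr I e"
    by (auto simp: Fr_def add_divide_distrib)
  thus "z \<in> {u + v * e j | u v. u \<in> Fr I e \<and> v \<in> Fr I e}" by blast
next
  fix z assume "z \<in> {u + v * e j | u v. u \<in> Fr I e \<and> v \<in> Fr I e}"
  moreover have "e j \<in> Fr (insert j I) e" using Rv_subset_Fr Rv_var by blast
  ultimately show "z \<in> Fr (insert j I) e"
    using Fr_mono[of I "insert j I" e] zero by (auto intro!: is_subringD(3,4)[OF is_subring_Fr])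
qed

lemma Fr_insert_subfield: "is_subfield (Fr (insert j I) e)"
  unfolding is_subfield_def
proof (intro conjI ballI)
  show sr: "is_subring (Fr (insert j I) e)" by (rule is_subring_Fr) (simp add: zero)
  fix z assume "z \<in> Fr (insert j I) e"
  then obtain u v where uv: "z = u + v * e j" "u \<in> Fr I e" "v \<in> Fr I e" by (auto simp: Fr_insert)
  \<comment> \<open>The norm of z; the conjugate of z under e j -> e j + 1 is u + v + v (e
    j).\<close>
  define N where "N = u\<^sup>2 + u * v + v\<^sup>2 * h e"
  have N: "N \<in> Fr I e" unfolding N_def power2_eq_square using uv h_in by (intro Fr_closed)
  have zN: "z * (u + v + v * e j) = N"
    unfolding N_def uv(1) je[symmetric] by (simp add: algebra_simps power2_eq_square)
  show "inverse z \<in> Fr (insert j I) e"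
  proof (cases "z = 0")
    case True
    thus ?thesis using is_subringD(1)[OF sr] by simp
  next
    case False
    have "u + v + v * e j \<noteq> 0"
    proof
      assume "u + v + v * e j = 0"
      hence "(u + v) + v * e j = 0 + 0 * e j" by simp
      from unique[OF this] uv have "u + v = 0 \<and> v = 0" by (simp add: Fr_closed(1,3))
      with False uv show False by simp
    qed
    hence "N \<noteq> 0" using zN False by auto
    have "(u + v) / N + (v / N) * e j = (u + v + v * e j) / N" by (simp add: add_divide_distrib)
    also have "\<dots> = inverse z"
      using \<open>N \<noteq> 0\<close> unfolding zN[symmetric] by (simp add: divide_inverse)
    finally have "inverse z = (u + v) / N + (v / N) * e j" ..
    moreover have "(u + v) / N \<in> Fr I e" "v / N \<in> Fr I e" using uv N by (auto intro!: Fr_closed(3,6))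
    ultimately show ?thesis unfolding Fr_insert by (intro CollectI exI[of _ "(u + v) / N"] exI[of _ "v / N"]) simp
  qed
qed

text \<open>Conjugation e j -> e j + 1 respects multiplication because both values satisfy the same
  equation. Stating this for powers avoids constructing the automorphism.\<close>

lemma conj_powers:
  assumes "u \<in> Fr I e" "v \<in> Fr I e"
  shows "\<exists>a\<in>Fr I e. \<exists>b\<in>Fr I e. (u + v * e j) ^ n = a + b * e j \<and> (u + v * (e j + 1)) ^ n = a + b * (e j + 1)"
proof (induction n)
  case 0
  show ?case by (rule bexI[of _ 1], rule bexI[of _ 0]) (auto intro: Fr_closed)
next
  case (Suc n)
  then obtain a b where ab: "a \<in> Fr I e" "b \<in> Fr I e" "(u + v * e j) ^ n = a + b * e j"
    "(u + v * (e j + 1)) ^ n = a + b * (e j + 1)" by blast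
  have 1: "(u + v * x) * (a + b * x) = (u * a + v * b * h e) + (u * b + v * a + v * b) * x"
    if "x ^ 2 + x = h e" for x
    unfolding that[symmetric] by (simp add: algebra_simps power2_eq_square)
  have "(e j + 1)\<^sup>2 + (e j + 1) = e j ^ 2 + e j" by (simp add: Omega_power2_add ac_simps)
  hence "(e j + 1)\<^sup>2 + (e j + 1) = h e" using je by simp
  from 1[OF je] 1[OF this] ab(3,4)
  show ?case
    by (intro bexI[of _ "u * a + v * b * h e"] bexI[of _ "u * b + v * a + v * b"])
       (auto intro!: Fr_closed assms ab h_in)
qed

lemma mem_Rv_insert:
  assumes "a \<in> Fr I e" "b \<in> Fr I e" "a + b * e j \<in> Rv (insert j I) e"
  shows "a \<in> Rv I e" "b \<in> Rv I e"
proof -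
  from assms(3) obtain u v where "u \<in> Rv I e" "v \<in> Rv I e" "a + b * e j = u + v * e j"
    by (auto simp: Rv_insert)
  with unique[of a b u v] assms Rv_subset_Fr[of I e] show "a \<in> Rv I e" "b \<in> Rv I e" by auto
qed

text \<open>The conjugate of z = u + v (e j) is almost integral with the same multiplier, hence so
  is the trace, which is v itself. No denominator appears because X^2 + X + h has derivative 1, that
  is, the step is unramified. Then u = z + v (e j) follows.\<close>

lemma integrally_closed:
  assumes z: "z \<in> Fr (insert j I) e" and ai: "almost_integral (insert j I) e z"
  shows "z \<in> Rv (insert j I) e"
proof -
  let ?J = "insert j I"
  have R0: "Rv {0} e \<subseteq> Fr I e" using Rv_mono[of "{0}" I e] zero Rv_subset_Fr by blast
  have ai_down: "a \<in> Rv I e" if a: "a \<in> Fr I e" "almost_integral ?J e a" for a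
  proof -
    from a obtain d where d: "d \<in> Rv {0} e" "d \<noteq> 0" "\<And>n. d * a ^ n \<in> Rv ?J e"
      by (auto simp: almost_integral_def)
    have "d * a ^ n \<in> Rv I e" for n
    proof -
      have "d * a ^ n \<in> Fr I e" using d R0 a(1)
        by (intro Fr_closed is_subring_power Fr_closed(7)) auto
      thus ?thesis using mem_Rv_insert[of "d * a ^ n" 0] d(3)[of n] Fr_closed(1) by simp
    qed
    hence "almost_integral I e a" unfolding almost_integral_def using d by blast
    thus ?thesis using towerD(5)[OF tower a(1)] by blast
  qed
  from z obtain u v where uv: "z = u + v * e j" "u \<in> Fr I e" "v \<in> Fr I e" by (auto simp: Fr_insert)
  define z' where "z' = u + v * (e j + 1)"
  have "almost_integral ?J e z'"
  proof -
    from ai obtain d where d: "d \<in> Rv {0} e" "d \<noteq> 0" "\<And>n. d * z ^ n \<in> Rv ?J e"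
      by (auto simp: almost_integral_def)
    have "d * z' ^ n \<in> Rv ?J e" for n
    proof -
      obtain a b where ab: "a\<in>Fr I e" "b\<in>Fr I e" "z ^ n = a + b * e j" "z' ^ n = a + b * (e j + 1)"
        using conj_powers[OF uv(2,3), of n] unfolding uv(1) z'_def by blast
      have 1: "d * z ^ n = d * a + d * b * e j" using ab by (simp add: algebra_simps)
      have da: "d * a \<in> Fr I e" "d * b \<in> Fr I e" using d R0 ab by (auto intro: Fr_closed)
      have "d * a \<in> Rv I e" "d * b \<in> Rv I e" using mem_Rv_insert[OF da] d(3)[of n] 1 by auto
      moreover have "d * z' ^ n = (d * a + d * b) + d * b * e j" using ab by (simp add: algebra_simps)
      ultimately show ?thesis unfolding Rv_insert
        by (intro CollectI exI[of _ "d * a + d * b"] exI[of _ "d * b"]) (simp add: Rv_closed(3))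
    qed
    thus ?thesis unfolding almost_integral_def using d by blast
  qed
  hence "almost_integral ?J e (z + z')" using ai zero by (intro almost_integral_add) auto
  moreover have "z + z' = v" by (simp add: uv(1) z'_def algebra_simps)
  ultimately have v: "v \<in> Rv I e" using ai_down uv by simp
  hence vx: "v * e j \<in> Rv ?J e" using Rv_mono[of I ?J e] by (auto intro!: Rv_closed Rv_var)
  have "z + v * e j = u" by (simp add: uv(1) algebra_simps)
  hence "u \<in> Rv I e"
    using ai_down[OF uv(2)] almost_integral_add[OF ai almost_integral_Rv[OF vx]] zero by simp
  with v show ?thesis unfolding Rv_insert uv(1) by blast
qed

lemma tower_insert: "tower (insert j I) Z e"
  unfolding tower_def
proof (intro conjI ballI impI allI)
  show "0 \<in> insert j I" "Z e" using towerD(1,2)[OF tower] by auto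
  show "is_subfield (Fr (insert j I) e)" by (rule Fr_insert_subfield)
  show "z \<in> Rv (insert j I) e" if "z \<in> Fr (insert j I) e" "almost_integral (insert j I) e z" for z
    using integrally_closed that by blast
  fix f p assume f: "f \<in> PF (insert j I)" "f e = 0" and p: "Z p"
  obtain u v where uv: "u \<in> PF I" "v \<in> PF I" "\<And>p. p j ^ 2 + p j = h p \<Longrightarrow> f p = u p + v p * p j"
    using AS_normal_form[OF f(1) h] by blast
  have "u e + v e * e j = 0 + 0 * e j" using uv(3)[OF je] f(2) by simp
  moreover have "u e \<in> Fr I e" "v e \<in> Fr I e" using uv RvI Rv_subset_Fr by blast+
  ultimately have "u e = 0" "v e = 0" using unique[of "u e" "v e" 0 0] by (simp_all add: Fr_closed(1))
  hence "u p = 0" "v p = 0" using towerD(3)[OF tower] uv p by blast+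
  thus "f p = 0" using uv(3)[OF rel[OF p]] by simp
qed

end

text \<open>Multiplying p = a + x b by its conjugate a + (x + 1) b gives the norm, whose
  coefficients lie in \<open>A\<close> and which still vanishes at z.\<close>

lemma monic_descend:
  assumes A: "is_subring A" and h: "x ^ 2 + x = h" "h \<in> A"
    and p: "lead_coeff p = 1" "\<And>i. \<exists>u\<in>A. \<exists>v\<in>A. coeff p i = u + v * x" "poly p z = 0"
  shows "\<exists>q. lead_coeff q = 1 \<and> q \<in> polys A \<and> poly q z = (0::Omega)"
proof -
  define n where "n = degree p"
  obtain U V where UV: "\<And>i. U i \<in> A" "\<And>i. V i \<in> A" "\<And>i. coeff p i = U i + V i * x"
    using p(2) by metis
  \<comment> \<open>The leading coefficient 1 is put into \<open>a\<close> by hand: the chosen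
    values \<open>U n\<close> and \<open>V n\<close> need not be 1 and 0, and this way both
    conjugate factors are monic.\<close>
  define a where "a = monom 1 n + (\<Sum>i<n. monom (U i) i)"
  define b where "b = (\<Sum>i<n. monom (V i) i)"
  have ca: "coeff a i = (if i = n then 1 else if i < n then U i else 0)" for i
    by (auto simp: a_def coeff_sum)
  have cb: "coeff b i = (if i < n then V i else 0)" for i by (auto simp: b_def coeff_sum)
  have pab: "p = a + smult x b"
  proof (rule poly_eqI)
    fix i show "coeff p i = coeff (a + smult x b) i"
      using p(1) coeff_eq_0[of p i] UV(3)[of i] by (cases i n rule: linorder_cases) (auto simp: ca cb n_def mult.commute)
  qed
  have ab: "a \<in> polys A" "b \<in> polys A" using UV is_subringD[OF A] by (auto simp: polys_def ca cb)
  define q where "q = p * (a + smult (x + 1) b)"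
  have la: "degree a = n" "lead_coeff a = 1"
  proof -
    show "degree a = n" by (rule antisym[OF degree_le le_degree]) (auto simp: ca)
    thus "lead_coeff a = 1" by (simp add: ca)
  qed
  have l2: "lead_coeff (a + smult (x + 1) b) = 1"
  proof -
    have "degree (a + smult (x + 1) b) = n" by (rule antisym[OF degree_le le_degree]) (auto simp: ca cb)
    thus ?thesis by (simp add: ca cb)
  qed
  have "(a + y * b) * (a + (y + 1) * b) = a * a + a * b + y * (y + 1) * (b * b) + (y + y) * (a * b)"
    for y :: "Omega poly"
    by (simp only: distrib_left distrib_right mult_1_left mult_1_right ac_simps)
  from this[of "[:x:]"] have "q = a * a + a * b + [:x * (x + 1):] * (b * b)"
    by (simp add: q_def pab one_pCons mult.commute[of x])
  also have "x * (x + 1) = h" using h(1) by (simp add: algebra_simps power2_eq_square)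
  finally have "q \<in> polys A" using ab h(2) is_subringD[OF A] by (auto intro!: polys_closed A)
  moreover have "lead_coeff q = 1" unfolding q_def lead_coeff_mult using p(1) l2 by simp
  moreover have "poly q z = 0" by (simp add: q_def p(3))
  ultimately show ?thesis by blast
qed

text \<open>Specialisation of the coordinate ring from e to p. The choice of a representing function
  is immaterial at points of \<open>Z\<close>, because e is generic (\<open>sp_eq\<close>).\<close>

definition sp :: "nat set \<Rightarrow> env \<Rightarrow> env \<Rightarrow> Omega \<Rightarrow> Omega" where
  "sp I e p z = (SOME f. f \<in> PF I \<and> f e = z) p"

lemma sp_eq:
  assumes "tower I Z e" "f \<in> PF I" "Z p"
  shows "sp I e p (f e) = f p"
proof -
  define g where "g = (SOME g. g \<in> PF I \<and> g e = f e)"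
  have g: "g \<in> PF I \<and> g e = f e" unfolding g_def by (rule someI[of _ f]) (use assms in auto)
  hence "(\<lambda>p. g p + f p) \<in> PF I" using assms by auto
  from towerD(3)[OF assms(1) this _ assms(3)] g show ?thesis
    by (simp add: sp_def flip: g_def)
qed

text \<open>Rewrite rules that lower squares of a generator; the second form matches right-nested
  products. With \<open>algebra_simps\<close> they bring elements of a tower to normal form, which
  is how the explicit identities are verified.\<close>

lemma AS_rule:
  assumes "(a::Omega)\<^sup>2 + a = b"
  shows "a * a = a + b" "a * (a * z) = a * z + b * z"
proof -
  show 1: "a * a = a + b" using assms by (auto simp: power2_eq_square)
  show "a * (a * z) = a * z + b * z" by (simp only: mult.assoc[symmetric] distrib_right 1)
qed

text \<open>The Artin-Schreier right-hand side of x + \<kappa> d, written in the parameter v. The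
  corrections w v^5 and \<kappa> v^6 remove the terms of degree 10 and 12, as w^2 = w + 1, and leave
  the odd degree 9 with leading coefficient w + \<kappa>.\<close>

lemma reduced_x_polynomial:
  assumes "(w::Omega)\<^sup>2 + w = 1"
  shows "(w * (v ^ 4 + v) + (v ^ 4 + v)\<^sup>2) * ((w + 1) * v\<^sup>2 + w * v) + (w\<^sup>2 * v ^ 10 + w * v ^ 5)
     + \<kappa> * (v ^ 12 + v ^ 9 + v ^ 6 + v ^ 3) + \<kappa> * (v ^ 12 + v ^ 6)
     = poly (monom (w + \<kappa>) 9 + [:0, 0, w + 1, w + 1 + \<kappa>, w + 1, 1, 1:]) v"
  by (simp add: poly_monom numeral_eq_Suc algebra_simps AS_rule[OF assms])

section \<open>The two coverings\<close>

definition cover :: "Omega \<Rightarrow> env \<Rightarrow> bool" where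
  "cover c e \<longleftrightarrow> e 6 ^ 2 + e 6 = 1 \<and> e 2 ^ 2 + e 2 = e 6 * e 0 \<and>
     e 3 ^ 2 + e 3 = (e 6 * e 0 + e 0 ^ 2) * e 2 + c * e 0 ^ 3"

definition gcover :: "env \<Rightarrow> bool" where
  "gcover e \<longleftrightarrow> cover 0 e \<and> e 4 ^ 2 + e 4 = e 0 \<and> e 5 ^ 2 + e 5 = e 0 ^ 3"

lemma cover_D:
  assumes "cover c e"
  shows "e 6 ^ 2 + e 6 = 1" "e 2 ^ 2 + e 2 = e 6 * e 0"
     "e 3 ^ 2 + e 3 = (e 6 * e 0 + e 0 ^ 2) * e 2 + c * e 0 ^ 3"
  using assms by (simp_all add: cover_def)

lemma gcover_D:
  assumes "gcover e"
  shows "e 6 ^ 2 + e 6 = 1" "e 2 ^ 2 + e 2 = e 6 * e 0"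
     "e 3 ^ 2 + e 3 = (e 6 * e 0 + e 0 ^ 2) * e 2" "e 4 ^ 2 + e 4 = e 0" "e 5 ^ 2 + e 5 = e 0 ^ 3"
  using assms by (simp_all add: gcover_def cover_def)

lemma is_subfield_F4: "is_subfield F4" and finite_F4: "finite F4" and card_F4: "card F4 = 4"
  using is_subfield_GF[of 2] card_GF[of 2] by simp_all

lemma is_subring_F4: "is_subring F4" using is_subfieldD(7)[OF is_subfield_F4] .

lemma is_subring_F2: "is_subring {0, 1}" using is_subfieldD(7)[OF is_subfield_F2] .

lemma F2_subset_F4: "{0, 1} \<subseteq> F4"
  using is_subfieldD(1,2)[OF is_subfield_F4] by auto

lemma w_in_F4: "(w::Omega)\<^sup>2 + w = 1 \<Longrightarrow> w \<in> F4"
  using GF4_eq by simp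

locale generic_point =
  fixes e :: env
  assumes U: "gcover e" and T: "e 0 = T"
begin

abbreviation "w \<equiv> e 6"
abbreviation "y \<equiv> e 2"
abbreviation "x \<equiv> e 3"
abbreviation "s \<equiv> e 4"
abbreviation "d \<equiv> e 5"

lemma rels: "w\<^sup>2 + w = 1" "y\<^sup>2 + y = w * T" "x\<^sup>2 + x = (w * T + T\<^sup>2) * y"
  "s\<^sup>2 + s = T" "d\<^sup>2 + d = T ^ 3"
  using gcover_D[OF U] T by simp_all

lemma w4: "w \<in> F4" "w + 1 \<in> F4"
  using w_in_F4[OF rels(1)] is_subfieldD(2,3)[OF is_subfield_F4] by auto

lemma w01: "w \<noteq> 0" "w \<noteq> 1" using rels(1) by auto

text \<open>
  A rational parameter of \<open>F\<^sub>4(T)(y, s)\<close>; it reduces the nontriviality of the last two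
  Artin--Schreier steps to the parity of a degree.
\<close>

definition v :: Omega where "v = y + (w + 1) * s"

text \<open>In v^2 + v the terms with w cancel, because w T = w (s^2 + s) and (w + 1)^2 = w. Then T
  = v^4 + v, the additive polynomial with kernel F_4, so T, s and y are all polynomials in
  v.\<close>

lemma v_rels: "v\<^sup>2 + v = s" "T = v ^ 4 + v" "y = (w + 1) * v\<^sup>2 + w * v" "s = v\<^sup>2 + v"
proof -
  show 1: "v\<^sup>2 + v = s"
    by (simp add: v_def power2_eq_square algebra_simps AS_rule[OF rels(1)] AS_rule[OF rels(2)] AS_rule[OF rels(4)])
  thus s: "s = v\<^sup>2 + v" by simp
  have "T = s\<^sup>2 + s" using rels(4) by simp
  thus "T = v ^ 4 + v" unfolding s by (simp add: power2_eq_square power4_eq_xxxx algebra_simps)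
  have "y = v + (w + 1) * s" by (simp add: v_def)
  thus "y = (w + 1) * v\<^sup>2 + w * v" unfolding s by (simp add: power2_eq_square algebra_simps)
qed

lemma transc_F4_y: "transc F4 y"
proof (rule transc_if_Pol_contains[OF is_subfield_F4 finite_F4])
  have "T = poly [:0, w + 1, w + 1:] y"
    by (simp add: power2_eq_square algebra_simps AS_rule[OF rels(1)] AS_rule[OF rels(2)])
  moreover have "[:0, w + 1, w + 1:] \<in> polys F4"
    using w4 by (intro polys_closed is_subring_F4) (auto intro: is_subfieldD[OF is_subfield_F4])
  ultimately show "T \<in> Pol F4 y" unfolding Pol_def by blast
qed (rule T_power_inj)

lemma transc_F4_v: "transc F4 v"
proof (rule transc_if_Pol_contains[OF is_subfield_F4 finite_F4])
  have "T = poly [:0, 1, 0, 0, 1:] v"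
    by (simp add: v_rels(2) power4_eq_xxxx algebra_simps)
  moreover have "[:0, 1, 0, 0, 1:] \<in> polys F4"
    by (intro polys_closed is_subring_F4) (auto intro: is_subfieldD[OF is_subfield_F4])
  ultimately show "T \<in> Pol F4 v" unfolding Pol_def by blast
qed (rule T_power_inj)

text \<open>T is transcendental over F_4 as well, so w = a(T)/b(T) would give a = w b, and comparing
  coefficients in {0, 1} is impossible.\<close>

lemma w_notin: "w \<notin> Fr {0} e"
proof
  assume "w \<in> Fr {0} e"
  then obtain a b where ab: "w = poly a T / poly b T" "a \<in> polys {0,1}" "b \<in> polys {0,1}" "poly b T \<noteq> 0"
    by (auto simp: Fr0_eq Rat_def Pol_def T)
  hence "poly (a - smult w b) T = 0" by (simp add: field_simps)
  moreover have "a - smult w b \<in> polys F4"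
    using ab(2,3) polys_mono[OF F2_subset_F4] w4 by (intro polys_closed is_subring_F4) auto
  ultimately have "a = smult w b" using transc_T[OF is_subfield_F4 finite_F4] by (auto simp: transc_def)
  hence "coeff a (degree b) = w * lead_coeff b" by simp
  moreover have "coeff a (degree b) \<in> {0,1}" "lead_coeff b \<in> {0,1}"
    using ab unfolding polys_def by blast+
  moreover have "lead_coeff b \<noteq> 0" using ab(4) by auto
  ultimately show False using w01 by auto
qed

lemma Rat_contains: "F4 \<subseteq> Rat F4 t" "t \<in> Rat F4 t"
  using Pol_contains[OF is_subring_F4] Pol_subset_Rat[OF is_subring_F4] by blast+

lemmas Rat_closed = is_subfieldD[OF is_subfield_Rat[OF is_subring_F4]]

lemma y_notin: "y \<notin> Fr {6, 0} e"
proof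
  assume "y \<in> Fr {6, 0} e"
  moreover have "Fr {6, 0} e \<subseteq> Rat F4 T"
    using w4 Rat_contains by (intro Fr_least is_subfield_Rat is_subring_F4) (auto simp: T)
  ultimately have y: "y \<in> Rat F4 T" by blast
  have "[:0, w:] \<in> polys F4" using w4 by (intro polys_closed is_subring_F4) (auto intro: is_subfieldD[OF is_subfield_F4])
  moreover have "odd (degree [:0, w:])" using w01 by simp
  ultimately have "y\<^sup>2 + y \<noteq> poly [:0, w:] T"
    using AS_odd_degree[OF is_subfield_F4 transc_T[OF is_subfield_F4 finite_F4] _ _ y] by blast
  thus False by (simp add: rels(2) mult.commute)
qed

lemma s_notin: "s \<notin> Fr {2, 6, 0} e"
proof
  assume "s \<in> Fr {2, 6, 0} e"
  moreover have "Fr {2, 6, 0} e \<subseteq> Rat F4 y"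
  proof (intro Fr_least is_subfield_Rat is_subring_F4)
    have "T = (w + 1) * (y * y + y)"
      by (simp add: algebra_simps AS_rule[OF rels(1)] AS_rule[OF rels(2)])
    also have "\<dots> \<in> Rat F4 y" using w4 Rat_contains by (intro Rat_closed) auto
    finally show "e i \<in> Rat F4 y" if "i \<in> {2, 6, 0}" for i
      using w4 Rat_contains that by (auto simp: T)
  qed auto
  ultimately have s: "s \<in> Rat F4 y" by blast
  \<comment> \<open>Adding w y turns the right-hand side T, of even degree 2 in y, into y
    itself.\<close>
  have "s + w * y \<in> Rat F4 y" using s w4 Rat_contains by (intro Rat_closed) auto
  moreover have "[:0, 1:] \<in> polys F4" by (intro polys_closed is_subring_F4) (auto intro: is_subfieldD[OF is_subfield_F4])
  moreover have "odd (degree [:0, 1::Omega:])" by simp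
  ultimately have "(s + w * y)\<^sup>2 + (s + w * y) \<noteq> poly [:0, 1:] y"
    using AS_odd_degree[OF is_subfield_F4 transc_F4_y] by blast
  moreover have "(s + w * y)\<^sup>2 + (s + w * y) = y"
    by (simp add: power2_eq_square algebra_simps AS_rule[OF rels(1)] AS_rule[OF rels(2)] AS_rule[OF rels(4)])
  ultimately show False by simp
qed

lemma Fr_subset_Rat_v: "Fr {4, 2, 6, 0} e \<subseteq> Rat F4 v"
proof (intro Fr_least is_subfield_Rat is_subring_F4)
  have "v ^ 4 + v \<in> Rat F4 v" "(w + 1) * v\<^sup>2 + w * v \<in> Rat F4 v" "v\<^sup>2 + v \<in> Rat F4 v"
    using w4 Rat_contains by (auto intro!: Rat_closed(2,3,4) is_subring_power Rat_closed(7))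
  thus "e i \<in> Rat F4 v" if "i \<in> {4, 2, 6, 0}" for i
    using w4 Rat_contains that by (auto simp: T simp flip: v_rels(2,3,4))
qed auto

lemma d_v: "d\<^sup>2 + d = v ^ 12 + v ^ 9 + v ^ 6 + v ^ 3"
proof -
  have "d\<^sup>2 + d = (v ^ 4 + v) ^ 3" by (simp only: rels(5) v_rels(2)[symmetric])
  also have "\<dots> = v ^ 12 + v ^ 9 + v ^ 6 + v ^ 3"
    by (simp add: power3_eq_cube algebra_simps flip: power_add power_Suc power_Suc2)
  finally show ?thesis .
qed

lemma d_notin: "d \<notin> Rat F4 v"
proof
  assume d: "d \<in> Rat F4 v"
  \<comment> \<open>Adding v^6 removes the leading term v^12 and the term v^6, so that the odd
    degree 9 remains.\<close>
  have "d + v ^ 6 \<in> Rat F4 v" using d Rat_contains by (intro Rat_closed is_subring_power) auto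
  moreover have "monom 1 9 + monom 1 3 \<in> polys F4"
    by (intro polys_closed is_subring_F4) (auto intro: is_subfieldD[OF is_subfield_F4])
  moreover have "odd (degree (monom 1 9 + monom (1::Omega) 3))"
    by (subst degree_add_eq_left) (auto simp: degree_monom_eq)
  ultimately have "(d + v ^ 6)\<^sup>2 + (d + v ^ 6) \<noteq> poly (monom 1 9 + monom 1 3) v"
    using AS_odd_degree[OF is_subfield_F4 transc_F4_v] by blast
  moreover have "(d + v ^ 6)\<^sup>2 + (d + v ^ 6) = (d\<^sup>2 + d) + v ^ 12 + v ^ 6"
    by (simp add: power2_eq_square algebra_simps flip: power_add)
  moreover have "\<dots> = poly (monom 1 9 + monom 1 3) v"
    unfolding d_v by (simp add: poly_monom ac_simps)
  ultimately show False by simp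
qed

text \<open>Both values of \<kappa> matter: x and x + d generate the last step for the two
  coverings, and together they show that x is not even in F_4(v, d).\<close>

lemma x_notin_aux:
  assumes \<kappa>: "\<kappa> = 0 \<or> \<kappa> = 1"
  shows "x + \<kappa> * d \<notin> Rat F4 v"
proof
  assume x: "x + \<kappa> * d \<in> Rat F4 v"
  define z where "z = x + \<kappa> * d + (w * v ^ 5 + \<kappa> * v ^ 6)"
  define p where "p = monom (w + \<kappa>) 9 + [:0, 0, w + 1, w + 1 + \<kappa>, w + 1, 1, 1:]"
  note F4 = is_subfieldD[OF is_subfield_F4]
  have \<kappa>4: "\<kappa> \<in> F4" using \<kappa> F4 by auto
  hence "\<kappa> \<in> Rat F4 v" "w \<in> Rat F4 v" using w4 Rat_contains by auto
  hence z: "z \<in> Rat F4 v" unfolding z_def using Rat_contains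
    by (intro Rat_closed(3)[OF x] Rat_closed(3,4) is_subring_power Rat_closed(7)) auto
  have wk: "w + \<kappa> \<in> F4" "w + 1 + \<kappa> \<in> F4" using w4 \<kappa>4 by (auto intro: F4)
  hence p: "p \<in> polys F4" unfolding p_def using w4
    by (intro polys_closed is_subring_F4) (auto intro: F4)
  have "w + \<kappa> \<noteq> 0" using w01 \<kappa> by auto
  hence "degree p = 9" unfolding p_def
    by (subst degree_add_eq_left) (auto simp: degree_monom_eq degree_pCons_eq_if)
  hence "z\<^sup>2 + z \<noteq> poly p v"
    using AS_odd_degree[OF is_subfield_F4 transc_F4_v p _ z] by simp
  moreover have "z\<^sup>2 + z = (x\<^sup>2 + x) + (w\<^sup>2 * v ^ 10 + w * v ^ 5) + \<kappa> * (d\<^sup>2 + d) + \<kappa> * (v ^ 12 + v ^ 6)"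
    using \<kappa> by (auto simp: z_def power2_eq_square algebra_simps simp flip: power_add)
  moreover have "x\<^sup>2 + x = (w * (v ^ 4 + v) + (v ^ 4 + v)\<^sup>2) * ((w + 1) * v\<^sup>2 + w * v)"
    by (simp only: rels(3) flip: v_rels(2,3))
  moreover have "(w * (v ^ 4 + v) + (v ^ 4 + v)\<^sup>2) * ((w + 1) * v\<^sup>2 + w * v) + (w\<^sup>2 * v ^ 10 + w * v ^ 5)
     + \<kappa> * (v ^ 12 + v ^ 9 + v ^ 6 + v ^ 3) + \<kappa> * (v ^ 12 + v ^ 6) = poly p v"
    unfolding p_def by (rule reduced_x_polynomial[OF rels(1)])
  ultimately show False using d_v by (simp only: simp_thms)
qed

text \<open>The order is chosen so that w, y and s come first and stay inside the rational function
  field F_4(v), where degrees decide. If x = a + b d, its equation yields b^2 + b = 0 by comparing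
  coefficients of d, so x or x + d would lie in F_4(v).\<close>

lemma towers:
  "tower {0} gcover e" "tower {6, 0} gcover e" "tower {2, 6, 0} gcover e" "tower {4, 2, 6, 0} gcover e"
  "tower {5, 4, 2, 6, 0} gcover e" "tower {3, 5, 4, 2, 6, 0} gcover e"
  and steps: "AS_step {0} gcover e 6 (\<lambda>_. 1)" "AS_step {6, 0} gcover e 2 (\<lambda>p. p 6 * p 0)"
    "AS_step {2, 6, 0} gcover e 4 (\<lambda>p. p 0)" "AS_step {4, 2, 6, 0} gcover e 5 (\<lambda>p. p 0 ^ 3)"
    "AS_step {5, 4, 2, 6, 0} gcover e 3 (\<lambda>p. (p 6 * p 0 + p 0 ^ 2) * p 2)"
  and Fr5: "Fr {5, 4, 2, 6, 0} e = {a + b * d | a b. a \<in> Fr {4, 2, 6, 0} e \<and> b \<in> Fr {4, 2, 6, 0} e}"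
proof -
  have "transc {0, 1} T" by (rule transc_T[OF is_subfield_F2]) simp
  thus 0: "tower {0} gcover e" by (intro tower_base U) (simp add: T)
  interpret s1: AS_step "{0}" gcover e 6 "\<lambda>_. 1"
    by unfold_locales (use 0 w_notin in \<open>auto simp: gcover_D\<close>)
  show 1: "tower {6, 0} gcover e" by (rule s1.tower_insert)
  interpret s2: AS_step "{6, 0}" gcover e 2 "\<lambda>p. p 6 * p 0"
    by unfold_locales (use 1 y_notin in \<open>auto simp: gcover_D\<close>)
  show 2: "tower {2, 6, 0} gcover e" by (rule s2.tower_insert)
  interpret s4: AS_step "{2, 6, 0}" gcover e 4 "\<lambda>p. p 0"
    by unfold_locales (use 2 s_notin in \<open>auto simp: gcover_D\<close>)
  show 4: "tower {4, 2, 6, 0} gcover e" by (rule s4.tower_insert)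
  interpret s5: AS_step "{4, 2, 6, 0}" gcover e 5 "\<lambda>p. p 0 ^ 3"
    by unfold_locales (use 4 d_notin Fr_subset_Rat_v in \<open>auto simp: gcover_D\<close>)
  show 5: "tower {5, 4, 2, 6, 0} gcover e" by (rule s5.tower_insert)
  show Fr5: "Fr {5, 4, 2, 6, 0} e = {a + b * d | a b. a \<in> Fr {4, 2, 6, 0} e \<and> b \<in> Fr {4, 2, 6, 0} e}"
    using s5.Fr_insert .
  have "x \<notin> Fr {5, 4, 2, 6, 0} e"
  proof
    assume "x \<in> Fr {5, 4, 2, 6, 0} e"
    then obtain a b where ab: "x = a + b * d" "a \<in> Fr {4, 2, 6, 0} e" "b \<in> Fr {4, 2, 6, 0} e"
      unfolding Fr5 by blast
    have v4: "e i \<in> Fr {4, 2, 6, 0} e" if "i \<in> {4, 2, 6, 0}" for i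
      using Rv_var[OF that] Rv_subset_Fr by blast
    have T4: "T \<in> Fr {4, 2, 6, 0} e" using v4[of 0] T by simp
    have r4: "w \<in> Fr {4, 2, 6, 0} e" "y \<in> Fr {4, 2, 6, 0} e" using v4[of 6] v4[of 2] by simp_all
    have "x\<^sup>2 + x = (a\<^sup>2 + a + b\<^sup>2 * T ^ 3) + (b\<^sup>2 + b) * d"
      unfolding ab(1) by (simp add: power2_eq_square algebra_simps AS_rule[OF rels(5)])
    hence "(a\<^sup>2 + a + b\<^sup>2 * T ^ 3) + (b\<^sup>2 + b) * d = (w * T + T\<^sup>2) * y + 0 * d"
      using rels(3) by simp
    moreover have "a\<^sup>2 + a + b\<^sup>2 * T ^ 3 \<in> Fr {4, 2, 6, 0} e" "b\<^sup>2 + b \<in> Fr {4, 2, 6, 0} e"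
      "(w * T + T\<^sup>2) * y \<in> Fr {4, 2, 6, 0} e" "0 \<in> Fr {4, 2, 6, 0} e"
      using T4 r4 ab by (auto intro!: s5.Fr_closed(1,3,4) is_subring_power s5.Fr_closed(7))
    ultimately have "b\<^sup>2 + b = 0" using s5.unique by blast
    hence "b * (b + 1) = 0" by (simp add: power2_eq_square algebra_simps)
    hence "b = 0 \<or> b = 1" by auto
    from x_notin_aux[OF this] have "x + b * d \<notin> Rat F4 v" .
    moreover have "x + b * d = a" by (simp add: ab(1))
    ultimately show False using ab(2) Fr_subset_Rat_v by blast
  qed
  then interpret s3: AS_step "{5, 4, 2, 6, 0}" gcover e 3 "\<lambda>p. (p 6 * p 0 + p 0 ^ 2) * p 2"
    by unfold_locales (use 5 in \<open>auto simp: gcover_D\<close>)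
  show "tower {3, 5, 4, 2, 6, 0} gcover e" by (rule s3.tower_insert)
  show "AS_step {0} gcover e 6 (\<lambda>_. 1)" "AS_step {6, 0} gcover e 2 (\<lambda>p. p 6 * p 0)"
    "AS_step {2, 6, 0} gcover e 4 (\<lambda>p. p 0)" "AS_step {4, 2, 6, 0} gcover e 5 (\<lambda>p. p 0 ^ 3)"
    "AS_step {5, 4, 2, 6, 0} gcover e 3 (\<lambda>p. (p 6 * p 0 + p 0 ^ 2) * p 2)"
    by (rule s1.AS_step_axioms s2.AS_step_axioms s4.AS_step_axioms s5.AS_step_axioms s3.AS_step_axioms)+
qed

end

text \<open>Removing c d from coordinate 3 turns a point of either covering into a point of the
  common Galois cover.\<close>

lemma extend_point:
  assumes "cover c e" "c = 0 \<or> c = 1"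
  obtains e' where "gcover e'" "e' 0 = e 0" "e' 6 = e 6" "e' 2 = e 2" "e 3 = e' 3 + c * e' 5"
proof -
  obtain s d where sd: "s\<^sup>2 + s = e 0" "d\<^sup>2 + d = e 0 ^ 3" using alg_closed_AS by metis
  define e' where "e' = e(3 := e 3 + c * d, 4 := s, 5 := d)"
  have "(e 3 + c * d)\<^sup>2 + (e 3 + c * d) = (e 3 ^ 2 + e 3) + c * (d\<^sup>2 + d)"
    using assms(2) by (auto simp: power2_eq_square algebra_simps)
  hence "gcover e'" using cover_D[OF assms(1)] sd by (simp add: gcover_def cover_def e'_def)
  thus ?thesis by (intro that[of e']) (auto simp: e'_def)
qed

lemma cover_towers:
  assumes V: "cover c e" and c: "c = 0 \<or> c = 1" and eT: "e 0 = T"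
  shows "tower {0} (cover c) e" "tower {6, 0} (cover c) e" "tower {2, 6, 0} (cover c) e" "tower {3, 2, 6, 0} (cover c) e"
    and "AS_step {0} (cover c) e 6 (\<lambda>_. 1)" "AS_step {6, 0} (cover c) e 2 (\<lambda>p. p 6 * p 0)"
      "AS_step {2, 6, 0} (cover c) e 3 (\<lambda>p. (p 6 * p 0 + p 0 ^ 2) * p 2 + c * p 0 ^ 3)"
proof -
  obtain e' where e': "gcover e'" "e' 0 = e 0" "e' 6 = e 6" "e' 2 = e 2" "e 3 = e' 3 + c * e' 5"
    using extend_point[OF V c] .
  interpret generic_point e' by (rule generic_point.intro) (simp_all add: e'(1,2) eT)
  have eq: "Rv I e = Rv I e'" if "I \<subseteq> {2, 6, 0}" for I
    unfolding Rv_def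
  proof (rule image_cong[OF refl])
    fix f assume "f \<in> PF I"
    thus "f e = f e'" by (rule PF_cong) (use that e' in auto)
  qed
  have Feq: "Fr I e = Fr I e'" if "I \<subseteq> {2, 6, 0}" for I
    unfolding Fr_def using eq[OF that] eq[of "{0}"] by simp
  have "transc {0, 1} (e 0)" unfolding eT by (rule transc_T[OF is_subfield_F2]) simp
  thus 0: "tower {0} (cover c) e" by (intro tower_base V)
  show 01: "AS_step {0} (cover c) e 6 (\<lambda>_. 1)"
    by unfold_locales (use 0 w_notin in \<open>auto simp: cover_D Feq e'\<close>)
  then interpret s1: AS_step "{0}" "cover c" e 6 "\<lambda>_. 1" .
  show 1: "tower {6, 0} (cover c) e" by (rule s1.tower_insert)
  show 02: "AS_step {6, 0} (cover c) e 2 (\<lambda>p. p 6 * p 0)"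
    by unfold_locales (use 1 y_notin in \<open>auto simp: cover_D Feq e'\<close>)
  then interpret s2: AS_step "{6, 0}" "cover c" e 2 "\<lambda>p. p 6 * p 0" .
  show 2: "tower {2, 6, 0} (cover c) e" by (rule s2.tower_insert)
  have "e 3 \<notin> Fr {2, 6, 0} e"
    using x_notin_aux[OF c] Fr_subset_Rat_v Fr_mono[of "{2,6,0}" "{4,2,6,0}" e'] by (auto simp: e'(5) Feq)
  moreover have "(\<lambda>p. c) \<in> PF {2, 6, 0}" using c by auto
  ultimately show "AS_step {2, 6, 0} (cover c) e 3 (\<lambda>p. (p 6 * p 0 + p 0 ^ 2) * p 2 + c * p 0 ^ 3)"
    using 2 by unfold_locales (auto simp: cover_D)
  then interpret s3: AS_step "{2, 6, 0}" "cover c" e 3 "\<lambda>p. (p 6 * p 0 + p 0 ^ 2) * p 2 + c * p 0 ^ 3" .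
  show "tower {3, 2, 6, 0} (cover c) e" by (rule s3.tower_insert)
qed

section \<open>Primes above a prime and their inertia degrees\<close>

definition hom_on :: "Omega set \<Rightarrow> (Omega \<Rightarrow> Omega) \<Rightarrow> bool" where
  "hom_on B \<psi> \<longleftrightarrow> \<psi> 1 = 1 \<and> (\<forall>a\<in>B. \<forall>b\<in>B. \<psi> (a + b) = \<psi> a + \<psi> b \<and> \<psi> (a * b) = \<psi> a * \<psi> b)"

definition ker_on :: "Omega set \<Rightarrow> (Omega \<Rightarrow> Omega) \<Rightarrow> Omega set" where
  "ker_on B \<psi> = {b \<in> B. \<psi> b = 0}"

lemma hom_onD:
  assumes "hom_on B \<psi>"
  shows "\<psi> 1 = 1" "a \<in> B \<Longrightarrow> b \<in> B \<Longrightarrow> \<psi> (a + b) = \<psi> a + \<psi> b" "a \<in> B \<Longrightarrow> b \<in> B \<Longrightarrow> \<psi> (a * b) = \<psi> a * \<psi> b"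
    "a \<in> B \<Longrightarrow> \<psi> 0 = 0"
proof -
  show "\<psi> 1 = 1" "a \<in> B \<Longrightarrow> b \<in> B \<Longrightarrow> \<psi> (a + b) = \<psi> a + \<psi> b"
    "a \<in> B \<Longrightarrow> b \<in> B \<Longrightarrow> \<psi> (a * b) = \<psi> a * \<psi> b" using assms by (auto simp: hom_on_def)
  assume "a \<in> B"
  hence "\<psi> (a + a) = \<psi> a + \<psi> a" using assms by (simp only: hom_on_def)
  thus "\<psi> 0 = 0" by simp
qed

lemma hom_on_mono: "hom_on B \<psi> \<Longrightarrow> A \<subseteq> B \<Longrightarrow> hom_on A \<psi>"
  unfolding hom_on_def by blast

lemma hom_on_power: "is_subring B \<Longrightarrow> hom_on B \<psi> \<Longrightarrow> b \<in> B \<Longrightarrow> \<psi> (b ^ n) = \<psi> b ^ n"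
  by (induction n) (auto simp: hom_onD is_subring_power)

lemma hom_on_image: "is_subring B \<Longrightarrow> hom_on B \<psi> \<Longrightarrow> is_subring (\<psi> ` B)"
proof -
  assume B: "is_subring B" and h: "hom_on B \<psi>"
  have "\<psi> 0 = 0" using hom_onD(4)[OF h is_subringD(1)[OF B]] .
  thus ?thesis unfolding is_subring_def
    using is_subringD[OF B] hom_onD(1)[OF h] hom_onD(2,3)[OF h, symmetric]
    by (auto intro!: image_eqI[of 0 _ 0] image_eqI[of 1 _ 1])
qed

lemma finite_subring_field:
  assumes E: "is_subring E" "finite (E::Omega set)" shows "is_subfield E"
  unfolding is_subfield_def
proof (intro conjI ballI E)
  fix x assume x: "x \<in> E"
  show "inverse x \<in> E"
  proof (cases "x = 0")
    case False
    have "(\<lambda>y. x * y) ` E = E"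
      by (rule endo_inj_surj[OF E(2)]) (use x False is_subringD[OF E(1)] in \<open>auto simp: inj_on_def\<close>)
    then obtain y where "y \<in> E" "x * y = 1" using is_subringD(2)[OF E(1)] by (metis imageE)
    thus ?thesis using inverse_unique by metis
  qed (use x in auto)
qed

lemma ring_hom_ring_amb:
  assumes B: "is_subring B" and h: "hom_on B \<psi>"
  shows "ring_hom_ring (sub_of B) (amb::Omega ring) \<psi>"
proof (rule ring_hom_ringI)
  show "ring (sub_of B)" using cring_sub_of[OF B] cring.axioms(1) by blast
  show "ring (amb::Omega ring)" by (rule amb.ring_axioms)
qed (auto simp: hom_onD[OF h])

lemma a_kernel_eq: "a_kernel (sub_of B) (amb::Omega ring) \<psi> = ker_on B \<psi>"
  by (auto simp: a_kernel_def' ker_on_def)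

lemma ker_primeideal:
  assumes B: "is_subring B" and h: "hom_on B \<psi>"
  shows "primeideal (ker_on B \<psi>) (sub_of B)"
proof (rule primeidealI)
  show "ideal (ker_on B \<psi>) (sub_of B)"
    using ring_hom_ring.kernel_is_ideal[OF ring_hom_ring_amb[OF B h]] by (simp add: a_kernel_eq)
  show "cring (sub_of B)" using cring_sub_of[OF B] .
  show "carrier (sub_of B) \<noteq> ker_on B \<psi>"
  proof
    assume "carrier (sub_of B) = ker_on B \<psi>"
    hence "1 \<in> ker_on B \<psi>" using is_subringD(2)[OF B] by simp
    thus False using hom_onD(1)[OF h] by (simp add: ker_on_def)
  qed
qed (use hom_onD(3)[OF h] in \<open>auto simp: ker_on_def\<close>)

lemma prime_ideal_props:
  assumes "primeideal P (sub_of B)" and B: "is_subring B"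
  shows "P \<subseteq> B" "1 \<notin> P" "0 \<in> P" "a \<in> P \<Longrightarrow> b \<in> P \<Longrightarrow> a + b \<in> P" "a \<in> P \<Longrightarrow> b \<in> B \<Longrightarrow> a * b \<in> P"
    "a \<in> B \<Longrightarrow> b \<in> B \<Longrightarrow> a * b \<in> P \<Longrightarrow> a \<in> P \<or> b \<in> P"
proof -
  interpret primeideal P "sub_of B" by fact
  show "P \<subseteq> B" using a_subset by simp
  show "1 \<notin> P" using one_imp_carrier I_notcarr by auto
  show "0 \<in> P" using additive_subgroup.zero_closed[OF is_additive_subgroup] by simp
  show "a \<in> P \<Longrightarrow> b \<in> P \<Longrightarrow> a + b \<in> P" using additive_subgroup.a_closed[OF is_additive_subgroup, of a b] by simp
  show "a \<in> P \<Longrightarrow> b \<in> B \<Longrightarrow> a * b \<in> P" using I_r_closed[of a b] by simp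
  show "a \<in> B \<Longrightarrow> b \<in> B \<Longrightarrow> a * b \<in> P \<Longrightarrow> a \<in> P \<or> b \<in> P" using I_prime[of a b] by simp
qed

text \<open>The image of \<psi> is a finite integral domain, hence a field; an element of
  \<open>P\<close> outside the kernel would be invertible modulo the kernel.\<close>

lemma ker_maximal:
  assumes B: "is_subring B" and h: "hom_on B \<psi>" and fin: "finite (\<psi> ` B)"
    and P: "primeideal P (sub_of B)" "ker_on B \<psi> \<subseteq> P"
  shows "P = ker_on B \<psi>"
proof (rule ccontr)
  note PP = prime_ideal_props[OF P(1) B]
  assume "P \<noteq> ker_on B \<psi>"
  then obtain b where b: "b \<in> P" "b \<in> B" "\<psi> b \<noteq> 0" using P(2) PP(1) by (auto simp: ker_on_def)
  have "inverse (\<psi> b) \<in> \<psi> ` B"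
    using finite_subring_field[OF hom_on_image[OF B h] fin] b is_subfieldD(5) by blast
  then obtain c where c: "c \<in> B" "\<psi> c = inverse (\<psi> b)" by auto
  have bc: "b * c \<in> B" using b c is_subringD[OF B] by blast
  have "\<psi> (b * c + 1) = 0"
    using b c bc hom_onD[OF h] is_subringD(2)[OF B] by simp
  hence "b * c + 1 \<in> P" using P(2) is_subringD[OF B] bc by (auto simp: ker_on_def)
  moreover have "b * c \<in> P" using b c PP by blast
  ultimately have "b * c + (b * c + 1) \<in> P" by (rule PP(4)[rotated])
  thus False using PP(2) by simp
qed

text \<open>If \<open>P\<close> contained none of the kernels, one could pick in each kernel an
  element outside \<open>P\<close>. Their product is killed by every \<psi>, so it lies in
  \<open>P\<close> by \<open>zero\<close>, against primality. The hypothesis \<open>zero\<close> is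
  the form in which unramifiedness enters.\<close>

lemma primes_above_eq:
  assumes A: "is_subring A" and B: "is_subring B" and AB: "A \<subseteq> B"
    and \<Psi>: "finite \<Psi>" "\<Psi> \<noteq> {}" "\<And>\<psi>. \<psi> \<in> \<Psi> \<Longrightarrow> hom_on B \<psi>" "\<And>\<psi>. \<psi> \<in> \<Psi> \<Longrightarrow> finite (\<psi> ` B)"
    and p: "p \<noteq> {0}" "\<And>\<psi>. \<psi> \<in> \<Psi> \<Longrightarrow> ker_on A \<psi> = p"
    and zero: "\<And>P b. primeideal P (sub_of B) \<Longrightarrow> p \<subseteq> P \<Longrightarrow> b \<in> B \<Longrightarrow> (\<And>\<psi>. \<psi> \<in> \<Psi> \<Longrightarrow> \<psi> b = 0) \<Longrightarrow> b \<in> P"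
  shows "primes_above A B p = ker_on B ` \<Psi>"
proof (intro equalityI subsetI)
  fix P assume "P \<in> ker_on B ` \<Psi>"
  then obtain \<psi> where \<psi>: "\<psi> \<in> \<Psi>" "P = ker_on B \<psi>" by blast
  have "P \<inter> A = p" using p(2)[OF \<psi>(1)] AB \<psi>(2) by (auto simp: ker_on_def)
  moreover have "P \<noteq> {0}"
  proof
    assume "P = {0}"
    hence "p \<subseteq> {0}" using \<open>P \<inter> A = p\<close> by auto
    moreover have "0 \<in> p"
      using p(2)[OF \<psi>(1)] is_subringD(1)[OF A] hom_onD(4)[OF \<Psi>(3)[OF \<psi>(1)]] AB by (auto simp: ker_on_def)
    ultimately show False using p(1) by auto
  qed
  ultimately show "P \<in> primes_above A B p"
    using ker_primeideal[OF B \<Psi>(3)[OF \<psi>(1)]] \<psi>(2) by (auto simp: primes_above_def nz_primes_def)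
next
  fix P assume "P \<in> primes_above A B p"
  hence P: "primeideal P (sub_of B)" "p \<subseteq> P" by (auto simp: primes_above_def nz_primes_def)
  note PP = prime_ideal_props[OF P(1) B]
  have "\<exists>\<psi>\<in>\<Psi>. ker_on B \<psi> \<subseteq> P"
  proof (rule ccontr)
    assume "\<not> ?thesis"
    hence "\<forall>\<psi>\<in>\<Psi>. \<exists>b. b \<in> B \<and> \<psi> b = 0 \<and> b \<notin> P" by (auto simp: ker_on_def)
    then obtain b where b: "\<And>\<psi>. \<psi> \<in> \<Psi> \<Longrightarrow> b \<psi> \<in> B" "\<And>\<psi>. \<psi> \<in> \<Psi> \<Longrightarrow> \<psi> (b \<psi>) = 0"
      "\<And>\<psi>. \<psi> \<in> \<Psi> \<Longrightarrow> b \<psi> \<notin> P" by metis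
    have "prod b \<Psi> \<in> B" using b(1) by (rule is_subring_prod[OF B])
    have "prod b S \<notin> P" if "S \<subseteq> \<Psi>" for S
      using finite_subset[OF that \<Psi>(1)] that
    proof induction
      case (insert \<psi> S)
      hence "prod b S \<in> B" "b \<psi> \<in> B" using b(1) by (auto intro!: is_subring_prod[OF B])
      thus ?case using insert PP(6)[of "b \<psi>" "prod b S"] b(3) by auto
    qed (simp add: PP(2))
    moreover have "\<psi> (prod b \<Psi>) = 0" if "\<psi> \<in> \<Psi>" for \<psi>
    proof -
      have "prod b (\<Psi> - {\<psi>}) \<in> B" using b(1) by (intro is_subring_prod[OF B]) auto
      moreover have "prod b \<Psi> = b \<psi> * prod b (\<Psi> - {\<psi>})" using \<Psi>(1) that by (simp add: prod.remove)
      ultimately show ?thesis using hom_onD(3)[OF \<Psi>(3)[OF that]] b that by simp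
    qed
    hence "prod b \<Psi> \<in> P" using zero[OF P \<open>prod b \<Psi> \<in> B\<close>] by blast
    ultimately show False by blast
  qed
  then obtain \<psi> where \<psi>: "\<psi> \<in> \<Psi>" "ker_on B \<psi> \<subseteq> P" by blast
  have "P = ker_on B \<psi>" using ker_maximal[OF B \<Psi>(3)[OF \<psi>(1)] \<Psi>(4)[OF \<psi>(1)] P(1) \<psi>(2)] .
  thus "P \<in> ker_on B ` \<Psi>" using \<psi>(1) by blast
qed

lemma (in ring) card_dimension:
  assumes K: "subfield K R" "finite K" and "dimension n K E"
  shows "card E = card K ^ n"
proof -
  obtain Vs where Vs: "set Vs \<subseteq> carrier R" "independent K Vs" "length Vs = n" "Span K Vs = E"
    using exists_base[OF K(1) assms(3)] by blast
  let ?L = "{Ks. set Ks \<subseteq> K \<and> length Ks = n}"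
  have "bij_betw (\<lambda>Ks. combine Ks Vs) ?L E"
  proof (rule bij_betwI')
    fix Ks Ls assume L: "Ks \<in> ?L" "Ls \<in> ?L"
    have in_Span: "combine Ks Vs \<in> Span K Vs" if "Ks \<in> ?L" for Ks
      using that Span_eq_combine_set_length_version[OF K(1) Vs(1)] Vs(3) by auto
    note ex1 = unique_decomposition[OF K(1) Vs(2) in_Span[OF L(1)]]
    have len: "set Ks \<subseteq> K" "length Ks = length Vs" "set Ls \<subseteq> K" "length Ls = length Vs"
      using L Vs(3) by simp_all
    show "(combine Ks Vs = combine Ls Vs) = (Ks = Ls)"
    proof
      assume eq: "combine Ks Vs = combine Ls Vs"
      from the1_equality[OF ex1 conjI[OF len(1) conjI[OF len(2) refl]]]
           the1_equality[OF ex1 conjI[OF len(3) conjI[OF len(4) eq]]]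
      show "Ks = Ls" by (rule trans[OF sym])
    qed (rule arg_cong)
  next
    fix Ks assume "Ks \<in> ?L"
    thus "combine Ks Vs \<in> E"
      using Span_eq_combine_set_length_version[OF K(1) Vs(1)] Vs(3,4) by auto
  next
    fix x assume "x \<in> E"
    thus "\<exists>Ks\<in>?L. x = combine Ks Vs"
      using Span_eq_combine_set_length_version[OF K(1) Vs(1)] Vs(3,4) by auto
  qed
  hence "card E = card ?L" by (rule bij_betw_same_card[symmetric])
  thus ?thesis using card_lists_length_eq[OF K(2)] by simp
qed

lemma card_quotient_ker:
  assumes B: "is_subring B" and h: "hom_on B \<psi>"
  shows "bij_betw (\<lambda>C. the_elem (\<psi> ` C)) (carrier (sub_of B Quot (ker_on B \<psi>))) (\<psi> ` B)"
    and "(\<lambda>C. the_elem (\<psi> ` C)) \<in> ring_iso (sub_of B Quot (ker_on B \<psi>)) (sub_of (\<psi> ` B))"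
proof -
  interpret ring_hom_ring "sub_of B" amb \<psi> by (rule ring_hom_ring_amb[OF B h])
  show iso: "(\<lambda>C. the_elem (\<psi> ` C)) \<in> ring_iso (sub_of B Quot (ker_on B \<psi>)) (sub_of (\<psi> ` B))"
    using FactRing_iso_set_aux by (simp add: a_kernel_eq)
  thus "bij_betw (\<lambda>C. the_elem (\<psi> ` C)) (carrier (sub_of B Quot (ker_on B \<psi>))) (\<psi> ` B)"
    by (simp add: ring_iso_def)
qed

lemma the_elem_coset:
  assumes B: "is_subring B" and h: "hom_on B \<psi>" and a: "a \<in> B"
  shows "the_elem (\<psi> ` (ker_on B \<psi> +>\<^bsub>sub_of B\<^esub> a)) = \<psi> a"
proof -
  have "ker_on B \<psi> +>\<^bsub>sub_of B\<^esub> a = {k + a | k. k \<in> ker_on B \<psi>}"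
    by (auto simp: a_r_coset_def')
  moreover have "\<psi> (k + a) = \<psi> a" if "k \<in> ker_on B \<psi>" for k
    using that hom_onD(2)[OF h] a by (auto simp: ker_on_def)
  moreover have "0 \<in> ker_on B \<psi>" using is_subringD(1)[OF B] hom_onD(4)[OF h] by (auto simp: ker_on_def)
  ultimately have "\<psi> ` (ker_on B \<psi> +>\<^bsub>sub_of B\<^esub> a) = {\<psi> a}" by (auto simp: image_iff)
  thus ?thesis by simp
qed

text \<open>The residue fields are finite, so the inertia degree, a dimension, can be read off
  cardinalities. The isomorphism of the quotient with \<psi>(B) moves the count into the ambient
  field.\<close>

lemma card_image_inertia_degree:
  assumes A: "is_subring A" and B: "is_subring B" and AB: "A \<subseteq> B" and h: "hom_on B \<psi>" and fin: "finite (\<psi> ` B)"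
  shows "card (\<psi> ` B) = card (\<psi> ` A) ^ inertia_degree A B (ker_on B \<psi>)"
proof -
  define Q where "Q = sub_of B Quot (ker_on B \<psi>)"
  define f where "f = (\<lambda>C. the_elem (\<psi> ` C))"
  define K where "K = (\<lambda>a. ker_on B \<psi> +>\<^bsub>sub_of B\<^esub> a) ` A"
  have bij: "bij_betw f (carrier Q) (\<psi> ` B)" and iso: "f \<in> ring_iso Q (sub_of (\<psi> ` B))"
    unfolding f_def Q_def by (rule card_quotient_ker[OF B h])+
  have E: "is_subring (\<psi> ` B)" "is_subring (\<psi> ` A)"
    using hom_on_image B h A hom_on_mono[OF h AB] by blast+
  have Ef: "is_subfield (\<psi> ` A)" "is_subfield (\<psi> ` B)"
    using finite_subring_field E fin finite_subset[OF image_mono[OF AB, of \<psi>]] by blast+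
  have ringQ: "ring Q" unfolding Q_def
    using ideal.quotient_is_ring[OF primeideal.axioms(1)[OF ker_primeideal[OF B h]]] .
  have ringE: "ring (sub_of (\<psi> ` B))" using cring_sub_of[OF E(1)] cring.axioms(1) by blast
  define g where "g = inv_into (carrier Q) f"
  have "g \<in> ring_iso (sub_of (\<psi> ` B)) Q"
    using ring_iso_set_sym[OF ringQ iso] by (simp add: g_def)
  hence ghom: "g \<in> ring_hom (sub_of (\<psi> ` B)) Q" by (simp add: ring_iso_def)
  have ga: "g (\<psi> a) = ker_on B \<psi> +>\<^bsub>sub_of B\<^esub> a" if "a \<in> B" for a
  proof -
    have "(ker_on B \<psi> +>\<^bsub>sub_of B\<^esub> a) \<in> carrier Q"
      using that by (auto simp: Q_def FactRing_def A_RCOSETS_def')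
    moreover have "f (ker_on B \<psi> +>\<^bsub>sub_of B\<^esub> a) = \<psi> a"
      unfolding f_def by (rule the_elem_coset[OF B h that])
    ultimately show ?thesis unfolding g_def using bij_betw_imp_inj_on[OF bij] by (simp add: inv_into_f_eq)
  qed
  have K_eq: "K = g ` (\<psi> ` A)" using ga AB by (auto simp: K_def image_image intro!: image_cong)
  interpret gh: ring_hom_ring "sub_of (\<psi> ` B)" Q g
    by (rule ring_hom_ringI2[OF ringE ringQ ghom])
  have "field (sub_of (\<psi> ` B))"
    using amb.subfield_iff(2)[of "\<psi> ` B"] Ef(2) by (simp add: subfield_amb_iff)
  have "subfield (\<psi> ` A) (sub_of (\<psi> ` B))"
    using ring.subfield_iff(1)[OF ringE, of "\<psi> ` A"] amb.subfield_iff(2)[of "\<psi> ` A"] Ef(1) AB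
    by (auto simp: subfield_amb_iff)
  moreover have "\<one>\<^bsub>Q\<^esub> \<noteq> \<zero>\<^bsub>Q\<^esub>"
    using domain.one_not_zero[OF primeideal.quotient_is_domain[OF ker_primeideal[OF B h]]] by (simp add: Q_def)
  ultimately have K: "subfield K Q" unfolding K_eq by (rule gh.img_is_subfield(2))
  have finQ: "finite (carrier Q)" using bij_betw_finite[OF bij] fin by simp
  have finK: "finite K" using finite_subset[OF subfieldE(3)[OF K] finQ] .
  obtain xs where xs: "set xs = carrier Q" using finite_list[OF finQ] by blast
  have "ring.Span Q K xs = carrier Q"
    using gh.S.Span_in_carrier[OF subfieldE(3)[OF K], of xs] gh.S.Span_base_incl[OF K, of xs] xs by auto
  hence "ring.finite_dimension Q K (carrier Q)"
    using gh.S.Span_finite_dimension[OF K, of xs] xs by simp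
  hence "ring.dimension Q (ring.dim Q K (carrier Q)) K (carrier Q)"
    using gh.S.finite_dimensionE[OF K] by (simp add: over_def)
  from gh.S.card_dimension[OF K finK this]
  have "card (carrier Q) = card K ^ inertia_degree A B (ker_on B \<psi>)"
    by (simp add: inertia_degree_def Q_def K_def)
  moreover have "card (carrier Q) = card (\<psi> ` B)" using bij by (rule bij_betw_same_card)
  moreover have "card K = card (\<psi> ` A)"
  proof -
    have "inj_on g (\<psi> ` B)" unfolding g_def using bij inj_on_inv_into[of "\<psi> ` B" f "carrier Q"]
      by (auto simp: bij_betw_def)
    thus ?thesis unfolding K_eq using AB by (intro card_image) (meson image_mono inj_on_subset)
  qed
  ultimately show ?thesis by simp
qed

lemma ideal_norm_ker:
  assumes B: "is_subring B" and h: "hom_on B \<psi>"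
  shows "ideal_norm B (ker_on B \<psi>) = card (\<psi> ` B)"
  unfolding ideal_norm_def using card_quotient_ker(1)[OF assms] by (rule bij_betw_same_card)

section \<open>Primes of the polynomial ring\<close>

text \<open>The prime of F[T] belonging to a root \<theta>, that is, the kernel of the evaluation T
  -> \<theta>.\<close>

definition PI :: "Omega set \<Rightarrow> Omega \<Rightarrow> Omega set" where
  "PI F \<theta> = {poly a T | a. a \<in> polys F \<and> poly a \<theta> = 0}"

definition ev :: "Omega set \<Rightarrow> Omega \<Rightarrow> Omega \<Rightarrow> Omega" where
  "ev F \<theta> z = poly (SOME a. a \<in> polys F \<and> poly a T = z) \<theta>"

locale fin_field =
  fixes k :: nat and F :: "Omega set"
  assumes k: "k > 0" and F: "F = GF (2 ^ k)"
begin

lemma sub: "is_subfield F" "is_subring F" and fin: "finite F" "card F = 2 ^ k"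
  using is_subfield_GF is_subring_GF card_GF[OF k] by (simp_all add: F)

lemma poly_T_inj: "a \<in> polys F \<Longrightarrow> b \<in> polys F \<Longrightarrow> poly a T = poly b T \<Longrightarrow> a = b"
proof -
  assume "a \<in> polys F" "b \<in> polys F" "poly a T = poly b T"
  hence "a - b \<in> polys F" "poly (a - b) T = 0" using sub by (auto intro: polys_closed)
  thus "a = b" using transc_T[OF sub(1) fin(1)] unfolding transc_def by (metis right_minus_eq)
qed

lemma ev_poly: "a \<in> polys F \<Longrightarrow> ev F \<theta> (poly a T) = poly a \<theta>"
proof -
  assume a: "a \<in> polys F"
  define b where "b = (SOME b. b \<in> polys F \<and> poly b T = poly a T)"
  have "b \<in> polys F \<and> poly b T = poly a T" unfolding b_def by (rule someI[of _ a]) (use a in auto)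
  hence "b = a" using a poly_T_inj by blast
  thus ?thesis by (simp add: ev_def flip: b_def)
qed

lemma ev_hom: "hom_on (Pol F T) (ev F \<theta>)"
  unfolding hom_on_def
proof (intro conjI ballI)
  show "ev F \<theta> 1 = 1" using ev_poly[OF polys_closed(2)[OF sub(2)]] by simp
  fix x y assume "x \<in> Pol F T" "y \<in> Pol F T"
  then obtain a b where ab: "a \<in> polys F" "b \<in> polys F" "x = poly a T" "y = poly b T" by (auto simp: Pol_def)
  show "ev F \<theta> (x + y) = ev F \<theta> x + ev F \<theta> y"
    using ev_poly[OF polys_closed(4)[OF sub(2) ab(1,2)]] ev_poly ab by simp
  show "ev F \<theta> (x * y) = ev F \<theta> x * ev F \<theta> y"
    using ev_poly[OF polys_closed(6)[OF sub(2) ab(1,2)]] ev_poly ab by simp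
qed

lemma ker_ev: "ker_on (Pol F T) (ev F \<theta>) = PI F \<theta>"
  using ev_poly by (auto simp: ker_on_def PI_def Pol_def)

lemma ev_image: "ev F \<theta> ` Pol F T = Pol F \<theta>"
  using ev_poly by (auto simp: Pol_def image_image intro!: image_cong)

lemma subring_Pol_T: "is_subring (Pol F T)" by (rule is_subring_Pol[OF sub(2)])

lemma PI_nonzero:
  assumes "alg2 \<theta>" shows "PI F \<theta> \<noteq> {0}"
proof -
  define p where "p = (\<Prod>i<fdeg k \<theta>. [:\<theta> ^ ((2 ^ k) ^ i), 1:])"
  have p: "p \<in> polys F" unfolding p_def F by (rule conj_polynomial[OF assms k])
  have "[:\<theta> ^ ((2 ^ k) ^ 0), 1:] dvd p"
    unfolding p_def using fdeg(1)[OF assms k] by (intro dvd_prodI) auto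
  hence "poly p \<theta> = 0" by (auto elim!: dvdE)
  hence "poly p T \<in> PI F \<theta>" using p by (auto simp: PI_def)
  moreover have "p \<noteq> 0" by (auto simp: p_def)
  hence "poly p T \<noteq> 0" using p transc_T[OF sub(1) fin(1)] by (auto simp: transc_def)
  ultimately show ?thesis by blast
qed

lemma PI_nz_prime: "alg2 \<theta> \<Longrightarrow> PI F \<theta> \<in> nz_primes (Pol F T)"
  using PI_nonzero ker_primeideal[OF subring_Pol_T ev_hom] by (simp add: nz_primes_def ker_ev)

lemma norm_PI: "alg2 \<theta> \<Longrightarrow> ideal_norm (Pol F T) (PI F \<theta>) = (2 ^ k) ^ fdeg k \<theta>"
proof -
  assume a: "alg2 \<theta>"
  have "ideal_norm (Pol F T) (PI F \<theta>) = card (Pol F \<theta>)"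
    using ideal_norm_ker[OF subring_Pol_T ev_hom, of \<theta>] by (simp only: ker_ev ev_image)
  thus ?thesis using Pol_GF[OF a k] card_GF(1)[of "k * fdeg k \<theta>"] fdeg(1)[OF a k] k
    by (simp add: F power_mult)
qed

text \<open>Take m of least degree in \<open>P\<close> and a root \<theta> of it. The minimal
  polynomial n of \<theta> divides m, and primality together with the minimality of m puts n into
  \<open>P\<close>; this gives \<open>PI F \<theta> \<subseteq> P\<close>. Division by m gives the
  converse.\<close>

lemma nz_prime_PI:
  assumes P: "P \<in> nz_primes (Pol F T)"
  shows "\<exists>\<theta>. alg2 \<theta> \<and> P = PI F \<theta>"
proof -
  from P have pr: "primeideal P (sub_of (Pol F T))" and P0: "P \<noteq> {0}" by (auto simp: nz_primes_def)
  note PP = prime_ideal_props[OF pr subring_Pol_T]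
  define M where "M = (\<lambda>p. p \<in> polys F \<and> p \<noteq> 0 \<and> poly p T \<in> P)"
  have "\<exists>p. M p"
  proof -
    obtain z where z: "z \<in> P" "z \<noteq> 0" using P0 PP(3) by blast
    then obtain p where "p \<in> polys F" "z = poly p T" using PP(1) by (auto simp: Pol_def)
    thus ?thesis using z by (auto simp: M_def)
  qed
  define m where "m = arg_min degree M"
  have m: "M m" and m_min: "\<And>p. M p \<Longrightarrow> degree m \<le> degree p"
    unfolding m_def using \<open>\<exists>p. M p\<close> arg_min_natI[of M] arg_min_nat_le[of M] by blast+
  have m': "m \<in> polys F" "m \<noteq> 0" "poly m T \<in> P" using m by (auto simp: M_def)
  have "degree m > 0"
  proof (rule ccontr)
    assume "\<not> degree m > 0"
    then obtain c where c: "m = [:c:]" by (metis degree_eq_zeroE gr0I)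
    hence "c \<noteq> 0" "c \<in> P" "c \<in> F" using m' by (auto simp: polys_def coeff_pCons split: nat.splits dest: spec[of _ 0])
    moreover have "inverse c \<in> Pol F T" using is_subfieldD(5)[OF sub(1) \<open>c \<in> F\<close>] Pol_contains[OF sub(2)] by blast
    ultimately have "c * inverse c \<in> P" using PP(5) by blast
    thus False using \<open>c \<noteq> 0\<close> PP(2) by simp
  qed
  then obtain \<theta> where \<theta>: "poly m \<theta> = 0" using alg_closed_imp_poly_has_root by blast
  have alg: "alg2 \<theta>"
    using alg2_if_finite_Pol[OF sub(2)] finite_Pol_algebraic[OF sub(1) fin(1) m'(1,2) \<theta>] by blast
  define N where "N = (\<lambda>p. p \<in> polys F \<and> p \<noteq> 0 \<and> poly p \<theta> = 0)"
  have "N m" using m' \<theta> by (simp add: N_def)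
  define n where "n = arg_min degree N"
  have n: "N n" and n_min: "\<And>p. N p \<Longrightarrow> degree n \<le> degree p"
    unfolding n_def using \<open>N m\<close> arg_min_natI[of N] arg_min_nat_le[of N] by blast+
  have n': "n \<in> polys F" "n \<noteq> 0" "poly n \<theta> = 0" using n by (auto simp: N_def)
  have multiple: "\<exists>q\<in>polys F. a = q * n" if a: "a \<in> polys F" "poly a \<theta> = 0" for a
  proof -
    obtain q r where qr: "q \<in> polys F" "r \<in> polys F" "a = q * n + r" "r = 0 \<or> degree r < degree n"
      using polys_division[OF sub(1) n'(1,2) a(1)] by blast
    have "poly r \<theta> = 0" using qr(3) a(2) n'(3) by simp
    hence "r \<noteq> 0 \<Longrightarrow> degree n \<le> degree r" using qr(2) n_min[of r] by (simp add: N_def)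
    hence "r = 0" using qr(4) by linarith
    thus ?thesis using qr by auto
  qed
  obtain q where q: "q \<in> polys F" "m = q * n" using multiple[OF m'(1) \<theta>] by blast
  have nP: "poly n T \<in> P"
  proof (rule ccontr)
    assume "poly n T \<notin> P"
    moreover have "poly q T \<in> Pol F T" "poly n T \<in> Pol F T" using q n' by (auto simp: Pol_def)
    moreover have "poly q T * poly n T \<in> P" using m'(3) q(2) by simp
    ultimately have "poly q T \<in> P" using PP(6) by blast
    moreover have "q \<noteq> 0" using q m' by auto
    ultimately have "degree m \<le> degree q" using m_min q by (auto simp: M_def)
    hence "degree n = 0" using q(2) \<open>q \<noteq> 0\<close> n'(2) by (simp add: degree_mult_eq)
    then obtain c where "n = [:c:]" by (metis degree_eq_zeroE)
    thus False using n' by simp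
  qed
  have "P = PI F \<theta>"
  proof
    show "PI F \<theta> \<subseteq> P"
    proof
      fix z assume "z \<in> PI F \<theta>"
      then obtain a where a: "a \<in> polys F" "poly a \<theta> = 0" "z = poly a T" by (auto simp: PI_def)
      then obtain q where "q \<in> polys F" "a = q * n" using multiple by blast
      hence "z = poly n T * poly q T" "poly q T \<in> Pol F T" using a(3) by (auto simp: Pol_def)
      thus "z \<in> P" using PP(5)[OF nP] by simp
    qed
    show "P \<subseteq> PI F \<theta>"
    proof
      fix z assume z: "z \<in> P"
      then obtain a where a: "a \<in> polys F" "z = poly a T" using PP(1) by (auto simp: Pol_def)
      obtain q r where qr: "q \<in> polys F" "r \<in> polys F" "a = q * m + r" "r = 0 \<or> degree r < degree m"
        using polys_division[OF sub(1) m'(1,2) a(1)] by blast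
      have "poly m T * poly q T \<in> P" using PP(5)[OF m'(3), of "poly q T"] qr by (auto simp: Pol_def)
      hence "z + poly m T * poly q T \<in> P" using PP(4) z by blast
      moreover have "z + poly m T * poly q T = poly r T" using a(2) qr(3) by (simp add: mult.commute)
      ultimately have "r \<noteq> 0 \<Longrightarrow> degree m \<le> degree r" using qr(2) m_min[of r] by (simp add: M_def)
      hence "r = 0" using qr(4) by linarith
      hence "poly a \<theta> = 0" using qr(3) \<theta> by simp
      thus "z \<in> PI F \<theta>" using a by (auto simp: PI_def)
    qed
  qed
  thus ?thesis using alg by blast
qed

text \<open>Frobenius conjugates are zeros of the same polynomials over \<open>F\<close>.
  Conversely, the conjugate polynomial of \<theta> lies in the prime, so it vanishes at
  \<theta>'.\<close>

lemma PI_eq_iff: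
  assumes "alg2 \<theta>"
  shows "PI F \<theta> = PI F \<theta>' \<longleftrightarrow> (\<exists>i<fdeg k \<theta>. \<theta>' = \<theta> ^ ((2 ^ k) ^ i))"
proof
  assume eq: "PI F \<theta> = PI F \<theta>'"
  define p where "p = (\<Prod>i<fdeg k \<theta>. [:\<theta> ^ ((2 ^ k) ^ i), 1:])"
  have p: "p \<in> polys F" unfolding p_def F by (rule conj_polynomial[OF assms k])
  have px: "poly p x = (\<Prod>i<fdeg k \<theta>. \<theta> ^ ((2 ^ k) ^ i) + x)" for x
    by (simp add: p_def poly_prod)
  have "poly p \<theta> = 0" unfolding px using fdeg(1)[OF assms k] by (intro prod_zero) (auto intro!: bexI[of _ 0])
  hence "poly p T \<in> PI F \<theta>'" using p eq by (auto simp: PI_def)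
  then obtain a where "a \<in> polys F" "poly a T = poly p T" "poly a \<theta>' = 0" by (auto simp: PI_def)
  hence "poly p \<theta>' = 0" using poly_T_inj p by blast
  thus "\<exists>i<fdeg k \<theta>. \<theta>' = \<theta> ^ ((2 ^ k) ^ i)" unfolding px by auto
next
  assume "\<exists>i<fdeg k \<theta>. \<theta>' = \<theta> ^ ((2 ^ k) ^ i)"
  then obtain i where i: "\<theta>' = \<theta> ^ ((2 ^ k) ^ i)" by blast
  have "poly a \<theta>' = 0 \<longleftrightarrow> poly a \<theta> = 0" if "a \<in> polys F" for a
    using poly_frob[of a k \<theta> i] that i F by (metis power_eq_0_iff zero_less_numeral zero_less_power)
  thus "PI F \<theta> = PI F \<theta>'" by (auto simp: PI_def)
qed

end

section \<open>Specialisations of the coordinate rings\<close>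

text \<open>Write f as u + v times coordinate j. Since \<open>S\<close> also contains a point with
  that coordinate raised by 1 and the coordinates in \<open>I\<close> unchanged, vanishing of f on
  \<open>S\<close> forces u and v to vanish there. So the question whether functions vanishing on a
  fibre lie in an ideal passes down the tower.\<close>

lemma zero_descend:
  assumes f: "f \<in> PF (insert j I)" "\<forall>p\<in>S. f p = 0" and h: "h \<in> PF I"
    and rel: "\<forall>p\<in>S. p j ^ 2 + p j = h p" "e j ^ 2 + e j = h e"
    and flip: "\<forall>p\<in>S. \<exists>p'\<in>S. (\<forall>i\<in>I. p' i = p i) \<and> p' j = p j + 1"
    and J: "\<forall>a\<in>J. \<forall>b\<in>J. a + b \<in> J" "\<forall>a\<in>J. a * e j \<in> J"
    and IH: "\<forall>u\<in>PF I. (\<forall>p\<in>S. u p = 0) \<longrightarrow> u e \<in> J"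
  shows "f e \<in> J"
proof -
  obtain u v where uv: "u \<in> PF I" "v \<in> PF I" "\<And>p. p j ^ 2 + p j = h p \<Longrightarrow> f p = u p + v p * p j"
    using AS_normal_form[OF f(1) h] by blast
  have "v p = 0 \<and> u p = 0" if p: "p \<in> S" for p
  proof -
    obtain p' where p': "p' \<in> S" "\<forall>i\<in>I. p' i = p i" "p' j = p j + 1" using flip p by blast
    have 1: "u p + v p * p j = 0" using uv(3)[OF bspec[OF rel(1) p]] f(2) p by simp
    have "u p' = u p" "v p' = v p" using p'(2) by (auto intro: PF_cong[OF uv(1)] PF_cong[OF uv(2)])
    hence "u p + v p * (p j + 1) = 0" using uv(3)[OF bspec[OF rel(1) p'(1)]] f(2) p'(1,3) by simp
    hence "(u p + v p * p j) + v p = 0" by (simp only: distrib_left mult_1_right add.assoc)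
    with 1 have "v p = 0" by simp
    with 1 show ?thesis by simp
  qed
  hence "u e \<in> J" "v e \<in> J" using IH uv by blast+
  thus ?thesis using uv(3)[OF rel(2)] J by simp
qed

text \<open>All further coordinates are set to 0, so that a point is determined by these four values
  and fibres are finite.\<close>

definition cpt :: "Omega \<Rightarrow> Omega \<Rightarrow> Omega \<Rightarrow> Omega \<Rightarrow> env" where
  "cpt t w y x = (\<lambda>i. if i = 0 then t else if i = 6 then w else if i = 2 then y else if i = 3 then x else 0)"

lemma cpt_simps [simp]: "cpt t w y x 0 = t" "cpt t w y x 6 = w" "cpt t w y x 2 = y" "cpt t w y x 3 = x"
  by (simp_all add: cpt_def)

text \<open>The set \<open>W\<close> limits the values of w: it is \<open>UNIV\<close> for primes of
  F_2[T], and a single value for F_4[T], whose residue maps fix the constants.\<close>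

definition fibre :: "Omega \<Rightarrow> Omega \<Rightarrow> Omega set \<Rightarrow> env set" where
  "fibre c \<theta> W = {cpt \<theta> w y x | w y x. cover c (cpt \<theta> w y x) \<and> w \<in> W}"

lemma fibre_cptI:
  "w\<^sup>2 + w = 1 \<Longrightarrow> y\<^sup>2 + y = w * \<theta> \<Longrightarrow> x\<^sup>2 + x = (w * \<theta> + \<theta>\<^sup>2) * y + c * \<theta> ^ 3 \<Longrightarrow> w \<in> W \<Longrightarrow>
    cpt \<theta> w y x \<in> fibre c \<theta> W"
  unfolding fibre_def cover_def by (intro CollectI exI[of _ w] exI[of _ y] exI[of _ x]) simp

lemma fibreE:
  assumes "p \<in> fibre c \<theta> W"
  obtains w y x where "p = cpt \<theta> w y x" "w\<^sup>2 + w = 1" "y\<^sup>2 + y = w * \<theta>"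
    "x\<^sup>2 + x = (w * \<theta> + \<theta>\<^sup>2) * y + c * \<theta> ^ 3" "w \<in> W"
  using assms by (auto simp: fibre_def cover_def)

lemma fibre_cover: "p \<in> fibre c \<theta> W \<Longrightarrow> cover c p \<and> p 0 = \<theta> \<and> p 6 \<in> W"
  by (auto simp: fibre_def)

lemma finite_AS: "finite {r::Omega. r\<^sup>2 + r = a}"
proof -
  have "{r::Omega. r\<^sup>2 + r = a} \<subseteq> {r. poly [:a, 1, 1:] r = 0}"
    by (auto simp: power2_eq_square algebra_simps)
  thus ?thesis by (rule finite_subset) (rule poly_roots_finite, simp)
qed

lemma finite_fibre: "finite (fibre c \<theta> W)"
proof -
  let ?A = "\<lambda>a. {r::Omega. r\<^sup>2 + r = a}"
  have "fibre c \<theta> W \<subseteq> (\<lambda>(w, y, x). cpt \<theta> w y x) `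
     (SIGMA w:?A 1. SIGMA y:?A (w * \<theta>). ?A ((w * \<theta> + \<theta>\<^sup>2) * y + c * \<theta> ^ 3))"
    by (force simp: fibre_def cover_def)
  thus ?thesis by (rule finite_subset) (intro finite_imageI finite_SigmaI finite_AS)
qed

lemma fibre_nonempty:
  assumes "w \<in> W" "w\<^sup>2 + w = 1"
  shows "\<exists>p\<in>fibre c \<theta> W. p 6 = w"
proof -
  obtain y where y: "y\<^sup>2 + y = w * \<theta>" using alg_closed_AS by blast
  obtain x where x: "x\<^sup>2 + x = (w * \<theta> + \<theta>\<^sup>2) * y + c * \<theta> ^ 3" using alg_closed_AS by blast
  have "cpt \<theta> w y x \<in> fibre c \<theta> W" using assms y x by (intro fibre_cptI)
  thus ?thesis by (intro bexI[of _ "cpt \<theta> w y x"]) simp_all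
qed

lemma flip_root: "(r::Omega)\<^sup>2 + r = a \<Longrightarrow> (r + 1)\<^sup>2 + (r + 1) = a"
  by (simp add: Omega_power2_add ac_simps)

lemma fibre_flip3:
  assumes "p \<in> fibre c \<theta> W"
  shows "\<exists>p'\<in>fibre c \<theta> W. (\<forall>i\<in>{2, 6, 0}. p' i = p i) \<and> p' 3 = p 3 + 1"
proof -
  from assms obtain w y x where p: "p = cpt \<theta> w y x" "w\<^sup>2 + w = 1" "y\<^sup>2 + y = w * \<theta>"
    "x\<^sup>2 + x = (w * \<theta> + \<theta>\<^sup>2) * y + c * \<theta> ^ 3" "w \<in> W" by (rule fibreE)
  hence "cpt \<theta> w y (x + 1) \<in> fibre c \<theta> W" by (intro fibre_cptI flip_root)
  thus ?thesis using p by (intro bexI[of _ "cpt \<theta> w y (x + 1)"]) auto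
qed

lemma fibre_flip2:
  assumes "p \<in> fibre c \<theta> W"
  shows "\<exists>p'\<in>fibre c \<theta> W. (\<forall>i\<in>{6, 0}. p' i = p i) \<and> p' 2 = p 2 + 1"
proof -
  from assms obtain w y x where p: "p = cpt \<theta> w y x" "w\<^sup>2 + w = 1" "y\<^sup>2 + y = w * \<theta>" "w \<in> W" by (rule fibreE)
  \<comment> \<open>The equation of x involves y, so a new x is needed; \<open>zero_descend\<close>
    only asks the coordinates below y to be kept.\<close>
  obtain x' where x': "x'\<^sup>2 + x' = (w * \<theta> + \<theta>\<^sup>2) * (y + 1) + c * \<theta> ^ 3" using alg_closed_AS by blast
  have "cpt \<theta> w (y + 1) x' \<in> fibre c \<theta> W" using p x' by (intro fibre_cptI flip_root)
  thus ?thesis using p by (intro bexI[of _ "cpt \<theta> w (y + 1) x'"]) auto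
qed

lemma fibre_flip6:
  assumes "p \<in> fibre c \<theta> UNIV"
  shows "\<exists>p'\<in>fibre c \<theta> UNIV. (\<forall>i\<in>{0}. p' i = p i) \<and> p' 6 = p 6 + 1"
proof -
  have "p 6 ^ 2 + p 6 = 1" using fibre_cover[OF assms] by (simp add: cover_def)
  from fibre_nonempty[OF UNIV_I flip_root[OF this], of c \<theta>] fibre_cover[OF assms]
  show ?thesis using fibre_cover by (metis singletonD)
qed

lemma GF_mono: "(x::Omega) \<in> GF (2 ^ n) \<Longrightarrow> x \<in> GF (2 ^ (n * m))"
proof (induction m)
  case (Suc m)
  have "x ^ (2 ^ (n * Suc m)) = (x ^ (2 ^ (n * m))) ^ (2 ^ n)" by (simp flip: power_mult power_add add: add.commute)
  thus ?case using Suc by (simp add: GF_def)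
qed (simp add: GF_def)

lemma AS_alg2:
  assumes "(u::Omega) \<in> GF (2 ^ n)" "r\<^sup>2 + r = u" shows "r \<in> GF (2 ^ (n * 2))"
proof -
  have t: "tr n u = 0 \<or> tr n u = 1" using tr_in[OF assms(1)] .
  have r: "r ^ (2 ^ n) = r + tr n u" using AS_frob[OF assms(2)] .
  have "r ^ (2 ^ (n * 2)) = (r ^ (2 ^ n)) ^ (2 ^ n)" by (simp add: power_mult power2_eq_square)
  also have "\<dots> = (r + tr n u) + tr n u ^ (2 ^ n)" by (simp only: r Omega_frob_add)
  also have "\<dots> = r" using t by auto
  finally show ?thesis by (simp add: GF_def)
qed

lemma point_in_GF:
  assumes "cover c p" "alg2 (p 0)" "c = 0 \<or> c = 1"
  shows "\<exists>n>0. \<forall>i\<in>{3, 2, 6, 0}. p i \<in> GF (2 ^ n)"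
proof -
  from assms(2) obtain n where n: "n > 0" "p 0 \<in> GF (2 ^ n)" by (auto simp: alg2_def)
  note rel = cover_D[OF assms(1)]
  define m where "m = n * 2"
  note F = is_subfieldD[OF is_subfield_GF[of m]] and Fp = is_subring_power[OF is_subring_GF[of m]]
  have 1: "p 6 \<in> GF (2 ^ (1 * 2))" by (rule AS_alg2[OF _ rel(1)]) (simp add: GF_def)
  have p6: "p 6 \<in> GF (2 ^ m)" using GF_mono[OF 1, of n] by (simp add: m_def mult.commute)
  have p0: "p 0 \<in> GF (2 ^ m)" using GF_mono[OF n(2), of 2] by (simp add: m_def)
  have p2: "p 2 \<in> GF (2 ^ (m * 2))" using p6 p0 by (intro AS_alg2[OF _ rel(2)] F)
  have p60: "p 6 \<in> GF (2 ^ (m * 2))" "p 0 \<in> GF (2 ^ (m * 2))" using GF_mono p6 p0 by blast+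
  note F = is_subfieldD[OF is_subfield_GF[of "m * 2"]] and Fp = is_subring_power[OF is_subring_GF[of "m * 2"]]
  have "c \<in> GF (2 ^ (m * 2))" using assms(3) F by auto
  hence "p 3 \<in> GF (2 ^ (m * 2 * 2))" using p2 p60 by (intro AS_alg2[OF _ rel(3)] F Fp)
  moreover have "p 6 \<in> GF (2 ^ (m * 2 * 2))" "p 0 \<in> GF (2 ^ (m * 2 * 2))" "p 2 \<in> GF (2 ^ (m * 2 * 2))"
    using GF_mono p60 p2 by blast+
  ultimately show ?thesis using n(1) by (intro exI[of _ "m * 2 * 2"]) (auto simp: m_def)
qed

lemma finite_Rv:
  assumes "cover c p" "alg2 (p 0)" "c = 0 \<or> c = 1"
  shows "finite (Rv {3, 2, 6, 0} p)"
proof -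
  obtain n where n: "n > 0" "\<forall>i\<in>{3, 2, 6, 0}. p i \<in> GF (2 ^ n)" using point_in_GF[OF assms] by blast
  have "Rv {3, 2, 6, 0} p \<subseteq> GF (2 ^ n)" using n(2) by (intro Rv_least is_subring_GF) blast
  thus ?thesis using card_GF(2)[OF n(1)] finite_subset by blast
qed

text \<open>With w held constant, a function of w and coordinate 0 is a polynomial over F_4 in
  coordinate 0. One polynomial serves the generic point and the points of the fibre.\<close>

lemma PF60_poly:
  assumes "f \<in> PF {6, 0}" "(w::Omega)\<^sup>2 + w = 1"
  shows "\<exists>a \<in> polys F4. \<forall>p. p 6 = w \<longrightarrow> f p = poly a (p 0)"
  using assms(1)
proof (induction rule: PF.induct)
  case PF_0
  show ?case by (rule bexI[of _ 0]) (auto simp: polys_closed is_subring_F4)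
next
  case PF_1
  show ?case by (rule bexI[of _ 1]) (auto simp: polys_closed is_subring_F4)
next
  case (PF_var i)
  have "[:0, 1:] \<in> polys F4" "[:w:] \<in> polys F4" using w_in_F4[OF assms(2)] is_subfieldD[OF is_subfield_F4]
    by (auto intro!: polys_closed is_subring_F4)
  thus ?case using PF_var by (auto intro: bexI[of _ "[:0,1:]"] bexI[of _ "[:w:]"])
next
  case (PF_add f g)
  then obtain a b where "a \<in> polys F4" "\<forall>p. p 6 = w \<longrightarrow> f p = poly a (p 0)"
     "b \<in> polys F4" "\<forall>p. p 6 = w \<longrightarrow> g p = poly b (p 0)" by blast
  thus ?case by (intro bexI[of _ "a + b"]) (auto simp: polys_closed is_subring_F4)
next
  case (PF_mult f g)
  then obtain a b where "a \<in> polys F4" "\<forall>p. p 6 = w \<longrightarrow> f p = poly a (p 0)"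
     "b \<in> polys F4" "\<forall>p. p 6 = w \<longrightarrow> g p = poly b (p 0)" by blast
  thus ?case by (intro bexI[of _ "a * b"]) (auto simp: polys_closed is_subring_F4)
qed

lemma Rv60_eq:
  assumes "e 6 ^ 2 + e 6 = 1"
  shows "Rv {6, 0} e = Pol F4 (e 0)"
proof
  show "Rv {6, 0} e \<subseteq> Pol F4 (e 0)"
    using Pol_contains[OF is_subring_F4] w_in_F4[OF assms] by (intro Rv_least is_subring_Pol is_subring_F4) auto
  have v: "e 6 \<in> Rv {6, 0} e" "e 0 \<in> Rv {6, 0} e" by (auto intro: Rv_var)
  have "F4 \<subseteq> Rv {6, 0} e" using v Rv_closed by (auto simp: GF4_eq[OF assms])
  thus "Pol F4 (e 0) \<subseteq> Rv {6, 0} e" using v by (intro Pol_least is_subring_Rv)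
qed

lemma (in AS_step) Rv_insertD:
  "z \<in> Rv (insert j I) e \<Longrightarrow> \<exists>u\<in>Rv I e. \<exists>v\<in>Rv I e. z = u + v * e j"
  unfolding Rv_insert by blast

section \<open>The coordinate ring at a generic point: its primes and its integral
  closedness\<close>

locale covering_point =
  fixes c :: Omega and e :: env
  assumes V: "cover c e" and c: "c = 0 \<or> c = 1" and eT: "e 0 = T"
begin

abbreviation "B \<equiv> Rv {3, 2, 6, 0} e"
abbreviation "K \<equiv> Fr {3, 2, 6, 0} e"

definition evp :: "env \<Rightarrow> Omega \<Rightarrow> Omega" where "evp p = sp {3, 2, 6, 0} e p"

lemmas tow = cover_towers[OF V c eT]

lemma evp_eq: "f \<in> PF {3, 2, 6, 0} \<Longrightarrow> cover c p \<Longrightarrow> evp p (f e) = f p"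
  unfolding evp_def by (rule sp_eq[where Z = "cover c"]) (rule tow)

lemma evp_hom:
  assumes "cover c p" shows "hom_on B (evp p)"
  unfolding hom_on_def
proof (intro conjI ballI)
  show "evp p 1 = 1" using evp_eq[OF PF_1 assms] .
  fix x y assume "x \<in> B" "y \<in> B"
  then obtain f g where *: "f \<in> PF {3,2,6,0}" "g \<in> PF {3,2,6,0}" "x = f e" "y = g e" by (auto elim!: RvE)
  show "evp p (x + y) = evp p x + evp p y" using evp_eq[OF PF_add[OF *(1,2)] assms] evp_eq * assms by simp
  show "evp p (x * y) = evp p x * evp p y" using evp_eq[OF PF_mult[OF *(1,2)] assms] evp_eq * assms by simp
qed

lemma evp_image: "cover c p \<Longrightarrow> I \<subseteq> {3, 2, 6, 0} \<Longrightarrow> evp p ` Rv I e = Rv I p"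
  unfolding Rv_def image_image using evp_eq PF_mono by (intro image_cong refl) blast

lemma finite_evp: "cover c p \<Longrightarrow> alg2 (p 0) \<Longrightarrow> finite (evp p ` B)"
  using evp_image[of p "{3,2,6,0}"] finite_Rv[OF _ _ c] by simp

text \<open>Two applications of \<open>zero_descend\<close>, for x and y. The base case is left open
  because w is free over F_2[T] and fixed over F_4[T].\<close>

lemma evp_zero:
  assumes P: "primeideal P (sub_of B)" and "b \<in> B" "\<And>p. p \<in> S \<Longrightarrow> evp p b = 0"
    and S: "S = fibre c \<theta> W"
    and base: "\<forall>u\<in>PF {6, 0}. (\<forall>p\<in>S. u p = 0) \<longrightarrow> u e \<in> P"
  shows "b \<in> P"
proof -
  note PP = prime_ideal_props[OF P is_subring_Rv]
  interpret s2: AS_step "{6, 0}" "cover c" e 2 "\<lambda>p. p 6 * p 0" by (rule tow)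
  interpret s3: AS_step "{2, 6, 0}" "cover c" e 3 "\<lambda>p. (p 6 * p 0 + p 0 ^ 2) * p 2 + c * p 0 ^ 3" by (rule tow)
  have VS: "cover c p" if "p \<in> S" for p using that fibre_cover S by blast
  have ej: "\<forall>a\<in>P. a * e j \<in> P" if "j \<in> {3,2,6,0}" for j
    using PP(5)[OF _ Rv_var[OF that]] by blast
  have add: "\<forall>a\<in>P. \<forall>b\<in>P. a + b \<in> P" using PP(4) by blast
  have rel2: "\<forall>p\<in>S. p 2 ^ 2 + p 2 = p 6 * p 0" using s2.rel VS by blast
  have rel3: "\<forall>p\<in>S. p 3 ^ 2 + p 3 = (p 6 * p 0 + p 0 ^ 2) * p 2 + c * p 0 ^ 3" using s3.rel VS by blast
  have flip2: "\<forall>p\<in>S. \<exists>p'\<in>S. (\<forall>i\<in>{6, 0}. p' i = p i) \<and> p' 2 = p 2 + 1"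
    and flip3: "\<forall>p\<in>S. \<exists>p'\<in>S. (\<forall>i\<in>{2, 6, 0}. p' i = p i) \<and> p' 3 = p 3 + 1"
    unfolding S using fibre_flip2 fibre_flip3 by blast+
  have 2: "u e \<in> P" if "u \<in> PF {2, 6, 0}" "\<forall>p\<in>S. u p = 0" for u
    by (rule zero_descend[OF that s2.h rel2 s2.je flip2 add ej base]) simp
  from assms(2) obtain f where f: "f \<in> PF {3,2,6,0}" "b = f e" by (rule RvE)
  have f0: "\<forall>p\<in>S. f p = 0"
  proof
    fix p assume "p \<in> S"
    thus "f p = 0" using evp_eq[OF f(1) VS] f(2) assms(3) by simp
  qed
  have "\<forall>u\<in>PF {2, 6, 0}. (\<forall>p\<in>S. u p = 0) \<longrightarrow> u e \<in> P" using 2 by blast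
  from zero_descend[OF f(1) f0 s3.h rel3 s3.je flip3 add ej this]
  show ?thesis unfolding f(2) by simp
qed

text \<open>Each point of the fibre is a homomorphism of \<open>B\<close> into a finite field,
  extending T -> \<theta>. For the vanishing condition, w is eliminated like x and y, and a
  polynomial in T that vanishes at \<theta> lies in the given prime.\<close>

lemma primes_above_F2:
  assumes "alg2 \<theta>"
  shows "primes_above (Rv {0} e) B (PI {0, 1} \<theta>) = (\<lambda>p. ker_on B (evp p)) ` fibre c \<theta> UNIV"
proof -
  interpret F2: fin_field 1 "{0, 1}" by unfold_locales (simp_all add: GF2_eq)
  have kerA: "ker_on (Rv {0} e) (evp p) = PI {0, 1} \<theta>" if p: "p \<in> fibre c \<theta> UNIV" for p
  proof -
    have "evp p (poly a T) = poly a \<theta>" if "a \<in> polys {0,1}" for a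
      using evp_eq[OF PF_mono[OF PF_poly[OF that]], of p] fibre_cover[OF p] eT by auto
    thus ?thesis unfolding Rv0_eq ker_on_def PI_def Pol_def eT by auto
  qed
  have "primes_above (Rv {0} e) B (PI {0, 1} \<theta>) = ker_on B ` evp ` fibre c \<theta> UNIV"
  proof (rule primes_above_eq)
    show "finite (evp ` fibre c \<theta> UNIV)" using finite_fibre by blast
    obtain w :: Omega where "w\<^sup>2 + w = 1" using alg_closed_AS by blast
    thus "evp ` fibre c \<theta> UNIV \<noteq> {}" using fibre_nonempty[of w UNIV c \<theta>] by blast
    show "PI {0, 1} \<theta> \<noteq> {0}" using F2.PI_nonzero[OF assms] .
    show "hom_on B \<psi>" "finite (\<psi> ` B)" "ker_on (Rv {0} e) \<psi> = PI {0, 1} \<theta>"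
      if "\<psi> \<in> evp ` fibre c \<theta> UNIV" for \<psi>
    proof -
      from that obtain p where p: "\<psi> = evp p" "p \<in> fibre c \<theta> UNIV" by blast
      note pV = fibre_cover[OF p(2)]
      show "hom_on B \<psi>" "finite (\<psi> ` B)" "ker_on (Rv {0} e) \<psi> = PI {0, 1} \<theta>"
        using evp_hom[of p] finite_evp[of p] kerA[OF p(2)] pV assms unfolding p(1) by simp_all
    qed
    fix P b assume P: "primeideal P (sub_of B)" "PI {0, 1} \<theta> \<subseteq> P"
      and b: "b \<in> B" "\<And>\<psi>. \<psi> \<in> evp ` fibre c \<theta> UNIV \<Longrightarrow> \<psi> b = 0"
    note PP = prime_ideal_props[OF P(1) is_subring_Rv]
    interpret s1: AS_step "{0}" "cover c" e 6 "\<lambda>_. 1" by (rule tow)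
    show "b \<in> P"
    proof (rule evp_zero[OF P(1) b(1) _ refl])
      show "evp p b = 0" if "p \<in> fibre c \<theta> UNIV" for p using b(2) that by blast
      have base: "\<forall>v\<in>PF {0}. (\<forall>p\<in>fibre c \<theta> UNIV. v p = 0) \<longrightarrow> v e \<in> P"
      proof (intro ballI impI)
        fix v assume v: "v \<in> PF {0}" "\<forall>p\<in>fibre c \<theta> UNIV. v p = 0"
        obtain a where a: "a \<in> polys {0,1}" "\<forall>p. v p = poly a (p 0)" using PF0_poly[OF v(1)] by blast
        obtain w :: Omega where "w\<^sup>2 + w = 1" using alg_closed_AS by blast
        then obtain p where "p \<in> fibre c \<theta> UNIV" using fibre_nonempty by blast
        hence "poly a \<theta> = 0" using v(2) a(2) fibre_cover by metis
        thus "v e \<in> P" using P(2) a eT by (auto simp: PI_def)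
      qed
      have add: "\<forall>a\<in>P. \<forall>b\<in>P. a + b \<in> P" using PP(4) by blast
      have e6: "\<forall>a\<in>P. a * e 6 \<in> P" using PP(5)[OF _ Rv_var] by blast
      have flip6: "\<forall>p\<in>fibre c \<theta> UNIV. \<exists>p'\<in>fibre c \<theta> UNIV. (\<forall>i\<in>{0}. p' i = p i) \<and> p' 6 = p 6 + 1"
        using fibre_flip6 by blast
      have rel6: "\<forall>p\<in>fibre c \<theta> UNIV. p 6 ^ 2 + p 6 = 1" using s1.rel fibre_cover by blast
      show "\<forall>u\<in>PF {6, 0}. (\<forall>p\<in>fibre c \<theta> UNIV. u p = 0) \<longrightarrow> u e \<in> P"
      proof (intro ballI impI)
        fix u assume u: "u \<in> PF {6, 0}" "\<forall>p\<in>fibre c \<theta> UNIV. u p = 0"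
        show "u e \<in> P" by (rule zero_descend[OF u s1.h rel6 s1.je flip6 add e6 base])
      qed
    qed
  qed (auto intro: is_subring_Rv Rv_mono[THEN subsetD])
  thus ?thesis by (simp add: image_image)
qed

text \<open>Here the homomorphisms must be the identity on F_4, so only points with w =
  \<open>e 6\<close> occur. The base case is then the identification of the kernel on
  F_4[T].\<close>

lemma primes_above_F4:
  assumes "alg2 \<theta>"
  shows "primes_above (Rv {6, 0} e) B (PI F4 \<theta>) = (\<lambda>p. ker_on B (evp p)) ` fibre c \<theta> {e 6}"
proof -
  interpret F4: fin_field 2 F4 by unfold_locales simp_all
  note w = cover_D(1)[OF V]
  have kerA: "ker_on (Rv {6, 0} e) (evp p) = PI F4 \<theta>" if p: "p \<in> fibre c \<theta> {e 6}" for p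
  proof -
    note pV = fibre_cover[OF p]
    have "z \<in> PI F4 \<theta>" if z: "z \<in> Rv {6, 0} e" "evp p z = 0" for z
    proof -
      from z obtain f where f: "f \<in> PF {6, 0}" "z = f e" by (auto elim!: RvE)
      obtain a where a: "a \<in> polys F4" "\<forall>q. q 6 = e 6 \<longrightarrow> f q = poly a (q 0)" using PF60_poly[OF f(1) w] by blast
      have "evp p z = f p" using evp_eq[OF PF_mono[OF f(1)]] pV f(2) by auto
      hence "poly a \<theta> = 0" using a(2) pV z(2) by auto
      thus ?thesis using a f(2) eT by (auto simp: PI_def)
    qed
    moreover have "z \<in> Rv {6, 0} e \<and> evp p z = 0" if "z \<in> PI F4 \<theta>" for z
    proof -
      from that obtain b where b: "b \<in> polys F4" "poly b \<theta> = 0" "z = poly b T" by (auto simp: PI_def)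
      hence z: "z \<in> Rv {6, 0} e" unfolding Rv60_eq[of e, OF w] eT Pol_def by blast
      then obtain f where f: "f \<in> PF {6, 0}" "z = f e" by (auto elim!: RvE)
      obtain a where a: "a \<in> polys F4" "\<forall>q. q 6 = e 6 \<longrightarrow> f q = poly a (q 0)" using PF60_poly[OF f(1) w] by blast
      have "poly a T = poly b T" using a(2) f(2) b(3) eT by auto
      hence "a = b" using F4.poly_T_inj a b by blast
      moreover have "evp p z = f p" using evp_eq[OF PF_mono[OF f(1)]] pV f(2) by auto
      ultimately show ?thesis using z a(2) b(2) pV by auto
    qed
    ultimately show ?thesis by (auto simp: ker_on_def)
  qed
  have "primes_above (Rv {6, 0} e) B (PI F4 \<theta>) = ker_on B ` evp ` fibre c \<theta> {e 6}"
  proof (rule primes_above_eq)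
    show "finite (evp ` fibre c \<theta> {e 6})" using finite_fibre by blast
    show "evp ` fibre c \<theta> {e 6} \<noteq> {}" using fibre_nonempty[OF _ w, of "{e 6}" c \<theta>] by blast
    show "PI F4 \<theta> \<noteq> {0}" using F4.PI_nonzero[OF assms] .
    show "hom_on B \<psi>" "finite (\<psi> ` B)" "ker_on (Rv {6, 0} e) \<psi> = PI F4 \<theta>"
      if "\<psi> \<in> evp ` fibre c \<theta> {e 6}" for \<psi>
    proof -
      from that obtain p where p: "\<psi> = evp p" "p \<in> fibre c \<theta> {e 6}" by blast
      note pV = fibre_cover[OF p(2)]
      show "hom_on B \<psi>" "finite (\<psi> ` B)" "ker_on (Rv {6, 0} e) \<psi> = PI F4 \<theta>"
        using evp_hom[of p] finite_evp[of p] kerA[OF p(2)] pV assms unfolding p(1) by simp_all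
    qed
    fix P b assume P: "primeideal P (sub_of B)" "PI F4 \<theta> \<subseteq> P"
      and b: "b \<in> B" "\<And>\<psi>. \<psi> \<in> evp ` fibre c \<theta> {e 6} \<Longrightarrow> \<psi> b = 0"
    show "b \<in> P"
    proof (rule evp_zero[OF P(1) b(1) _ refl])
      show "evp p b = 0" if "p \<in> fibre c \<theta> {e 6}" for p using b(2) that by blast
      show "\<forall>u\<in>PF {6, 0}. (\<forall>p\<in>fibre c \<theta> {e 6}. u p = 0) \<longrightarrow> u e \<in> P"
      proof (intro ballI impI)
      fix u assume u: "u \<in> PF {6, 0}" "\<forall>p\<in>fibre c \<theta> {e 6}. u p = 0"
      obtain p where p: "p \<in> fibre c \<theta> {e 6}" using fibre_nonempty[OF _ w, of "{e 6}" c \<theta>] by blast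
      have "evp p (u e) = 0" using evp_eq[OF PF_mono[OF u(1)]] fibre_cover[OF p] u(2) p by auto
      hence "u e \<in> ker_on (Rv {6, 0} e) (evp p)" using u(1) by (auto simp: ker_on_def RvI)
      thus "u e \<in> P" using kerA[OF p] P(2) by blast
      qed
    qed
  qed (auto intro: is_subring_Rv Rv_mono[THEN subsetD])
  thus ?thesis by (simp add: image_image)
qed

text \<open>Integral elements are almost integral, and the tower is closed under these. Conversely,
  three norms take the monic polynomial X + z from \<open>B\<close> down to F_2[T]. Allowing any
  ring between F_2[T] and \<open>B\<close> covers F_2[T] and F_4[T] alike.\<close>

lemma integral_closure_eq:
  assumes A: "is_subring A" "Rv {0} e \<subseteq> A" "A \<subseteq> B"
  shows "integral_closure A K = B"
proof (intro equalityI subsetI)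
  fix z assume "z \<in> integral_closure A K"
  then obtain p where p: "z \<in> K" "lead_coeff p = 1" "set (coeffs p) \<subseteq> A" "poly p z = 0"
    by (auto simp: integral_closure_def)
  have "p \<in> polys B" using p(3) A polys_mono set_coeffs_subset_iff by blast
  hence "almost_integral {3,2,6,0} e z" by (intro almost_integral_integral[OF p(1) _ p(2) _ p(4)]) auto
  thus "z \<in> B" using towerD(5)[OF tow(4) p(1)] by blast
next
  fix z assume z: "z \<in> B"
  interpret s1: AS_step "{0}" "cover c" e 6 "\<lambda>_. 1" by (rule tow)
  interpret s2: AS_step "{6, 0}" "cover c" e 2 "\<lambda>p. p 6 * p 0" by (rule tow)
  interpret s3: AS_step "{2, 6, 0}" "cover c" e 3 "\<lambda>p. (p 6 * p 0 + p 0 ^ 2) * p 2 + c * p 0 ^ 3" by (rule tow)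
  have p0: "[:z, 1:] \<in> polys B" "lead_coeff [:z, 1:] = 1" "poly [:z, 1:] z = 0"
    using z by (auto intro!: polys_closed is_subring_Rv Rv_closed(1,2))
  hence "\<exists>u\<in>Rv {2,6,0} e. \<exists>v\<in>Rv {2,6,0} e. coeff [:z, 1:] i = u + v * e 3" for i
    using s3.Rv_insertD by (simp add: polys_def)
  then obtain p where p: "lead_coeff p = 1" "p \<in> polys (Rv {2,6,0} e)" "poly p z = 0"
    using monic_descend[OF is_subring_Rv s3.je s3.h_in(1) p0(2) _ p0(3)] by blast
  hence "\<exists>u\<in>Rv {6,0} e. \<exists>v\<in>Rv {6,0} e. coeff p i = u + v * e 2" for i
    using s2.Rv_insertD by (simp add: polys_def)
  then obtain q where q: "lead_coeff q = 1" "q \<in> polys (Rv {6,0} e)" "poly q z = 0"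
    using monic_descend[OF is_subring_Rv s2.je s2.h_in(1) p(1) _ p(3)] by blast
  hence "\<exists>u\<in>Rv {0} e. \<exists>v\<in>Rv {0} e. coeff q i = u + v * e 6" for i
    using s1.Rv_insertD by (simp add: polys_def)
  then obtain r where r: "lead_coeff r = 1" "r \<in> polys (Rv {0} e)" "poly r z = 0"
    using monic_descend[OF is_subring_Rv s1.je s1.h_in(1) q(1) _ q(3)] by blast
  have "set (coeffs r) \<subseteq> A" using r(2) A set_coeffs_subset_iff[OF is_subring_Rv] by blast
  thus "z \<in> integral_closure A K" using r z Rv_subset_Fr unfolding integral_closure_def by blast
qed

end

section \<open>Equality of splitting types over \<open>F\<^sub>2(T)\<close>\<close>

lemma (in covering_point) ker_eq_iff:
  assumes "cover c p" "cover c q"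
  shows "ker_on B (evp p) = ker_on B (evp q) \<longleftrightarrow> (\<forall>f\<in>PF {3, 2, 6, 0}. f p = 0 \<longleftrightarrow> f q = 0)"
proof
  assume eq: "ker_on B (evp p) = ker_on B (evp q)"
  show "\<forall>f\<in>PF {3, 2, 6, 0}. f p = 0 \<longleftrightarrow> f q = 0"
  proof
    fix f assume f: "f \<in> PF {3, 2, 6, 0}"
    have "f e \<in> ker_on B (evp p) \<longleftrightarrow> f p = 0" "f e \<in> ker_on B (evp q) \<longleftrightarrow> f q = 0"
      using evp_eq[OF f assms(1)] evp_eq[OF f assms(2)] RvI[OF f] by (auto simp: ker_on_def)
    thus "f p = 0 \<longleftrightarrow> f q = 0" using eq by simp
  qed
next
  assume *: "\<forall>f\<in>PF {3, 2, 6, 0}. f p = 0 \<longleftrightarrow> f q = 0"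
  have "evp p b = 0 \<longleftrightarrow> evp q b = 0" if "b \<in> B" for b
  proof -
    from that obtain f where f: "f \<in> PF {3,2,6,0}" "b = f e" by (rule RvE)
    thus ?thesis using * evp_eq[OF f(1) assms(1)] evp_eq[OF f(1) assms(2)] by simp
  qed
  thus "ker_on B (evp p) = ker_on B (evp q)" by (auto simp: ker_on_def)
qed

lemma (in covering_point) card_Rv_inertia:
  assumes "cover c p" "alg2 (p 0)" "I \<subseteq> {3, 2, 6, 0}"
  shows "card (Rv {3, 2, 6, 0} p) = card (Rv I p) ^ inertia_degree (Rv I e) B (ker_on B (evp p))"
  using card_image_inertia_degree[OF is_subring_Rv is_subring_Rv Rv_mono[OF assms(3)] evp_hom[OF assms(1)] finite_evp[OF assms(1,2)]]
  by (simp only: evp_image[OF assms(1,3)] evp_image[OF assms(1) order.refl])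

definition cmap :: "(env \<Rightarrow> Omega) \<Rightarrow> (env \<Rightarrow> Omega) \<Rightarrow> (env \<Rightarrow> Omega) \<Rightarrow> env \<Rightarrow> env" where
  "cmap f g h p = cpt (p 0) (f p) (g p) (h p)"

lemma PF_cmap:
  assumes "u \<in> PF {3, 2, 6, 0}" "f \<in> PF {3, 2, 6, 0}" "g \<in> PF {3, 2, 6, 0}" "h \<in> PF {3, 2, 6, 0}"
  shows "(\<lambda>p. u (cmap f g h p)) \<in> PF {3, 2, 6, 0}"
  by (rule PF_subst[OF assms(1)]) (use assms in \<open>auto simp: cmap_def\<close>)

lemma Rv_cmap:
  assumes "f \<in> PF {3, 2, 6, 0}" "g \<in> PF {3, 2, 6, 0}" "h \<in> PF {3, 2, 6, 0}"
  shows "Rv {3, 2, 6, 0} (cmap f g h p) \<subseteq> Rv {3, 2, 6, 0} p"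
proof
  fix z assume "z \<in> Rv {3, 2, 6, 0} (cmap f g h p)"
  then obtain u where "u \<in> PF {3, 2, 6, 0}" "z = u (cmap f g h p)" by (rule RvE)
  thus "z \<in> Rv {3, 2, 6, 0} p" using RvI[OF PF_cmap[OF _ assms]] by simp
qed

lemma image_mset_bij:
  assumes "bij_betw \<phi> A B" "\<And>x. x \<in> A \<Longrightarrow> f x = g (\<phi> x)"
  shows "image_mset f (mset_set A) = image_mset g (mset_set B)"
proof (cases "finite A")
  case True
  have "image_mset g (mset_set B) = image_mset g (image_mset \<phi> (mset_set A))"
    using assms(1) by (simp add: bij_betw_def image_mset_mset_set)
  also have "\<dots> = image_mset f (mset_set A)"
    using assms(2) True by (auto simp: multiset.map_comp intro!: image_mset_cong)
  finally show ?thesis ..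
next
  case False
  hence "infinite B" using bij_betw_finite[OF assms(1)] by simp
  with False show ?thesis by simp
qed

text \<open>Mutually inverse maps with polynomial coordinates over F_2 preserve vanishing of
  functions, hence the partition of the fibre by kernels, and they preserve the ring generated by
  the coordinates of a point, hence the inertia degree. They need to be inverse on the fibres over
  \<theta> alone.\<close>

lemma splitting_types_transfer:
  assumes "covering_point c e" "covering_point c' e'" and \<theta>: "alg2 \<theta>"
    and fgh: "f \<in> PF {3,2,6,0}" "g \<in> PF {3,2,6,0}" "h \<in> PF {3,2,6,0}"
    and fgh': "f' \<in> PF {3,2,6,0}" "g' \<in> PF {3,2,6,0}" "h' \<in> PF {3,2,6,0}"
    and fwd: "\<And>p. p \<in> fibre c \<theta> UNIV \<Longrightarrow> cmap f g h p \<in> fibre c' \<theta> UNIV \<and> cmap f' g' h' (cmap f g h p) = p"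
    and bwd: "\<And>p. p \<in> fibre c' \<theta> UNIV \<Longrightarrow> cmap f' g' h' p \<in> fibre c \<theta> UNIV \<and> cmap f g h (cmap f' g' h' p) = p"
  shows "splitting_type F2 T (Fr {3,2,6,0} e) (PI {0, 1} \<theta>) = splitting_type F2 T (Fr {3,2,6,0} e') (PI {0, 1} \<theta>)"
proof -
  interpret e: covering_point c e by fact
  interpret e': covering_point c' e' by fact
  let ?I = "{3,2,6,0}::nat set" and ?S = "fibre c \<theta> UNIV" and ?S' = "fibre c' \<theta> UNIV"
  let ?\<tau> = "cmap f g h" and ?\<sigma> = "cmap f' g' h'"
  define A where "A = Rv {0} e"
  have A': "A = Rv {0} e'" by (simp add: A_def Rv0_eq e.eT e'.eT)
  have pA: "poly_subring F2 T = A"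
    using poly_subring_eq_Pol[OF is_subring_F2, of T] by (simp add: GF2_eq A_def Rv0_eq e.eT)
  have Asub: "is_subring A" "Rv {0} e \<subseteq> A" "A \<subseteq> e.B" "Rv {0} e' \<subseteq> A" "A \<subseteq> e'.B"
    using is_subring_Rv Rv_mono[of "{0}" ?I] by (auto simp: A_def) (auto simp: A' simp flip: A_def)
  define k where "k = (\<lambda>p. ker_on e.B (e.evp p))"
  define k' where "k' = (\<lambda>p. ker_on e'.B (e'.evp p))"
  have pr: "primes_above A e.B (PI {0, 1} \<theta>) = k ` ?S" "primes_above A e'.B (PI {0, 1} \<theta>) = k' ` ?S'"
    using e.primes_above_F2[OF \<theta>] e'.primes_above_F2[OF \<theta>] by (simp_all add: A_def k_def) (simp_all add: A' k'_def flip: A_def)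
  have S: "cover c p" "p 0 = \<theta>" if "p \<in> ?S" for p using fibre_cover[OF that] by auto
  have S': "cover c' p" "p 0 = \<theta>" if "p \<in> ?S'" for p using fibre_cover[OF that] by auto
  have k_iff: "k' (?\<tau> p) = k' (?\<tau> q) \<longleftrightarrow> k p = k q" if p: "p \<in> ?S" and q: "q \<in> ?S" for p q
  proof -
    have \<tau>: "cover c' (?\<tau> p)" "cover c' (?\<tau> q)" using fwd p q S' by blast+
    show ?thesis unfolding k_def k'_def e.ker_eq_iff[OF S(1)[OF p] S(1)[OF q]] e'.ker_eq_iff[OF \<tau>]
    proof
      assume *: "\<forall>u\<in>PF ?I. u p = 0 \<longleftrightarrow> u q = 0"
      show "\<forall>u\<in>PF ?I. u (?\<tau> p) = 0 \<longleftrightarrow> u (?\<tau> q) = 0"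
      proof
        fix u assume "u \<in> PF ?I"
        from bspec[OF * PF_cmap[OF this fgh]] show "u (?\<tau> p) = 0 \<longleftrightarrow> u (?\<tau> q) = 0" .
      qed
    next
      assume *: "\<forall>u\<in>PF ?I. u (?\<tau> p) = 0 \<longleftrightarrow> u (?\<tau> q) = 0"
      show "\<forall>u\<in>PF ?I. u p = 0 \<longleftrightarrow> u q = 0"
      proof
        fix u assume "u \<in> PF ?I"
        from bspec[OF * PF_cmap[OF this fgh']] show "u p = 0 \<longleftrightarrow> u q = 0" using fwd[OF p] fwd[OF q] by simp
      qed
    qed
  qed
  \<comment> \<open>A prime is sent through any point representing it; \<open>k_iff\<close> makes
    the choice immaterial.\<close>
  define \<phi> where "\<phi> P = k' (?\<tau> (SOME p. p \<in> ?S \<and> k p = P))" for P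
  have \<phi>: "\<phi> (k p) = k' (?\<tau> p)" if "p \<in> ?S" for p
  proof -
    define q where "q = (SOME q. q \<in> ?S \<and> k q = k p)"
    have "q \<in> ?S \<and> k q = k p" unfolding q_def by (rule someI[of _ p]) (use that in simp)
    thus ?thesis using k_iff[of q p] that by (simp add: \<phi>_def q_def)
  qed
  have bij: "bij_betw \<phi> (k ` ?S) (k' ` ?S')"
  proof (rule bij_betwI')
    fix P Q assume "P \<in> k ` ?S" "Q \<in> k ` ?S"
    thus "(\<phi> P = \<phi> Q) = (P = Q)" using \<phi> k_iff by auto
  next
    fix P assume "P \<in> k ` ?S" thus "\<phi> P \<in> k' ` ?S'" using \<phi> fwd by auto
  next
    fix Q assume "Q \<in> k' ` ?S'"
    then obtain q where q: "q \<in> ?S'" "Q = k' q" by blast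
    hence "Q = \<phi> (k (?\<sigma> q))" "?\<sigma> q \<in> ?S" using \<phi>[of "?\<sigma> q"] bwd[OF q(1)] by auto
    thus "\<exists>P\<in>k ` ?S. Q = \<phi> P" by blast
  qed
  have inertia: "inertia_degree A e.B P = inertia_degree A e'.B (\<phi> P)" if P: "P \<in> k ` ?S" for P
  proof -
    from P obtain p where p: "p \<in> ?S" "P = k p" by blast
    have \<tau>: "?\<tau> p \<in> ?S'" "?\<sigma> (?\<tau> p) = p" using fwd[OF p(1)] by auto
    have "Rv ?I (?\<tau> p) = Rv ?I p"
      using Rv_cmap[OF fgh, of p] Rv_cmap[OF fgh', of "?\<tau> p"] \<tau>(2) by auto
    moreover have "card (Rv ?I p) = card (Rv {0} p) ^ inertia_degree A e.B (k p)"
      using e.card_Rv_inertia[OF S(1)[OF p(1)], of "{0}"] S(2)[OF p(1)] \<theta> by (simp add: A_def k_def)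
    moreover have "card (Rv ?I (?\<tau> p)) = card (Rv {0} (?\<tau> p)) ^ inertia_degree A e'.B (k' (?\<tau> p))"
      using e'.card_Rv_inertia[OF S'(1)[OF \<tau>(1)], of "{0}"] S'(2)[OF \<tau>(1)] \<theta> by (simp add: A' k'_def)
    moreover have "Rv {0} (?\<tau> p) = Rv {0} p" using S(2)[OF p(1)] S'(2)[OF \<tau>(1)] by (simp add: Rv0_eq)
    moreover have "card (Rv {0} p) > 1"
    proof -
      have "finite (Rv {0} p)" using finite_subset[OF Rv_mono finite_Rv[OF S(1)[OF p(1)]]] S(2)[OF p(1)] \<theta> e.c by auto
      moreover have "{0, 1} \<subseteq> Rv {0} p" using Rv_closed(1,2) by auto
      ultimately have "card {0, 1::Omega} \<le> card (Rv {0} p)" by (intro card_mono)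
      thus ?thesis by simp
    qed
    ultimately have "inertia_degree A e.B (k p) = inertia_degree A e'.B (k' (?\<tau> p))"
      by (metis power_inject_exp)
    thus ?thesis using p \<phi> by simp
  qed
  show ?thesis
    unfolding splitting_type_def Let_def pA e.integral_closure_eq[OF Asub(1,2,3)] e'.integral_closure_eq[OF Asub(1,4,5)] pr
    using image_mset_bij[OF bij, of "inertia_degree A e.B" "inertia_degree A e'.B"] inertia by simp
qed

text \<open>
  The two coverings become isomorphic over every finite residue field, since one of
  \<open>t^3\<close>, \<open>t\<close>, \<open>t + t^3\<close> has trace zero there: the isomorphism needs only a root of the
  corresponding Artin--Schreier equation, and that root lifts to a polynomial in \<open>t\<close>.
\<close>

lemma splitting_types_equal:
  assumes e: "covering_point 0 e" and e': "covering_point 1 e'" and \<theta>: "alg2 \<theta>"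
  shows "splitting_type F2 T (Fr {3,2,6,0} e) (PI {0, 1} \<theta>) = splitting_type F2 T (Fr {3,2,6,0} e') (PI {0, 1} \<theta>)"
proof -
  define m where "m = fdeg 1 \<theta>"
  have E: "Pol {0, 1} \<theta> = GF (2 ^ m)" using Pol_GF[OF \<theta>, of 1] by (simp add: GF2_eq m_def)
  have \<theta>m: "\<theta> \<in> GF (2 ^ m)" using fdeg(2)[OF \<theta>, of 1] by (simp add: m_def)
  hence \<theta>3: "\<theta> ^ 3 \<in> GF (2 ^ m)" by (intro is_subring_power is_subring_GF)
  have lift: "\<exists>u\<in>PF {3,2,6,0}. \<exists>r. r\<^sup>2 + r = a \<and> (\<forall>p. p 0 = \<theta> \<longrightarrow> u p = r)" if a: "tr m a = 0" for a
  proof -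
    obtain r where r: "r\<^sup>2 + r = a" using alg_closed_AS by blast
    hence "r \<in> Pol {0, 1} \<theta>" using AS_in_GF_iff[OF r] a E by simp
    then obtain q where q: "q \<in> polys {0,1}" "r = poly q \<theta>" by (auto simp: Pol_def)
    have "(\<lambda>p. poly q (p 0)) \<in> PF {3,2,6,0}" using PF_mono[OF PF_poly[OF q(1)]] by simp
    thus ?thesis using r q(2) by (intro bexI[of _ "\<lambda>p. poly q (p 0)"] exI[of _ r]) auto
  qed
  consider "tr m (\<theta> ^ 3) = 0" | "tr m \<theta> = 0" | "tr m (\<theta> + \<theta> ^ 3) = 0"
    using tr_in[OF \<theta>m] tr_in[OF \<theta>3] by (auto simp: tr_add)
  thus ?thesis
  proof cases
    case 1
    then obtain u r where u: "u \<in> PF {3,2,6,0}" "r\<^sup>2 + r = \<theta> ^ 3" "\<And>p. p 0 = \<theta> \<Longrightarrow> u p = r" using lift by blast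
    have key: "cmap (\<lambda>p. p 6) (\<lambda>p. p 2) (\<lambda>p. p 3 + u p) p \<in> fibre c' \<theta> UNIV \<and>
        cmap (\<lambda>p. p 6) (\<lambda>p. p 2) (\<lambda>p. p 3 + u p) (cmap (\<lambda>p. p 6) (\<lambda>p. p 2) (\<lambda>p. p 3 + u p) p) = p"
      if "p \<in> fibre c \<theta> UNIV" "c' = c + 1" for p c c'
    proof -
      from that(1) show ?thesis
      proof (rule fibreE)
        fix w y x assume p: "p = cpt \<theta> w y x" "w\<^sup>2 + w = 1" "y\<^sup>2 + y = w * \<theta>"
          "x\<^sup>2 + x = (w * \<theta> + \<theta>\<^sup>2) * y + c * \<theta> ^ 3"
        have "(x + r)\<^sup>2 + (x + r) = (x\<^sup>2 + x) + (r\<^sup>2 + r)" by (simp add: Omega_power2_add ac_simps)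
        also have "\<dots> = (w * \<theta> + \<theta>\<^sup>2) * y + c' * \<theta> ^ 3" using p(4) u(2) that(2) by (simp add: algebra_simps)
        finally show ?thesis using p(1-3) u(3)
          by (simp add: cmap_def fibre_cptI)
      qed
    qed
    show ?thesis
      by (rule splitting_types_transfer[OF e e' \<theta>, where f = "\<lambda>p. p 6" and g = "\<lambda>p. p 2" and h = "\<lambda>p. p 3 + u p"
           and f' = "\<lambda>p. p 6" and g' = "\<lambda>p. p 2" and h' = "\<lambda>p. p 3 + u p"])
         (use u(1) key[of _ 0 1] key[of _ 1 0] in simp_all)
  next
    case 2
    then obtain u s where u: "u \<in> PF {3,2,6,0}" "s\<^sup>2 + s = \<theta>" "\<And>p. p 0 = \<theta> \<Longrightarrow> u p = s" using lift by blast
    \<comment> \<open>The translation \<open>Rm\<close> with s + 1 renamed s and the summand d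
      dropped. Without d the map leads to the other covering, and only s has to lie in the residue
      field.\<close>
    let ?f = "\<lambda>p. p 6 + 1 :: Omega" and ?g = "\<lambda>p. p 2 + u p" and ?h = "\<lambda>p. p 3 + u p * p 2 + p 2 ^ 2 + u p ^ 3"
    have key: "cmap ?f ?g ?h p \<in> fibre c' \<theta> UNIV \<and> cmap ?f ?g ?h (cmap ?f ?g ?h p) = p"
      if "p \<in> fibre c \<theta> UNIV" "c' = c + 1" for p c c'
    proof -
      from that(1) show ?thesis
      proof (rule fibreE)
        fix w y x assume p: "p = cpt \<theta> w y x" "w\<^sup>2 + w = 1" "y\<^sup>2 + y = w * \<theta>"
          "x\<^sup>2 + x = (w * \<theta> + \<theta>\<^sup>2) * y + c * \<theta> ^ 3"
        let ?x = "x + s * y + y\<^sup>2 + s ^ 3"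
        have "?x\<^sup>2 + ?x = (x\<^sup>2 + x) + ((s * y + y\<^sup>2 + s ^ 3)\<^sup>2 + (s * y + y\<^sup>2 + s ^ 3))"
          by (simp add: Omega_power2_add ac_simps)
        also have "(s * y + y\<^sup>2 + s ^ 3)\<^sup>2 + (s * y + y\<^sup>2 + s ^ 3)
            = ((w + 1) * \<theta> + \<theta>\<^sup>2) * (y + s) + (w * \<theta> + \<theta>\<^sup>2) * y + \<theta> ^ 3"
          by (simp add: power2_eq_square power3_eq_cube algebra_simps AS_rule[OF p(2)] AS_rule[OF p(3)] AS_rule[OF u(2)])
        finally have 1: "?x\<^sup>2 + ?x = ((w + 1) * \<theta> + \<theta>\<^sup>2) * (y + s) + c' * \<theta> ^ 3"
          using p(4) that(2) by (simp add: algebra_simps)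
        have 2: "(y + s)\<^sup>2 + (y + s) = (w + 1) * \<theta>"
          by (simp add: power2_eq_square algebra_simps AS_rule[OF p(3)] AS_rule[OF u(2)])
        have 3: "?x + s * (y + s) + (y + s)\<^sup>2 + s ^ 3 = x"
          by (simp add: power2_eq_square algebra_simps)
        show ?thesis using p(1) u(3) 1 2 3 flip_root[OF p(2)]
          by (simp add: cmap_def fibre_cptI)
      qed
    qed
    show ?thesis
      by (rule splitting_types_transfer[OF e e' \<theta>, where f = ?f and g = ?g and h = ?h and f' = ?f and g' = ?g and h' = ?h])
         (use u(1) key[of _ 0 1] key[of _ 1 0] in simp_all)
  next
    case 3
    then obtain u r where u: "u \<in> PF {3,2,6,0}" "r\<^sup>2 + r = \<theta> + \<theta> ^ 3" "\<And>p. p 0 = \<theta> \<Longrightarrow> u p = r" using lift by blast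
    let ?f = "\<lambda>p. p 6 :: Omega" and ?g = "\<lambda>p. p 2 + 1 :: Omega"
    \<comment> \<open>The square of \<open>Rm\<close> sends x to x + y + s^2. Adding d and using s^2
      = s + t leaves x + y + t + r with r = s + d. A second application meets y + 1 instead of y, so
      the inverse carries the extra constant b = 1.\<close>
    let ?h = "\<lambda>b p. p 3 + p 2 + p 0 + u p + b"
    have key: "cmap ?f ?g (?h b) p \<in> fibre c' \<theta> UNIV \<and> cmap ?f ?g (?h (b + 1)) (cmap ?f ?g (?h b) p) = p"
      if "p \<in> fibre c \<theta> UNIV" "c' = c + 1" "b = 0 \<or> b = 1" for p c c' b
    proof -
      from that(1) show ?thesis
      proof (rule fibreE)
        fix w y x assume p: "p = cpt \<theta> w y x" "w\<^sup>2 + w = 1" "y\<^sup>2 + y = w * \<theta>"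
          "x\<^sup>2 + x = (w * \<theta> + \<theta>\<^sup>2) * y + c * \<theta> ^ 3"
        let ?x = "x + y + \<theta> + r + b"
        have "?x\<^sup>2 + ?x = (x\<^sup>2 + x) + (y\<^sup>2 + y) + \<theta>\<^sup>2 + \<theta> + (r\<^sup>2 + r)"
          using that(3) by (auto simp: Omega_power2_add ac_simps)
        also have "\<dots> = (w * \<theta> + \<theta>\<^sup>2) * (y + 1) + c' * \<theta> ^ 3"
          unfolding p(3,4) u(2) that(2) by (simp add: algebra_simps)
        finally have 1: "?x\<^sup>2 + ?x = (w * \<theta> + \<theta>\<^sup>2) * (y + 1) + c' * \<theta> ^ 3" .
        have 3: "?x + (y + 1) + \<theta> + r + (b + 1) = x" by (simp add: ac_simps)
        show ?thesis using p(1,2) u(3) 1 3 flip_root[OF p(3)]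
          by (simp add: cmap_def fibre_cptI)
      qed
    qed
    show ?thesis
      by (rule splitting_types_transfer[OF e e' \<theta>, where f = ?f and g = ?g and h = "?h 0" and f' = ?f and g' = ?g and h' = "?h 1"])
         (use u(1) key[of _ 0 1 0] key[of _ 1 0 1] in simp_all)
  qed
qed

lemma arith_equivalent_F2:
  assumes "covering_point 0 e" "covering_point 1 e'"
  shows "arith_equivalent F2 T (Fr {3,2,6,0} e) (Fr {3,2,6,0} e')"
  unfolding arith_equivalent_def
proof (intro exI[of _ "{}"] conjI ballI)
  show "has_dirichlet_density (poly_subring F2 T) {} 0"
    by (simp add: has_dirichlet_density_def)
  interpret F2: fin_field 1 "{0, 1}" by unfold_locales (simp_all add: GF2_eq)
  fix p assume "p \<in> nz_primes (poly_subring F2 T) - {}"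
  hence "p \<in> nz_primes (Pol {0, 1} T)" using poly_subring_eq_Pol[OF is_subring_F2, of T] by (simp add: GF2_eq)
  then obtain \<theta> where "alg2 \<theta>" "p = PI {0, 1} \<theta>" using F2.nz_prime_PI by blast
  thus "splitting_type F2 T (Fr {3,2,6,0} e) p = splitting_type F2 T (Fr {3,2,6,0} e') p"
    using splitting_types_equal[OF assms] by simp
qed simp

section \<open>Counting elements of finite fields by traces\<close>

lemma card_le_fibres:
  assumes "finite A" "\<And>b. b \<in> f ` A \<Longrightarrow> card {a \<in> A. f a = b} \<le> m"
  shows "card A \<le> m * card (f ` A)"
proof -
  have "card A = (\<Sum>b\<in>f ` A. card {a \<in> A. f a = b})"
    using sum.image_gen[OF assms(1), of "\<lambda>_. 1::nat" f] by simp
  also have "\<dots> \<le> (\<Sum>b\<in>f ` A. m)" by (intro sum_mono assms)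
  finally show ?thesis by (simp add: mult.commute)
qed

locale trace_field =
  fixes n N :: nat and E :: "Omega set"
  assumes n: "n > 0" and N: "N = 2 * n" and E: "E = GF (2 ^ N)"
begin

lemma N0: "N > 0" using n N by simp

lemma fieldE: "is_subfield E" unfolding E by (rule is_subfield_GF)

lemmas Ecl = is_subfieldD[OF fieldE]

lemma powE: "z \<in> E \<Longrightarrow> z ^ k \<in> E" by (rule is_subring_power[OF Ecl(7)])

lemma cardE: "card E = 4 ^ n" "finite E"
  using card_GF[OF N0] by (simp_all add: E N power_mult)

lemma F4E: "F4 \<subseteq> E"
proof
  fix z :: Omega assume "z \<in> F4"
  hence "z \<in> GF (2 ^ (2 * n))" using GF_mono[of z 2 n] by simp
  thus "z \<in> E" by (simp add: E N)
qed

lemma tr01: "z \<in> E \<Longrightarrow> tr N z = 0 \<or> tr N z = 1" using tr_in by (simp add: E)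

lemma tr_sq: "z \<in> E \<Longrightarrow> tr N (z ^ 2) = tr N z" using tr_square by (simp add: E)

lemma tr_4: "z \<in> E \<Longrightarrow> tr N (z ^ 4) = tr N z"
  using tr_sq[of z] tr_sq[of "z ^ 2"] powE[of z 2] by (simp flip: power_mult)

lemma tr_nondegenerate:
  assumes "c \<in> E" "\<And>u. u \<in> E \<Longrightarrow> tr N (u * c) = 0" shows "c = 0"
proof (rule ccontr)
  assume "c \<noteq> 0"
  obtain v where v: "v \<in> E" "tr N v = 1" using tr_surj[OF N0] by (auto simp: E)
  hence "tr N (v / c * c) = 0" using assms(2)[OF Ecl(6)[OF v(1) assms(1)]] by simp
  thus False using v(2) \<open>c \<noteq> 0\<close> by simp
qed

text \<open>An F_4-linear map with kernel F_4. Its values have trace zero to F_4, which is why the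
  traces of both \<theta> and w \<theta> vanish on them.\<close>

abbreviation "L z \<equiv> z ^ 4 + z :: Omega"

lemma L_in: "z \<in> E \<Longrightarrow> L z \<in> E" by (intro Ecl powE)

lemma L_add: "L (z + a) = L z + L a"
  by (simp add: power4_eq_xxxx algebra_simps)

lemma tr_L: "z \<in> E \<Longrightarrow> tr N (L z) = 0"
  using tr_4 by (simp add: tr_add)

lemma tr_wL:
  assumes "z \<in> E" "(w::Omega)\<^sup>2 + w = 1" shows "tr N (w * L z) = 0"
proof -
  have "w \<in> F4" by (rule w_in_F4[OF assms(2)])
  hence w: "w \<in> E" "w ^ 4 = w" using F4E by (auto simp: GF_def)
  have "w * L z = (w * z) ^ 4 + w * z" by (simp add: power_mult_distrib w(2) distrib_left)
  thus ?thesis using tr_4[of "w * z"] assms(1) w(1) by (simp add: tr_add Ecl(4))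
qed

lemma card_L_image:
  assumes "Z \<subseteq> E" shows "card Z \<le> 4 * card (L ` Z)"
proof (rule card_le_fibres)
  show "finite Z" using assms cardE(2) finite_subset by blast
  fix b assume "b \<in> L ` Z"
  then obtain z where z: "L z = b" by blast
  have "{a \<in> Z. L a = b} \<subseteq> (\<lambda>u. u + z) ` F4"
  proof
    fix a assume "a \<in> {a \<in> Z. L a = b}"
    hence "L (a + z) = 0" using z by (simp only: L_add) simp
    hence "a + z \<in> F4" by (simp add: GF_def)
    thus "a \<in> (\<lambda>u. u + z) ` F4" by (intro image_eqI[of _ _ "a + z"]) (simp_all add: add.assoc)
  qed
  hence "card {a \<in> Z. L a = b} \<le> card ((\<lambda>u. u + z) ` F4)" by (intro card_mono finite_imageI finite_F4)
  also have "\<dots> \<le> 4" using card_image_le[OF finite_F4] card_F4 by metis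
  finally show "card {a \<in> Z. L a = b} \<le> 4" .
qed

text \<open>The translate of the image of \<open>L\<close> by one solution consists of solutions. If
  a has trace 1, then a or w a is a solution, since w^2 a = w a + a. The image has at least a
  quarter of the elements; the factor 16 matches \<open>count_cubic\<close>.\<close>

lemma count_linear:
  assumes w: "(w::Omega)\<^sup>2 + w = 1"
  shows "4 ^ n \<le> 16 * card {\<theta> \<in> E. tr N (w * \<theta>) = 0 \<and> tr N \<theta> = 1}"
proof -
  have wE: "w \<in> E" using w_in_F4[OF w] F4E by blast
  have "\<exists>\<theta>\<in>E. tr N (w * \<theta>) = 0 \<and> tr N \<theta> = 1"
  proof -
    obtain a where a: "a \<in> E" "tr N a = 1" using tr_surj[OF N0] by (auto simp: E)
    have wa: "w * a \<in> E" "w * (w * a) \<in> E" using a wE by (auto intro: Ecl(4))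
    have ww: "w * (w * a) = w * a + a" by (simp add: AS_rule[OF w])
    show ?thesis
    proof (cases "tr N (w * a) = 0")
      case False
      hence 1: "tr N (w * a) = 1" using tr01 wa by blast
      have "tr N (w * (w * a)) = 0" by (simp add: ww tr_add 1 a(2))
      thus ?thesis using 1 wa by blast
    qed (use a in blast)
  qed
  then obtain \<theta>0 where \<theta>0: "\<theta>0 \<in> E" "tr N (w * \<theta>0) = 0" "tr N \<theta>0 = 1" by blast
  have "(\<lambda>u. u + \<theta>0) ` L ` E \<subseteq> {\<theta> \<in> E. tr N (w * \<theta>) = 0 \<and> tr N \<theta> = 1}"
  proof clarify
    fix z assume z: "z \<in> E"
    have "tr N (w * (L z + \<theta>0)) = tr N (w * L z) + tr N (w * \<theta>0)" by (simp only: distrib_left[of w "L z"] tr_add)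
    moreover have "tr N (L z + \<theta>0) = tr N (L z) + tr N \<theta>0" by (rule tr_add)
    ultimately show "L z + \<theta>0 \<in> E \<and> tr N (w * (L z + \<theta>0)) = 0 \<and> tr N (L z + \<theta>0) = 1"
      using tr_L[OF z] tr_wL[OF z w] Ecl(3)[OF L_in[OF z] \<theta>0(1)] \<theta>0 by simp
  qed
  hence "card ((\<lambda>u. u + \<theta>0) ` L ` E) \<le> card {\<theta> \<in> E. tr N (w * \<theta>) = 0 \<and> tr N \<theta> = 1}"
    using cardE(2) by (intro card_mono) auto
  moreover have "card ((\<lambda>u. u + \<theta>0) ` L ` E) = card (L ` E)" by (rule card_image) (auto intro: inj_onI)
  ultimately show ?thesis using card_L_image[of E] cardE(1) by simp
qed

text \<open>The cubic trace on the image of \<open>L\<close>, pulled back to a quadratic form over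
  F_2 on \<open>E\<close>; \<open>Bil\<close> is its polarisation.\<close>

definition Q :: "Omega \<Rightarrow> Omega" where "Q z = tr N (L z ^ 3)"
definition Bil :: "Omega \<Rightarrow> Omega \<Rightarrow> Omega" where "Bil z a = tr N (L z ^ 2 * L a + L z * L a ^ 2)"

lemma Q_add: "Q (z + a) = Q z + Q a + Bil z a"
proof -
  have "(u + v) ^ 3 = u ^ 3 + v ^ 3 + (u ^ 2 * v + u * v ^ 2)" for u v :: Omega
    by (simp add: power3_eq_cube power2_eq_square algebra_simps)
  thus ?thesis unfolding Q_def Bil_def L_add by (simp add: tr_add)
qed

lemma Bil_add: "Bil (z + z') a = Bil z a + Bil z' a"
proof -
  have "(u + v) ^ 2 * b + (u + v) * b ^ 2 = (u ^ 2 * b + u * b ^ 2) + (v ^ 2 * b + v * b ^ 2)" for u v b :: Omega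
    by (simp add: power2_eq_square algebra_simps)
  thus ?thesis unfolding Bil_def L_add by (simp add: tr_add)
qed

lemma Q01: "z \<in> E \<Longrightarrow> Q z = 0 \<or> Q z = 1"
  unfolding Q_def by (intro tr01 powE L_in)

lemma Bil01: "z \<in> E \<Longrightarrow> a \<in> E \<Longrightarrow> Bil z a = 0 \<or> Bil z a = 1"
  unfolding Bil_def by (intro tr01 Ecl(3,4) powE L_in)

lemma frob8_surj:
  assumes u: "u \<in> E" and "n \<ge> 4" shows "\<exists>z\<in>E. z ^ 8 = u"
proof -
  have "(u ^ (2 ^ (N - 3))) ^ 8 = u ^ (2 ^ (N - 3) * 2 ^ 3)" by (simp flip: power_mult)
  also have "2 ^ (N - 3) * 2 ^ 3 = (2::nat) ^ N" using assms N by (simp only: power_add[symmetric]) simp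
  also have "u ^ (2 ^ N) = u" using u by (simp add: E GF_def)
  finally show ?thesis using powE[OF u] by blast
qed

text \<open>Suppose \<open>Bil\<close> vanishes and put b = a + a^4 for a in the image of
  \<open>L\<close>. Frobenius invariance of the trace gives tr(t^2 b) = 0 on that image, then b =
  b^4 by nondegeneracy, so a^16 = a. The image would have at most 16 elements, too few for n at
  least 4.\<close>

lemma Bil_nonzero:
  assumes "n \<ge> 4"
  shows "\<exists>z\<in>E. \<exists>a\<in>E. Bil z a = 1"
proof (rule ccontr)
  assume "\<not> ?thesis"
  hence B0: "Bil z a = 0" if "z \<in> E" "a \<in> E" for z a using Bil01 that by blast
  have "L ` E \<subseteq> GF (2 ^ 4)"
  proof
    fix a assume "a \<in> L ` E"
    then obtain a0 where a0: "a0 \<in> E" "a = L a0" by blast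
    have aE: "a \<in> E" using a0 L_in by blast
    define b where "b = a + a ^ 4"
    have bE: "b \<in> E" unfolding b_def using aE by (intro Ecl powE)
    have 1: "tr N (t ^ 2 * b) = 0" if "t \<in> L ` E" for t
    proof -
      from that obtain z where z: "z \<in> E" "t = L z" by blast
      have tE: "t \<in> E" using z L_in by blast
      have "tr N (t * a ^ 2) = tr N ((t * a ^ 2) ^ 2)" using tr_sq[of "t * a ^ 2"] tE aE by (simp add: Ecl(4) powE)
      also have "(t * a ^ 2) ^ 2 = t ^ 2 * a ^ 4" by (simp add: power_mult_distrib flip: power_mult)
      finally have "tr N (t ^ 2 * b) = Bil z a0"
        by (simp add: Bil_def b_def distrib_left tr_add a0(2) z(2))
      thus ?thesis using B0 z(1) a0(1) by simp
    qed
    have "tr N (u * (b + b ^ 4)) = 0" if u: "u \<in> E" for u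
    proof -
      \<comment> \<open>L(z)^2 = z^8 + z^2; applying the fourth power to the second term inside the
        trace turns it into z^8 b^4.\<close>
      obtain z where z: "z \<in> E" "z ^ 8 = u" using frob8_surj[OF u assms] by blast
      have zb: "z ^ 2 * b \<in> E" using z bE by (intro Ecl powE)
      have "tr N (z ^ 2 * b) = tr N ((z ^ 2 * b) ^ 4)" using tr_4[OF zb] by simp
      also have "(z ^ 2 * b) ^ 4 = z ^ 8 * b ^ 4" by (simp add: power_mult_distrib flip: power_mult)
      finally have "tr N (u * (b + b ^ 4)) = tr N (z ^ 8 * b) + tr N (z ^ 2 * b)"
        by (simp add: distrib_left tr_add z(2))
      also have "\<dots> = tr N ((L z) ^ 2 * b)"
        by (simp add: Omega_power2_add distrib_right tr_add flip: power_mult)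
      finally show ?thesis using 1 z(1) by simp
    qed
    hence "b + b ^ 4 = 0" by (rule tr_nondegenerate[OF Ecl(3)[OF bE powE[OF bE]]])
    hence "b = b ^ 4" by simp
    hence "a + a ^ 4 = a ^ 4 + a ^ 16"
      unfolding b_def using Omega_frob_add[of a "a ^ 4" 2] by (simp flip: power_mult)
    hence "a = a ^ 16" by (simp add: add.commute)
    thus "a \<in> GF (2 ^ 4)" by (simp add: GF_def)
  qed
  hence "card (L ` E) \<le> card (GF (2 ^ 4) :: Omega set)" by (intro card_mono card_GF) auto
  hence "4 ^ n \<le> (64::nat)" using card_L_image[of E] cardE(1) card_GF(1)[of 4] by simp
  moreover have "(4::nat) ^ 4 \<le> 4 ^ n" using assms by (intro power_increasing) auto
  ultimately show False by simp
qed

text \<open>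
  The difference of the quadratic form in a suitable direction \<open>a\<close> is a nonconstant affine function.
\<close>

lemma count_quadratic:
  assumes "n \<ge> 4"
  shows "4 ^ n \<le> 4 * card {z \<in> E. Q z = 1}"
proof -
  obtain z0 a where za: "z0 \<in> E" "a \<in> E" "Bil z0 a = 1" using Bil_nonzero[OF assms] by blast
  define D where "D = {z \<in> E. Bil z a \<noteq> Q a}"
  have finD: "finite D" "finite {z \<in> E. Q z = 1}" using cardE(2) by (auto simp: D_def)
  \<comment> \<open>Adding z0 changes the value of the linear form z -> \<open>Bil z a\<close>, so
    \<open>D\<close> is at least half of \<open>E\<close>.\<close>
  have "E - D \<subseteq> (\<lambda>z. z + z0) ` D"
  proof
    fix z assume z: "z \<in> E - D"
    hence "Bil (z + z0) a \<noteq> Q a" using za by (auto simp: D_def Bil_add)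
    hence "z + z0 \<in> D" using z za by (simp add: D_def Ecl(3))
    thus "z \<in> (\<lambda>z. z + z0) ` D" by (intro image_eqI[of _ _ "z + z0"]) (simp_all add: add.assoc)
  qed
  hence "card (E - D) \<le> card ((\<lambda>z. z + z0) ` D)" using finD by (intro card_mono) auto
  also have "\<dots> \<le> card D" by (rule card_image_le[OF finD(1)])
  finally have "card E \<le> 2 * card D"
    using card_Diff_subset[of D E] finD(1) card_mono[of E D] cardE(2) by (auto simp: D_def)
  \<comment> \<open>On \<open>D\<close> the values of \<open>Q\<close> at z and z + a differ, so one
    of them is 1.\<close>
  moreover have "D \<subseteq> {z \<in> E. Q z = 1} \<union> (\<lambda>z. z + a) ` {z \<in> E. Q z = 1}"
  proof
    fix z assume "z \<in> D"
    hence z: "z \<in> E" "Bil z a \<noteq> Q a" by (auto simp: D_def)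
    show "z \<in> {z \<in> E. Q z = 1} \<union> (\<lambda>z. z + a) ` {z \<in> E. Q z = 1}"
    proof (cases "Q z = 1")
      case False
      hence "Q z = 0" using Q01 z by blast
      hence "Q (z + a) = 1" using z(2) Bil01[OF z(1) za(2)] Q01[OF za(2)] by (auto simp: Q_add)
      moreover have "z + a \<in> E" using z za by (simp add: Ecl(3))
      ultimately have "z + a + a \<in> (\<lambda>z. z + a) ` {z \<in> E. Q z = 1}" by blast
      thus ?thesis by (simp add: add.assoc)
    qed (use z in simp)
  qed
  hence "card D \<le> card ({z \<in> E. Q z = 1} \<union> (\<lambda>z. z + a) ` {z \<in> E. Q z = 1})"
    using finD by (intro card_mono) auto
  also have "\<dots> \<le> card {z \<in> E. Q z = 1} + card ((\<lambda>z. z + a) ` {z \<in> E. Q z = 1})" by (rule card_Un_le)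
  also have "\<dots> \<le> 2 * card {z \<in> E. Q z = 1}" using card_image_le[OF finD(2), of "\<lambda>z. z + a"] by simp
  ultimately show ?thesis using cardE(1) by simp
qed

text \<open>The values L(z) satisfy both linear conditions automatically, and the cubic one is Q(z)
  = 1. A quarter of all z qualify, and \<open>L\<close> is at most four to one.\<close>

lemma count_cubic:
  assumes w: "(w::Omega)\<^sup>2 + w = 1" and "n \<ge> 4"
  shows "4 ^ n \<le> 16 * card {\<theta> \<in> E. tr N (w * \<theta>) = 0 \<and> tr N \<theta> = 0 \<and> tr N (\<theta> ^ 3) = 1}"
proof -
  have "L ` {z \<in> E. Q z = 1} \<subseteq> {\<theta> \<in> E. tr N (w * \<theta>) = 0 \<and> tr N \<theta> = 0 \<and> tr N (\<theta> ^ 3) = 1}"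
  proof clarify
    fix z assume z: "z \<in> E" "Q z = 1"
    show "L z \<in> E \<and> tr N (w * L z) = 0 \<and> tr N (L z) = 0 \<and> tr N (L z ^ 3) = 1"
      using tr_L[OF z(1)] tr_wL[OF z(1) w] L_in[OF z(1)] z(2) by (simp only: Q_def)
  qed
  hence "card (L ` {z \<in> E. Q z = 1}) \<le> card {\<theta> \<in> E. tr N (w * \<theta>) = 0 \<and> tr N \<theta> = 0 \<and> tr N (\<theta> ^ 3) = 1}"
    using cardE(2) by (intro card_mono) auto
  moreover have "card {z \<in> E. Q z = 1} \<le> 4 * card (L ` {z \<in> E. Q z = 1})" by (rule card_L_image) auto
  ultimately show ?thesis using count_quadratic[OF assms(2)] by linarith
qed

lemma fdeg_dvd:
  assumes "\<theta> \<in> E" shows "alg2 \<theta>" "fdeg 2 \<theta> dvd n"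
proof -
  show a: "alg2 \<theta>" using assms N0 by (auto simp: alg2_def E)
  define m where "m = fdeg 2 \<theta>"
  have m: "m > 0" "\<theta> ^ ((2 ^ 2) ^ m) = \<theta>" using fdeg(1,2)[OF a, of 2] by (simp_all add: m_def GF_def)
  have per: "\<theta> ^ ((2 ^ 2) ^ (m * j)) = \<theta>" for j
  proof (induction j)
    case (Suc j)
    have "\<theta> ^ ((2 ^ 2) ^ (m * Suc j)) = (\<theta> ^ ((2 ^ 2) ^ (m * j))) ^ ((2 ^ 2) ^ m)"
      by (simp flip: power_mult power_add add: add.commute)
    thus ?case using Suc m by simp
  qed simp
  have "\<theta> ^ ((2 ^ 2) ^ n) = \<theta>" using assms by (simp add: E N GF_def power_mult)
  moreover have "\<theta> ^ ((2 ^ 2) ^ n) = (\<theta> ^ ((2 ^ 2) ^ (m * (n div m)))) ^ ((2 ^ 2) ^ (n mod m))"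
    by (simp flip: power_mult power_add)
  ultimately have "\<theta> ^ ((2 ^ 2) ^ (n mod m)) = \<theta>" using per by simp
  hence "n mod m > 0 \<Longrightarrow> m \<le> n mod m" using fdeg(3)[OF a, of 2 "n mod m"] by (simp add: m_def GF_def)
  hence "n mod m = 0" using mod_less_divisor[OF m(1), of n] by linarith
  thus "fdeg 2 \<theta> dvd n" by (auto simp: m_def)
qed

text \<open>Elements of smaller degree lie in subfields of at most 4^(n/2) elements, and a geometric
  sum bounds their union by twice that. As 32 times 2 is 4^3, the bound holds once 3 + n/2 is at
  most n.\<close>

lemma count_nongenerators:
  assumes "n \<ge> 6"
  shows "32 * card {\<theta> \<in> E. fdeg 2 \<theta> \<noteq> n} \<le> 4 ^ n"
proof -
  have "{\<theta> \<in> E. fdeg 2 \<theta> \<noteq> n} \<subseteq> (\<Union>m\<in>{1..n div 2}. GF (4 ^ m))"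
  proof
    fix \<theta> assume "\<theta> \<in> {\<theta> \<in> E. fdeg 2 \<theta> \<noteq> n}"
    hence \<theta>: "\<theta> \<in> E" "fdeg 2 \<theta> \<noteq> n" by auto
    note d = fdeg_dvd[OF \<theta>(1)]
    from d(2) obtain j where j: "n = fdeg 2 \<theta> * j" by blast
    hence "j \<noteq> 0" "j \<noteq> 1" using n \<theta>(2) by auto
    hence "2 * fdeg 2 \<theta> \<le> n" using j by (metis One_nat_def Suc_1 Suc_leI le_neq_implies_less less_one linorder_not_less mult.commute mult_le_mono1)
    moreover have "\<theta> \<in> GF (4 ^ fdeg 2 \<theta>)" "fdeg 2 \<theta> > 0" using fdeg(1,2)[OF d(1), of 2] by simp_all
    ultimately show "\<theta> \<in> (\<Union>m\<in>{1..n div 2}. GF (4 ^ m))" by (intro UN_I[of "fdeg 2 \<theta>"]) auto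
  qed
  moreover have fin: "finite (GF (4 ^ m) :: Omega set)" "card (GF (4 ^ m) :: Omega set) = 4 ^ m" if "m > 0" for m
    using card_GF[of "2 * m"] that by (simp_all add: power_mult)
  ultimately have "card {\<theta> \<in> E. fdeg 2 \<theta> \<noteq> n} \<le> card (\<Union>m\<in>{1..n div 2}. GF (4 ^ m) :: Omega set)"
    by (intro card_mono) auto
  also have "\<dots> \<le> (\<Sum>m\<in>{1..n div 2}. card (GF (4 ^ m) :: Omega set))" by (rule card_UN_le) simp
  also have "\<dots> = (\<Sum>m\<in>{1..n div 2}. 4 ^ m)" using fin by (intro sum.cong) auto
  also have "\<dots> \<le> 2 * 4 ^ (n div 2)" for k :: nat
  proof -
    have "(\<Sum>m\<in>{1..k}. 4 ^ m) \<le> 2 * (4::nat) ^ k" for k by (induction k) auto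
    thus ?thesis .
  qed
  finally have "32 * card {\<theta> \<in> E. fdeg 2 \<theta> \<noteq> n} \<le> 4 ^ 3 * 4 ^ (n div 2)" by simp
  also have "\<dots> = 4 ^ (3 + n div 2)" by (simp only: power_add)
  also have "\<dots> \<le> 4 ^ n" using assms by (intro power_increasing) auto
  finally show ?thesis .
qed

text \<open>At least 1/16 of \<open>E\<close> satisfies the condition and at most 1/32 fails to
  generate, so 1/32 remains.\<close>

lemma count_generators:
  assumes "n \<ge> 6" "4 ^ n \<le> 16 * card {\<theta> \<in> E. C \<theta>}"
  shows "4 ^ n \<le> 32 * card {\<theta> \<in> E. C \<theta> \<and> fdeg 2 \<theta> = n}"
proof -
  have "{\<theta> \<in> E. C \<theta>} \<subseteq> {\<theta> \<in> E. C \<theta> \<and> fdeg 2 \<theta> = n} \<union> {\<theta> \<in> E. fdeg 2 \<theta> \<noteq> n}" by blast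
  hence "card {\<theta> \<in> E. C \<theta>} \<le> card ({\<theta> \<in> E. C \<theta> \<and> fdeg 2 \<theta> = n} \<union> {\<theta> \<in> E. fdeg 2 \<theta> \<noteq> n})"
    using cardE(2) by (intro card_mono) auto
  also have "\<dots> \<le> card {\<theta> \<in> E. C \<theta> \<and> fdeg 2 \<theta> = n} + card {\<theta> \<in> E. fdeg 2 \<theta> \<noteq> n}" by (rule card_Un_le)
  finally show ?thesis using count_nongenerators[OF assms(1)] assms(2) by linarith
qed

end

section \<open>Sets of positive density\<close>

interpretation F4: fin_field 2 F4 by unfold_locales simp_all

abbreviation "A4 \<equiv> Pol F4 T"

definition primes_deg :: "nat \<Rightarrow> Omega set set" where
  "primes_deg n = {PI F4 \<theta> | \<theta>. alg2 \<theta> \<and> fdeg 2 \<theta> = n}"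

lemma norm_PI4: "alg2 \<theta> \<Longrightarrow> ideal_norm A4 (PI F4 \<theta>) = 4 ^ fdeg 2 \<theta>"
  using F4.norm_PI by simp

lemma norm_primes_deg: "p \<in> primes_deg n \<Longrightarrow> ideal_norm A4 p = 4 ^ n"
  using norm_PI4 by (auto simp: primes_deg_def)

lemma nz_primes_A4: "nz_primes A4 = (\<Union>n\<in>{0<..}. primes_deg n)"
proof (intro equalityI subsetI)
  fix p assume "p \<in> nz_primes A4"
  then obtain \<theta> where "alg2 \<theta>" "p = PI F4 \<theta>" using F4.nz_prime_PI by blast
  thus "p \<in> (\<Union>n\<in>{0<..}. primes_deg n)" using fdeg(1)[of \<theta> 2] by (auto simp: primes_deg_def)
next
  fix p assume "p \<in> (\<Union>n\<in>{0<..}. primes_deg n)"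
  thus "p \<in> nz_primes A4" using F4.PI_nz_prime by (auto simp: primes_deg_def)
qed

lemma primes_deg_disjoint: "p \<in> primes_deg m \<Longrightarrow> p \<in> primes_deg n \<Longrightarrow> m = n"
  using norm_primes_deg[of p m] norm_primes_deg[of p n] by simp

definition gens :: "nat \<Rightarrow> Omega set" where "gens n = {\<theta>. alg2 \<theta> \<and> fdeg 2 \<theta> = n}"

lemma gens_subset: "gens n \<subseteq> GF (4 ^ n)"
  using fdeg(2)[of _ 2] by (auto simp: gens_def)

lemma finite_GF4: "n > 0 \<Longrightarrow> finite (GF (4 ^ n) :: Omega set) \<and> card (GF (4 ^ n) :: Omega set) = 4 ^ n"
  using card_GF[of "2 * n"] by (simp add: power_mult)

text \<open>A prime of degree n corresponds to one full Frobenius orbit of n roots, so primes can be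
  counted through field elements.\<close>

lemma fibre_gens:
  assumes "\<theta> \<in> gens n"
  shows "{\<theta>' \<in> gens n. PI F4 \<theta>' = PI F4 \<theta>} = (\<lambda>i. \<theta> ^ ((2 ^ 2) ^ i)) ` {..<n}"
    and "card {\<theta>' \<in> gens n. PI F4 \<theta>' = PI F4 \<theta>} = n"
proof -
  have \<theta>: "alg2 \<theta>" "fdeg 2 \<theta> = n" using assms by (auto simp: gens_def)
  have "\<theta> ^ ((2 ^ 2) ^ i) \<in> gens n" for i
  proof -
    have a: "alg2 (\<theta> ^ ((2 ^ 2) ^ i))"
    proof -
      obtain k where "k > 0" "\<theta> \<in> GF (2 ^ k)" using \<theta>(1) by (auto simp: alg2_def)
      thus ?thesis unfolding alg2_def using is_subring_power[OF is_subring_GF] by blast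
    qed
    have eq: "PI F4 (\<theta> ^ ((2 ^ 2) ^ i)) = PI F4 \<theta>"
    proof -
      have "poly b (\<theta> ^ ((2 ^ 2) ^ i)) = 0 \<longleftrightarrow> poly b \<theta> = 0" if "b \<in> polys F4" for b
      proof -
        have "poly b \<theta> ^ ((2 ^ 2) ^ i) = poly b (\<theta> ^ ((2 ^ 2) ^ i))" using poly_frob[of b 2 \<theta> i] that by simp
        thus ?thesis by (metis power_eq_0_iff zero_less_numeral zero_less_power)
      qed
      thus ?thesis by (auto simp: PI_def)
    qed
    have "(4::nat) ^ fdeg 2 (\<theta> ^ ((2 ^ 2) ^ i)) = 4 ^ fdeg 2 \<theta>"
      using norm_PI4[OF a] norm_PI4[OF \<theta>(1)] unfolding eq by simp
    thus ?thesis using a \<theta>(2) by (simp add: gens_def)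
  qed
  moreover have "\<exists>i<n. \<theta>' = \<theta> ^ ((2 ^ 2) ^ i)" if "PI F4 \<theta>' = PI F4 \<theta>" for \<theta>'
    using F4.PI_eq_iff[OF \<theta>(1), of \<theta>'] that \<theta>(2) by auto
  moreover have "PI F4 (\<theta> ^ ((2 ^ 2) ^ i)) = PI F4 \<theta>" if "i < n" for i
    using F4.PI_eq_iff[OF \<theta>(1), of "\<theta> ^ ((2 ^ 2) ^ i)"] that \<theta>(2) by auto
  ultimately show *: "{\<theta>' \<in> gens n. PI F4 \<theta>' = PI F4 \<theta>} = (\<lambda>i. \<theta> ^ ((2 ^ 2) ^ i)) ` {..<n}" by blast
  show "card {\<theta>' \<in> gens n. PI F4 \<theta>' = PI F4 \<theta>} = n"
    unfolding * using fdeg_conj_inj[OF \<theta>(1), of 2] by (simp add: card_image \<theta>(2))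
qed

lemma primes_deg_eq: "primes_deg n = PI F4 ` gens n"
  by (auto simp: primes_deg_def gens_def)

lemma card_primes_deg:
  assumes "n > 0" shows "n * card (primes_deg n) \<le> 4 ^ n" "finite (primes_deg n)"
proof -
  have fin: "finite (gens n)" using gens_subset finite_GF4[OF assms] finite_subset by blast
  thus "finite (primes_deg n)" by (simp add: primes_deg_eq)
  have "card (gens n) = (\<Sum>p\<in>primes_deg n. card {\<theta> \<in> gens n. PI F4 \<theta> = p})"
    unfolding primes_deg_eq using sum.image_gen[OF fin, of "\<lambda>_. 1::nat" "PI F4"] by simp
  also have "\<dots> = (\<Sum>p\<in>primes_deg n. n)"
    unfolding primes_deg_eq using fibre_gens(2) by (intro sum.cong) auto
  finally have "n * card (primes_deg n) = card (gens n)" by (simp add: mult.commute)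
  also have "\<dots> \<le> 4 ^ n" using card_mono[OF _ gens_subset] finite_GF4[OF assms] by metis
  finally show "n * card (primes_deg n) \<le> 4 ^ n" .
qed

lemma card_image_gens:
  assumes "n > 0" "Z \<subseteq> gens n" shows "card Z \<le> n * card (PI F4 ` Z)"
proof (rule card_le_fibres)
  have fin: "finite (gens n)" using gens_subset finite_GF4[OF assms(1)] finite_subset by blast
  show "finite Z" using fin assms(2) finite_subset by blast
  fix b assume "b \<in> PI F4 ` Z"
  then obtain \<theta> where \<theta>: "\<theta> \<in> Z" "b = PI F4 \<theta>" by blast
  have "card {a \<in> Z. PI F4 a = b} \<le> card {a \<in> gens n. PI F4 a = PI F4 \<theta>}"
    using assms(2) fin \<theta> by (intro card_mono) auto
  also have "\<dots> = n" using fibre_gens(2) \<theta> assms(2) by blast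
  finally show "card {a \<in> Z. PI F4 a = b} \<le> n" .
qed

section \<open>Sums over primes by degree and Dirichlet density\<close>

definition wt :: "real \<Rightarrow> Omega set \<Rightarrow> real" where
  "wt s p = real (ideal_norm A4 p) powr (- s)"

lemma wt_nonneg: "wt s p \<ge> 0" by (simp add: wt_def)

lemma wt_deg: "p \<in> primes_deg n \<Longrightarrow> wt s p = (4 powr (- s)) ^ n"
proof -
  assume p: "p \<in> primes_deg n"
  have "wt s p = (4 powr real n) powr (- s)" by (simp add: wt_def norm_primes_deg[OF p] powr_realpow)
  also have "\<dots> = (4 powr (- s)) powr real n" by (simp add: powr_powr mult.commute)
  also have "\<dots> = (4 powr (- s)) ^ n" by (simp add: powr_realpow)
  finally show ?thesis .
qed

lemma finite_primes_bounded_degree: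
  assumes "finite Y" "Y \<subseteq> nz_primes A4"
  obtains m where "Y \<subseteq> (\<Union>n\<in>{0<..m}. primes_deg n)"
proof -
  have "\<forall>p\<in>Y. \<exists>n>0. p \<in> primes_deg n" using assms(2) unfolding nz_primes_A4 by blast
  then obtain d where d: "\<And>p. p \<in> Y \<Longrightarrow> d p > 0 \<and> p \<in> primes_deg (d p)" by metis
  have "Y \<subseteq> (\<Union>n\<in>{0<..Max (insert 0 (d ` Y))}. primes_deg n)"
  proof
    fix p assume "p \<in> Y"
    thus "p \<in> (\<Union>n\<in>{0<..Max (insert 0 (d ` Y))}. primes_deg n)"
      using d[of p] assms(1) by (intro UN_I[of "d p"]) auto
  qed
  thus ?thesis using that by blast
qed

lemma sum_wt_by_degree:
  assumes "finite I" "\<And>n. n \<in> I \<Longrightarrow> n > 0"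
  shows "sum (wt s) (\<Union>n\<in>I. primes_deg n \<inter> Z) = (\<Sum>n\<in>I. real (card (primes_deg n \<inter> Z)) * (4 powr (- s)) ^ n)"
proof -
  have "sum (wt s) (\<Union>n\<in>I. primes_deg n \<inter> Z) = (\<Sum>n\<in>I. sum (wt s) (primes_deg n \<inter> Z))"
  proof (rule sum.UNION_disjoint)
    show "\<forall>i\<in>I. finite (primes_deg i \<inter> Z)" using card_primes_deg(2) assms(2) by blast
    show "\<forall>i\<in>I. \<forall>j\<in>I. i \<noteq> j \<longrightarrow> primes_deg i \<inter> Z \<inter> (primes_deg j \<inter> Z) = {}"
      using primes_deg_disjoint by blast
  qed (rule assms)
  also have "\<dots> = (\<Sum>n\<in>I. real (card (primes_deg n \<inter> Z)) * (4 powr (- s)) ^ n)"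
  proof (intro sum.cong refl)
    fix n assume "n \<in> I"
    have "sum (wt s) (primes_deg n \<inter> Z) = (\<Sum>p\<in>primes_deg n \<inter> Z. (4 powr (- s)) ^ n)"
      by (intro sum.cong refl) (auto simp: wt_deg)
    thus "sum (wt s) (primes_deg n \<inter> Z) = real (card (primes_deg n \<inter> Z)) * (4 powr (- s)) ^ n" by simp
  qed
  finally show ?thesis .
qed

text \<open>There are at most 4^n primes of degree n, so the geometric series with ratio 4^(1-s)
  dominates.\<close>

lemma wt_summable:
  assumes "s > 1" shows "wt s summable_on nz_primes A4"
proof (rule nonneg_bdd_above_summable_on)
  define r where "r = 4 * 4 powr (- s)"
  have "4 powr (1 - s) = 4 powr 1 * 4 powr (- s)" using powr_add[of 4 1 "- s"] by simp
  moreover have "4 powr (1 - s) < (4::real) powr 0" using assms by (intro powr_less_mono) auto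
  ultimately have r: "0 \<le> r" "r < 1" by (simp_all add: r_def)
  show "bdd_above (sum (wt s) ` {Y. Y \<subseteq> nz_primes A4 \<and> finite Y})"
  proof (rule bdd_aboveI2)
    fix Y assume "Y \<in> {Y. Y \<subseteq> nz_primes A4 \<and> finite Y}"
    then obtain m where m: "Y \<subseteq> (\<Union>n\<in>{0<..m}. primes_deg n)" using finite_primes_bounded_degree by blast
    hence "sum (wt s) Y \<le> sum (wt s) (\<Union>n\<in>{0<..m}. primes_deg n \<inter> UNIV)"
      using card_primes_deg(2) by (intro sum_mono2) (auto simp: wt_nonneg)
    also have "\<dots> = (\<Sum>n\<in>{0<..m}. real (card (primes_deg n \<inter> UNIV)) * (4 powr (- s)) ^ n)"
      by (rule sum_wt_by_degree) auto
    also have "\<dots> \<le> (\<Sum>n\<in>{0<..m}. r ^ n)"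
    proof (rule sum_mono)
      fix n assume "n \<in> {0<..m}"
      hence n: "n > 0" by simp
      have "card (primes_deg n) \<le> n * card (primes_deg n)" using n by simp
      also have "\<dots> \<le> 4 ^ n" by (rule card_primes_deg[OF n])
      finally have "real (card (primes_deg n)) \<le> 4 ^ n" by (metis of_nat_le_iff of_nat_numeral of_nat_power)
      thus "real (card (primes_deg n \<inter> UNIV)) * (4 powr (- s)) ^ n \<le> r ^ n"
        by (simp add: r_def power_mult_distrib mult_right_mono)
    qed
    also have "\<dots> \<le> (\<Sum>n. r ^ n)" using r by (intro sum_le_suminf summable_geometric) auto
    finally show "sum (wt s) Y \<le> (\<Sum>n. r ^ n)" .
  qed
qed (rule wt_nonneg)

text \<open>From degree n0 on, \<open>D\<close> contains at least 1/K of the primes of each degree,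
  so the full sum is at most M + K times the sum over \<open>S\<close>, where M counts the primes of
  lower degree. One prime of \<open>D\<close> bounds the sum over \<open>S\<close> from below
  uniformly for 1 < s < 2 and absorbs M. The quotient thus stays above a positive constant, with no
  asymptotics at s = 1.\<close>

lemma not_density_zero:
  assumes S: "D \<subseteq> S" "S \<subseteq> nz_primes A4" and K: "K > 0" "n0 > 0"
    and D: "\<And>n. n \<ge> n0 \<Longrightarrow> 4 ^ n \<le> K * n * card (primes_deg n \<inter> D)"
  shows "\<not> has_dirichlet_density A4 S 0"
proof
  assume "has_dirichlet_density A4 S 0"
  hence lim: "((\<lambda>s. infsum (wt s) S / infsum (wt s) (nz_primes A4)) \<longlongrightarrow> 0) (at_right 1)"
    by (simp add: has_dirichlet_density_def wt_def[abs_def])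
  define low where "low = (\<Union>n\<in>{0<..<n0}. primes_deg n)"
  define M where "M = real (card low)"
  have fin_low: "finite low" unfolding low_def using card_primes_deg(2) by auto
  have "primes_deg n0 \<inter> D \<noteq> {}" using D[of n0] by (auto intro: ccontr)
  then obtain p0 where p0: "p0 \<in> D" "p0 \<in> primes_deg n0" by blast
  \<comment> \<open>The weight of \<open>p0\<close> at s = 2, a lower bound for its weight when s <
    2.\<close>
  define \<delta> where "\<delta> = ((4::real) powr (- 2)) ^ n0"
  have \<delta>: "\<delta> > 0" by (simp add: \<delta>_def)
  define \<epsilon> where "\<epsilon> = 1 / (M / \<delta> + real K)"
  have M0: "M \<ge> 0" by (simp add: M_def)
  have \<epsilon>0: "M / \<delta> + real K > 0" using M0 \<delta> K by (simp add: add_nonneg_pos)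
  have bound: "infsum (wt s) S / infsum (wt s) (nz_primes A4) \<ge> \<epsilon>" if s: "1 < s" "s < 2" for s
  proof -
    note sumN = wt_summable[OF s(1)]
    have sumS: "wt s summable_on S" and sumD: "wt s summable_on D"
      using summable_on_subset_banach[OF sumN] S by blast+
    define num where "num = infsum (wt s) S"
    have fin_le: "sum (wt s) Y \<le> num" if "finite Y" "Y \<subseteq> D" for Y
      unfolding num_def by (rule finite_sum_le_infsum[OF sumS]) (use that S wt_nonneg in auto)
    have "\<delta> \<le> wt s p0"
      unfolding \<delta>_def wt_deg[OF p0(2)] using s by (intro power_mono powr_mono) auto
    also have "\<dots> \<le> num" using fin_le[of "{p0}"] p0 by simp
    finally have num: "\<delta> \<le> num" .
    have "infsum (wt s) (nz_primes A4) \<le> M + real K * num"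
    proof (rule infsum_le_finite_sums[OF sumN])
      fix Y assume Y: "finite Y" "Y \<subseteq> nz_primes A4"
      then obtain m where m: "Y \<subseteq> (\<Union>n\<in>{0<..m}. primes_deg n)" using finite_primes_bounded_degree by blast
      define high where "high = (\<Union>n\<in>{n0..m}. primes_deg n \<inter> UNIV)"
      have "Y \<subseteq> low \<union> high" using m unfolding low_def high_def by fastforce
      moreover have fin_high: "finite high" unfolding high_def using card_primes_deg(2) K by auto
      ultimately have "sum (wt s) Y \<le> sum (wt s) (low \<union> high)"
        using fin_low by (intro sum_mono2) (auto simp: wt_nonneg)
      also have "\<dots> \<le> sum (wt s) low + sum (wt s) high"
        using fin_low fin_high by (subst sum_Un) (auto simp: sum_nonneg wt_nonneg)
      also have "sum (wt s) low \<le> M"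
      proof -
        have "wt s p \<le> 1" if p: "p \<in> low" for p
        proof -
          obtain n where "p \<in> primes_deg n" using p by (auto simp: low_def)
          moreover have "(4::real) powr (- s) \<le> 4 powr 0" using s by (intro powr_mono) auto
          ultimately show ?thesis by (simp add: wt_deg power_le_one)
        qed
        hence "sum (wt s) low \<le> (\<Sum>p\<in>low. 1)" by (intro sum_mono)
        thus ?thesis by (simp add: M_def)
      qed
      also have "sum (wt s) high \<le> real K * num"
      proof -
        let ?r = "(4::real) powr (- s)"
        have "sum (wt s) high = (\<Sum>n\<in>{n0..m}. real (card (primes_deg n \<inter> UNIV)) * ?r ^ n)"
          unfolding high_def by (rule sum_wt_by_degree) (use K in auto)
        also have "\<dots> \<le> (\<Sum>n\<in>{n0..m}. real K * (real (card (primes_deg n \<inter> D)) * ?r ^ n))"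
        proof (rule sum_mono)
          fix n assume "n \<in> {n0..m}"
          hence n: "n \<ge> n0" "n > 0" using K by auto
          have "n * card (primes_deg n) \<le> n * (K * card (primes_deg n \<inter> D))"
            by (rule order.trans[OF card_primes_deg(1)[OF n(2)]]) (use D[OF n(1)] in \<open>simp only: mult_ac\<close>)
          hence "card (primes_deg n) \<le> K * card (primes_deg n \<inter> D)" using n(2) by simp
          hence "real (card (primes_deg n)) \<le> real K * real (card (primes_deg n \<inter> D))"
            by (metis of_nat_le_iff of_nat_mult)
          thus "real (card (primes_deg n \<inter> UNIV)) * ?r ^ n \<le> real K * (real (card (primes_deg n \<inter> D)) * ?r ^ n)"
            by (simp add: mult_right_mono flip: mult.assoc)
        qed
        also have "\<dots> = real K * sum (wt s) (\<Union>n\<in>{n0..m}. primes_deg n \<inter> D)"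
          by (subst sum_wt_by_degree) (use K in \<open>auto simp: sum_distrib_left\<close>)
        also have "\<dots> \<le> real K * num"
        proof (intro mult_left_mono fin_le)
          show "finite (\<Union>n\<in>{n0..m}. primes_deg n \<inter> D)" using card_primes_deg(2) K by auto
        qed auto
        finally show ?thesis .
      qed
      finally show "sum (wt s) Y \<le> M + real K * num" by simp
    qed
    also have "M \<le> M / \<delta> * num"
    proof -
      have "M / \<delta> * \<delta> \<le> M / \<delta> * num" using num M0 \<delta> by (intro mult_left_mono) auto
      thus ?thesis using \<delta> by simp
    qed
    finally have den: "infsum (wt s) (nz_primes A4) \<le> (M / \<delta> + real K) * num" by (simp add: distrib_right)
    have "p0 \<in> nz_primes A4" using p0 S by blast
    hence "wt s p0 \<le> infsum (wt s) (nz_primes A4)"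
      using finite_sum_le_infsum[OF sumN, of "{p0}"] wt_nonneg by simp
    hence pos: "infsum (wt s) (nz_primes A4) > 0" using \<open>\<delta> \<le> wt s p0\<close> \<delta> by linarith
    have "\<epsilon> * infsum (wt s) (nz_primes A4) \<le> num"
      unfolding \<epsilon>_def using den \<epsilon>0 by (simp add: field_simps)
    thus ?thesis using pos by (simp add: num_def pos_le_divide_eq)
  qed
  have "\<epsilon> > 0" using \<epsilon>0 by (simp add: \<epsilon>_def)
  have "\<forall>\<^sub>F s in at_right 1. infsum (wt s) S / infsum (wt s) (nz_primes A4) < \<epsilon>"
    using order_tendstoD(2)[OF lim \<open>\<epsilon> > 0\<close>] .
  moreover have "\<forall>\<^sub>F s in at_right (1::real). s \<in> {1<..<2}" by (rule eventually_at_right_real) simp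
  ultimately have "\<forall>\<^sub>F s in at_right (1::real). False"
    by eventually_elim (use bound in force)
  thus False by (simp add: trivial_limit_at_right_real eventually_False)
qed

section \<open>Different splitting types over \<open>F\<^sub>4(T)\<close>\<close>

text \<open>An inertia degree is 1 exactly if adjoining y and x does not enlarge the residue field
  F_4[\<theta>]; both sides are compared through cardinalities.\<close>

lemma (in covering_point) splitting_type_F4:
  assumes \<theta>: "alg2 \<theta>"
  shows "1 \<in> set (splitting_type F4 T K (PI F4 \<theta>)) \<longleftrightarrow>
    (\<exists>p\<in>fibre c \<theta> {e 6}. p 2 \<in> Pol F4 \<theta> \<and> p 3 \<in> Pol F4 \<theta>)"
proof -
  have w: "e 6 ^ 2 + e 6 = 1" using cover_D(1)[OF V] .
  have A: "poly_subring F4 T = Rv {6, 0} e"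
    using poly_subring_eq_Pol[OF is_subring_F4, of T] Rv60_eq[of e, OF w] by (simp add: eT)
  have cl: "integral_closure (Rv {6, 0} e) K = B"
    by (rule integral_closure_eq) (auto intro: is_subring_Rv Rv_mono[THEN subsetD])
  have "set (splitting_type F4 T K (PI F4 \<theta>)) =
      inertia_degree (Rv {6, 0} e) B ` (\<lambda>p. ker_on B (evp p)) ` fibre c \<theta> {e 6}"
    unfolding splitting_type_def Let_def A cl primes_above_F4[OF \<theta>] using finite_fibre by simp
  moreover have "inertia_degree (Rv {6, 0} e) B (ker_on B (evp p)) = 1 \<longleftrightarrow> p 2 \<in> Pol F4 \<theta> \<and> p 3 \<in> Pol F4 \<theta>"
    if p: "p \<in> fibre c \<theta> {e 6}" for p
  proof -
    have pV: "cover c p" "p 0 = \<theta>" "p 6 = e 6" using fibre_cover[OF p] by auto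
    have R: "Rv {6, 0} p = Pol F4 \<theta>" using Rv60_eq[of p] cover_D(1)[OF pV(1)] pV(2) by simp
    have fin: "finite (Rv {3,2,6,0} p)" using finite_Rv[OF pV(1) _ c] pV(2) \<theta> by simp
    have sub: "Rv {6, 0} p \<subseteq> Rv {3,2,6,0} p" by (rule Rv_mono) auto
    have "{0, 1} \<subseteq> Rv {6, 0} p" using Rv_closed(1,2) by auto
    hence "card {0, 1::Omega} \<le> card (Rv {6, 0} p)" by (intro card_mono finite_subset[OF sub fin])
    hence big: "card (Rv {6, 0} p) > 1" by simp
    have "card (Rv {3,2,6,0} p) = card (Rv {6, 0} p) ^ inertia_degree (Rv {6, 0} e) B (ker_on B (evp p))"
      using card_Rv_inertia[OF pV(1), of "{6, 0}"] pV(2) \<theta> by simp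
    hence "inertia_degree (Rv {6, 0} e) B (ker_on B (evp p)) = 1 \<longleftrightarrow> card (Rv {3,2,6,0} p) = card (Rv {6, 0} p)"
      using big power_inject_exp[of "card (Rv {6, 0} p)" _ 1] by simp
    also have "\<dots> \<longleftrightarrow> Rv {3,2,6,0} p = Rv {6, 0} p" using card_subset_eq[OF fin sub] by auto
    also have "\<dots> \<longleftrightarrow> p 2 \<in> Pol F4 \<theta> \<and> p 3 \<in> Pol F4 \<theta>"
    proof
      assume *: "Rv {3,2,6,0} p = Rv {6, 0} p"
      have "p 2 \<in> Rv {3,2,6,0} p" "p 3 \<in> Rv {3,2,6,0} p" by (auto intro: Rv_var)
      thus "p 2 \<in> Pol F4 \<theta> \<and> p 3 \<in> Pol F4 \<theta>" by (simp add: * R)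
    next
      assume *: "p 2 \<in> Pol F4 \<theta> \<and> p 3 \<in> Pol F4 \<theta>"
      have "Rv {3,2,6,0} p \<subseteq> Rv {6, 0} p"
      proof (rule Rv_least[OF is_subring_Rv])
        fix i :: nat assume "i \<in> {3,2,6,0}"
        moreover have "p 6 \<in> Rv {6, 0} p" "p 0 \<in> Rv {6, 0} p" by (auto intro: Rv_var)
        ultimately show "p i \<in> Rv {6, 0} p" using * R by auto
      qed
      thus "Rv {3,2,6,0} p = Rv {6, 0} p" using sub by blast
    qed
    finally show ?thesis .
  qed
  ultimately show ?thesis by (auto simp: image_iff) metis+
qed

text \<open>The condition \<open>C\<close> depends on how the constants w of the two fields compare.
  If they agree, y is made rational in both and the cubic trace decides which x is rational. If they
  differ, y is rational for the first field and not for the second, because w \<theta> and (w + 1)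
  \<theta> have different traces.\<close>

lemma splitting_types_differ:
  assumes e: "covering_point 0 e" and e': "covering_point 1 e'"
  obtains C where "\<And>n N E. trace_field n N E \<Longrightarrow> n \<ge> 4 \<Longrightarrow> 4 ^ n \<le> 16 * card {\<theta> \<in> E. C N \<theta>}"
    "\<And>n N E \<theta>. trace_field n N E \<Longrightarrow> \<theta> \<in> E \<Longrightarrow> fdeg 2 \<theta> = n \<Longrightarrow> C N \<theta> \<Longrightarrow>
       splitting_type F4 T (Fr {3,2,6,0} e) (PI F4 \<theta>) \<noteq> splitting_type F4 T (Fr {3,2,6,0} e') (PI F4 \<theta>)"
proof -
  interpret e: covering_point 0 e by fact
  interpret e': covering_point 1 e' by fact
  define w where "w = e 6"
  have w: "w\<^sup>2 + w = 1" using cover_D(1)[OF e.V] by (simp add: w_def)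
  have "e' 6 = w \<or> e' 6 = w + 1" using AS_roots[OF w cover_D(1)[OF e'.V]] .
  thus ?thesis
  proof
    assume w': "e' 6 = w"
    define C where "C = (\<lambda>N \<theta>. tr N (w * \<theta>) = 0 \<and> tr N \<theta> = 0 \<and> tr N (\<theta> ^ 3) = 1)"
    show ?thesis
    proof (rule that[of C])
      fix n N :: nat and E :: "Omega set" and \<theta>
      assume "trace_field n N E"
      then interpret trace_field n N E .
      show "4 ^ n \<le> 16 * card {\<theta> \<in> E. C N \<theta>}" if "n \<ge> 4" using count_cubic[OF w that] by (simp add: C_def)
      assume \<theta>: "\<theta> \<in> E" "fdeg 2 \<theta> = n" "C N \<theta>"
      note alg = fdeg_dvd(1)[OF \<theta>(1)]
      have P: "Pol F4 \<theta> = E" using Pol_GF[OF alg, of 2] \<theta>(2) by (simp add: E N power_mult)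
      have wE: "w \<in> E" using w_in_F4[OF w] F4E by blast
      obtain y where y: "y\<^sup>2 + y = w * \<theta>" using alg_closed_AS by blast
      have yE: "y \<in> E" using AS_in_GF_iff[OF y, of N] \<theta>(3) by (simp add: E C_def)
      define a where "a = (w * \<theta> + \<theta>\<^sup>2) * y"
      have aE: "a \<in> E" unfolding a_def using wE yE \<theta>(1) by (intro Ecl powE)
      have a1: "tr N ((w * \<theta> + \<theta>\<^sup>2) * y' + c * \<theta> ^ 3) = tr N a + c" if "y'\<^sup>2 + y' = w * \<theta>" "c = 0 \<or> c = 1" for y' c
      proof -
        \<comment> \<open>Consequently y and y + 1 give the same trace, and rationality of x does
          not depend on the point above w.\<close>
        have "tr N (w * \<theta> + \<theta>\<^sup>2) = 0" using \<theta>(1,3) tr_sq by (simp add: tr_add C_def)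
        hence "tr N ((w * \<theta> + \<theta>\<^sup>2) * y') = tr N a"
          using AS_roots[OF y that(1)] by (auto simp: a_def distrib_left tr_add)
        moreover have "tr N (c * \<theta> ^ 3) = c" using that(2) \<theta>(3) by (auto simp: C_def) (simp add: tr_def power_0_left)
        ultimately show ?thesis by (simp add: tr_add)
      qed
      have "(1 \<in> set (splitting_type F4 T (Fr {3,2,6,0} ee) (PI F4 \<theta>))) = (tr N a = c)"
        if cp: "covering_point c ee" "ee 6 = w" "c = 0 \<or> c = 1" for c ee
      proof -
        interpret ee: covering_point c ee by fact
        show ?thesis unfolding ee.splitting_type_F4[OF alg] P
        proof
          assume "\<exists>p\<in>fibre c \<theta> {ee 6}. p 2 \<in> E \<and> p 3 \<in> E"
          then obtain p where p: "p \<in> fibre c \<theta> {ee 6}" "p 3 \<in> E" by blast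
          have pV: "cover c p" "p 0 = \<theta>" "p 6 = w" using fibre_cover[OF p(1)] cp(2) by auto
          have "tr N ((w * \<theta> + \<theta>\<^sup>2) * p 2 + c * \<theta> ^ 3) = 0"
            using AS_in_GF_iff[OF cover_D(3)[OF pV(1)], of N] p(2) pV by (simp add: E)
          thus "tr N a = c" using a1[of "p 2" c] cover_D(2)[OF pV(1)] pV cp(3) by simp
        next
          assume ac: "tr N a = c"
          obtain x where x: "x\<^sup>2 + x = (w * \<theta> + \<theta>\<^sup>2) * y + c * \<theta> ^ 3" using alg_closed_AS by blast
          have "x \<in> E" using AS_in_GF_iff[OF x, of N] a1[OF y cp(3)] ac by (simp add: E)
          moreover have "cpt \<theta> w y x \<in> fibre c \<theta> {ee 6}" using w y x cp(2) by (intro fibre_cptI) auto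
          ultimately show "\<exists>p\<in>fibre c \<theta> {ee 6}. p 2 \<in> E \<and> p 3 \<in> E"
            using yE by (intro bexI[of _ "cpt \<theta> w y x"]) auto
        qed
      qed
      from this[OF e] this[OF e'] show "splitting_type F4 T (Fr {3,2,6,0} e) (PI F4 \<theta>) \<noteq> splitting_type F4 T (Fr {3,2,6,0} e') (PI F4 \<theta>)"
        using tr01[OF aE] w' by (auto simp: w_def)
    qed
  next
    assume w': "e' 6 = w + 1"
    define C where "C = (\<lambda>N \<theta>. tr N (w * \<theta>) = 0 \<and> tr N \<theta> = 1)"
    show ?thesis
    proof (rule that[of C])
      fix n N :: nat and E :: "Omega set" and \<theta>
      assume "trace_field n N E"
      then interpret trace_field n N E .
      show "4 ^ n \<le> 16 * card {\<theta> \<in> E. C N \<theta>}" if "n \<ge> 4" using count_linear[OF w] by (simp add: C_def)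
      assume \<theta>: "\<theta> \<in> E" "fdeg 2 \<theta> = n" "C N \<theta>"
      note alg = fdeg_dvd(1)[OF \<theta>(1)]
      have P: "Pol F4 \<theta> = E" using Pol_GF[OF alg, of 2] \<theta>(2) by (simp add: E N power_mult)
      have wE: "w \<in> E" using w_in_F4[OF w] F4E by blast
      obtain y where y: "y\<^sup>2 + y = w * \<theta>" using alg_closed_AS by blast
      have yE: "y \<in> E" using AS_in_GF_iff[OF y, of N] \<theta>(3) by (simp add: E C_def)
      \<comment> \<open>Here y and y + 1 give different traces, so one of them leads to a rational
        x.\<close>
      have "tr N (w * \<theta> + \<theta>\<^sup>2) = 1" using \<theta>(1,3) tr_sq by (simp add: tr_add C_def)
      hence "tr N ((w * \<theta> + \<theta>\<^sup>2) * (y + 1)) = tr N ((w * \<theta> + \<theta>\<^sup>2) * y) + 1"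
        by (simp only: distrib_left[of _ y 1] tr_add mult_1_right)
      moreover have "(w * \<theta> + \<theta>\<^sup>2) * y \<in> E" using wE yE \<theta>(1) by (intro Ecl powE)
      ultimately obtain y' where y': "y'\<^sup>2 + y' = w * \<theta>" "y' \<in> E" "tr N ((w * \<theta> + \<theta>\<^sup>2) * y') = 0"
        using tr01 y yE flip_root[OF y] Ecl(2,3) by (metis Omega_add_self)
      obtain x where x: "x\<^sup>2 + x = (w * \<theta> + \<theta>\<^sup>2) * y' + 0 * \<theta> ^ 3" using alg_closed_AS by blast
      have "x \<in> E" using AS_in_GF_iff[OF x, of N] y'(3) by (simp add: E)
      moreover have "cpt \<theta> w y' x \<in> fibre 0 \<theta> {e 6}" using w y' x by (intro fibre_cptI) (auto simp: w_def)
      ultimately have "1 \<in> set (splitting_type F4 T (Fr {3,2,6,0} e) (PI F4 \<theta>))"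
        unfolding e.splitting_type_F4[OF alg] P using y'(2) by (intro bexI[of _ "cpt \<theta> w y' x"]) auto
      moreover have "1 \<notin> set (splitting_type F4 T (Fr {3,2,6,0} e') (PI F4 \<theta>))"
        unfolding e'.splitting_type_F4[OF alg] P
      proof
        assume "\<exists>p\<in>fibre 1 \<theta> {e' 6}. p 2 \<in> E \<and> p 3 \<in> E"
        then obtain p where p: "p \<in> fibre 1 \<theta> {e' 6}" "p 2 \<in> E" by blast
        have pV: "cover 1 p" "p 0 = \<theta>" "p 6 = w + 1" using fibre_cover[OF p(1)] w' by auto
        have "tr N ((w + 1) * \<theta>) = 0"
          using AS_in_GF_iff[OF cover_D(2)[OF pV(1)], of N] p(2) pV by (simp add: E)
        thus False using \<theta>(3) by (auto simp: C_def distrib_right tr_add)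
      qed
      ultimately show "splitting_type F4 T (Fr {3,2,6,0} e) (PI F4 \<theta>) \<noteq> splitting_type F4 T (Fr {3,2,6,0} e') (PI F4 \<theta>)" by metis
    qed
  qed
qed

lemma not_arith_equivalent_F4:
  assumes e: "covering_point 0 e" and e': "covering_point 1 e'"
  shows "\<not> arith_equivalent F4 T (Fr {3,2,6,0} e) (Fr {3,2,6,0} e')"
proof
  let ?K = "Fr {3,2,6,0} e" and ?K' = "Fr {3,2,6,0} e'"
  assume "arith_equivalent F4 T ?K ?K'"
  then obtain S where S: "S \<subseteq> nz_primes A4" "has_dirichlet_density A4 S 0"
    "\<And>p. p \<in> nz_primes A4 - S \<Longrightarrow> splitting_type F4 T ?K p = splitting_type F4 T ?K' p"
    using poly_subring_eq_Pol[OF is_subring_F4, of T] by (auto simp: arith_equivalent_def)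
  define D where "D = {p \<in> nz_primes A4. splitting_type F4 T ?K p \<noteq> splitting_type F4 T ?K' p}"
  obtain C where C: "\<And>n N E. trace_field n N E \<Longrightarrow> n \<ge> 4 \<Longrightarrow> 4 ^ n \<le> 16 * card {\<theta> \<in> E. C N \<theta>}"
    "\<And>n N E \<theta>. trace_field n N E \<Longrightarrow> \<theta> \<in> E \<Longrightarrow> fdeg 2 \<theta> = n \<Longrightarrow> C N \<theta> \<Longrightarrow>
       splitting_type F4 T ?K (PI F4 \<theta>) \<noteq> splitting_type F4 T ?K' (PI F4 \<theta>)"
    using splitting_types_differ[OF e e'] by blast
  have "4 ^ n \<le> 32 * n * card (primes_deg n \<inter> D)" if n6: "n \<ge> 6" for n
  proof -
    define E :: "Omega set" where "E = GF (2 ^ (2 * n))"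
    interpret trace_field n "2 * n" E by unfold_locales (use n6 in \<open>auto simp: E_def\<close>)
    define Z where "Z = {\<theta> \<in> E. C (2 * n) \<theta> \<and> fdeg 2 \<theta> = n}"
    have "4 ^ n \<le> 32 * card Z"
      unfolding Z_def using n6 C(1)[OF trace_field_axioms] by (intro count_generators) auto
    also have "card Z \<le> n * card (PI F4 ` Z)"
      using n fdeg_dvd(1) by (intro card_image_gens) (auto simp: Z_def gens_def)
    also have "card (PI F4 ` Z) \<le> card (primes_deg n \<inter> D)"
    proof (rule card_mono)
      show "finite (primes_deg n \<inter> D)" using card_primes_deg(2)[of n] n by auto
      show "PI F4 ` Z \<subseteq> primes_deg n \<inter> D"
        using fdeg_dvd(1) C(2)[OF trace_field_axioms] F4.PI_nz_prime
        by (auto simp: Z_def primes_deg_def D_def)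
    qed
    finally show ?thesis by simp
  qed
  \<comment> \<open>The proportion 1/32 and the degree bound 6 are those of
    \<open>count_generators\<close>.\<close>
  hence "\<not> has_dirichlet_density A4 S 0"
    by (intro not_density_zero[of D S 32 6]) (use S in \<open>auto simp: D_def\<close>)
  thus False using S(2) by blast
qed

section \<open>The action of the affine group on the generic fibre\<close>

text \<open>
  \<open>Rm\<close> acts as the translation \<open>(1, 1)\<close>, and \<open>Sm j k\<close> as the unit \<open>u\<close> with
  \<open>j = 1\<close> iff \<open>u \<in> {3, 7}\<close> and \<open>k = 1\<close> iff \<open>u \<in> {3, 5}\<close>.
\<close>

definition Rm :: "env \<Rightarrow> env" where
  "Rm p = p(6 := p 6 + 1, 4 := p 4 + 1, 2 := p 2 + p 4 + 1,
            3 := p 3 + (p 4 + 1) * p 2 + p 2 ^ 2 + (p 4 + 1) ^ 3 + p 5)"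

definition Sm :: "Omega \<Rightarrow> Omega \<Rightarrow> env \<Rightarrow> env" where
  "Sm j k p = p(4 := p 4 + j, 5 := p 5 + k)"

lemma gcover_I:
  assumes "p 6 ^ 2 + p 6 = 1" "p 2 ^ 2 + p 2 = p 6 * p 0"
     "p 3 ^ 2 + p 3 = (p 6 * p 0 + p 0 ^ 2) * p 2" "p 4 ^ 2 + p 4 = p 0" "p 5 ^ 2 + p 5 = p 0 ^ 3"
   shows "gcover p"
  using assms by (simp add: gcover_def cover_def)

lemma gcover_rules:
  assumes "gcover p"
  shows "p 6 * p 6 = p 6 + 1" "p 6 * (p 6 * z) = p 6 * z + 1 * z"
    "p 2 * p 2 = p 2 + p 6 * p 0" "p 2 * (p 2 * z) = p 2 * z + p 6 * p 0 * z"
    "p 4 * p 4 = p 4 + p 0" "p 4 * (p 4 * z) = p 4 * z + p 0 * z"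
    "p 5 * p 5 = p 5 + p 0 ^ 3" "p 5 * (p 5 * z) = p 5 * z + p 0 ^ 3 * z"
  using AS_rule[OF gcover_D(1)[OF assms]] AS_rule[OF gcover_D(2)[OF assms]]
    AS_rule[OF gcover_D(4)[OF assms]] AS_rule[OF gcover_D(5)[OF assms]] by simp_all

lemma gcover_Rm:
  assumes "gcover p" shows "gcover (Rm p)"
proof -
  note r = gcover_rules[OF assms]
  let ?a = "(p 4 + 1) * p 2 + p 2 ^ 2 + (p 4 + 1) ^ 3 + p 5"
  have "?a\<^sup>2 + ?a = ((p 6 + 1) * p 0 + p 0 ^ 2) * (p 2 + p 4 + 1) + (p 6 * p 0 + p 0 ^ 2) * p 2"
    by (simp add: r power2_eq_square power3_eq_cube algebra_simps)
  moreover have "(p 3 + ?a)\<^sup>2 + (p 3 + ?a) = (p 3 ^ 2 + p 3) + (?a\<^sup>2 + ?a)"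
    by (simp add: Omega_power2_add ac_simps)
  ultimately have "(p 3 + ?a)\<^sup>2 + (p 3 + ?a) = (p 6 * p 0 + p 0 ^ 2) * p 2 +
       (((p 6 + 1) * p 0 + p 0 ^ 2) * (p 2 + p 4 + 1) + (p 6 * p 0 + p 0 ^ 2) * p 2)"
    using gcover_D(3)[OF assms] by (simp only:)
  also have "\<dots> = ((p 6 + 1) * p 0 + p 0 ^ 2) * (p 2 + p 4 + 1)"
    by (metis Omega_add_self_left add.commute)
  finally have "(p 3 + ?a)\<^sup>2 + (p 3 + ?a) = ((p 6 + 1) * p 0 + p 0 ^ 2) * (p 2 + p 4 + 1)" .
  moreover have "p 3 + ?a = Rm p 3" by (simp add: Rm_def add.assoc)
  ultimately have 3: "Rm p 3 ^ 2 + Rm p 3 = ((p 6 + 1) * p 0 + p 0 ^ 2) * (p 2 + p 4 + 1)" by simp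
  have 2: "(p 2 + p 4 + 1)\<^sup>2 + (p 2 + p 4 + 1) = (p 6 + 1) * p 0"
    by (simp add: r power2_eq_square algebra_simps)
  show ?thesis
    by (rule gcover_I) (use 3 2 flip_root[OF gcover_D(1)[OF assms]] flip_root[OF gcover_D(4)[OF assms]] gcover_D(5)[OF assms] in
       \<open>simp_all add: Rm_def\<close>)
qed

lemma gcover_Sm: "gcover p \<Longrightarrow> j = 0 \<or> j = 1 \<Longrightarrow> k = 0 \<or> k = 1 \<Longrightarrow> gcover (Sm j k p)"
  using gcover_D[of p] flip_root[OF gcover_D(4), of p] flip_root[OF gcover_D(5), of p]
  by (intro gcover_I) (auto simp: Sm_def)

text \<open>Translation by 2 fixes w, s and d and raises y by 1; squaring it gives translation by 4,
  which only moves x.\<close>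

lemma Rm_Rm: "gcover p \<Longrightarrow> Rm (Rm p) = p(2 := p 2 + 1, 3 := p 3 + p 2 + p 4 ^ 2)"
proof -
  assume p: "gcover p"
  have "(p 4 + 1 + 1) * (p 2 + p 4 + 1) + (p 2 + p 4 + 1)\<^sup>2 + (p 4 + 1 + 1) ^ 3 +
     ((p 4 + 1) * p 2 + p 2 ^ 2 + (p 4 + 1) ^ 3) = p 2 + p 4 ^ 2"
    by (simp add: gcover_rules[OF p] power2_eq_square power3_eq_cube algebra_simps)
  thus ?thesis
    by (simp add: Rm_def fun_eq_iff ac_simps)
qed

lemma gcover_Rm_iter: "gcover p \<Longrightarrow> gcover ((Rm ^^ n) p)"
  by (induction n) (auto simp: gcover_Rm)

lemma Rm4: "gcover p \<Longrightarrow> (Rm ^^ 4) p = p(3 := p 3 + 1)"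
proof -
  assume p: "gcover p"
  have "(Rm ^^ 4) p = Rm (Rm (Rm (Rm p)))" by (simp only: numeral_eq_Suc pred_numeral_simps funpow.simps o_apply BitM.simps id_apply)
  also have "\<dots> = (Rm (Rm p))(2 := Rm (Rm p) 2 + 1, 3 := Rm (Rm p) 3 + Rm (Rm p) 2 + Rm (Rm p) 4 ^ 2)"
    by (rule Rm_Rm[OF gcover_Rm[OF gcover_Rm[OF p]]])
  also have "\<dots> = p(3 := p 3 + 1)"
    unfolding Rm_Rm[OF p] by (rule ext) (simp add: algebra_simps)
  finally show ?thesis .
qed

lemma Rm8: "gcover p \<Longrightarrow> (Rm ^^ 8) p = p"
proof -
  assume p: "gcover p"
  have "(Rm ^^ (4 + 4)) p = (Rm ^^ 4) ((Rm ^^ 4) p)" by (simp only: funpow_add o_apply)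
  also have "\<dots> = p" unfolding Rm4[OF gcover_Rm_iter[OF p, of 4]] unfolding Rm4[OF p] by (simp add: add.assoc)
  finally show ?thesis by simp
qed

lemma Rm_mod8: "gcover p \<Longrightarrow> (Rm ^^ (n mod 8)) p = (Rm ^^ n) p"
proof -
  assume p: "gcover p"
  have "(Rm ^^ (8 * m)) p = p" for m
    by (induction m) (simp_all add: funpow_add Rm8[OF p])
  moreover have "(Rm ^^ n) p = (Rm ^^ (n mod 8)) ((Rm ^^ (8 * (n div 8))) p)"
    by (metis add.commute comp_apply funpow_add mult_div_mod_eq)
  ultimately show ?thesis by simp
qed

text \<open>\<open>Sm 1 0\<close> is the unit 7. This relation and \<open>Rm_Sm5\<close> describe
  how the generators 7 and 5 of the unit group act on translations; the unit 3 follows.\<close>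

lemma Rm_Sm7: "gcover p \<Longrightarrow> Rm (Sm 1 0 p) = Sm 1 0 ((Rm ^^ 7) p)"
proof -
  assume p: "gcover p"
  have "(Rm ^^ (4 + 3)) p = (Rm ^^ 4) ((Rm ^^ 3) p)" by (simp only: funpow_add o_apply)
  also have "(Rm ^^ 3) p = Rm (Rm (Rm p))" by (simp add: numeral_eq_Suc)
  finally have *: "(Rm ^^ 7) p = (Rm ^^ 4) (Rm (Rm (Rm p)))" by simp
  have 3: "p 3 + (p 4 + 1 + 1) * p 2 + p 2 ^ 2 + (p 4 + 1 + 1) ^ 3 + p 5 =
      p 3 + p 2 + p 4 ^ 2 + (p 4 + 1) * (p 2 + 1) + (p 2 + 1)\<^sup>2 + (p 4 + 1) ^ 3 + p 5 + 1"
    by (simp add: gcover_rules[OF p] power2_eq_square power3_eq_cube algebra_simps)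
  have "Rm (Rm (Rm p)) = Rm (p(2 := p 2 + 1, 3 := p 3 + p 2 + p 4 ^ 2))"
    using gcover_Rm[OF p] Rm_Rm[OF gcover_Rm[OF p]] Rm_Rm[OF p] by (simp only:)
  hence R3: "Rm (Rm (Rm p)) = p(6 := p 6 + 1, 4 := p 4 + 1, 2 := p 2 + 1 + p 4 + 1,
       3 := p 3 + p 2 + p 4 ^ 2 + (p 4 + 1) * (p 2 + 1) + (p 2 + 1)\<^sup>2 + (p 4 + 1) ^ 3 + p 5)"
    unfolding Rm_def by (simp add: fun_upd_twist)
  show ?thesis
    unfolding * Rm4[OF gcover_Rm[OF gcover_Rm[OF gcover_Rm[OF p]]]] unfolding R3
  proof (rule ext)
    fix i
    show "Rm (Sm 1 0 p) i = Sm 1 0 ((p(6 := p 6 + 1, 4 := p 4 + 1, 2 := p 2 + 1 + p 4 + 1,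
       3 := p 3 + p 2 + p 4 ^ 2 + (p 4 + 1) * (p 2 + 1) + (p 2 + 1)\<^sup>2 + (p 4 + 1) ^ 3 + p 5))
       (3 := (p(6 := p 6 + 1, 4 := p 4 + 1, 2 := p 2 + 1 + p 4 + 1,
       3 := p 3 + p 2 + p 4 ^ 2 + (p 4 + 1) * (p 2 + 1) + (p 2 + 1)\<^sup>2 + (p 4 + 1) ^ 3 + p 5)) 3 + 1)) i"
      using 3 by (cases "i = 3") (simp_all add: Rm_def Sm_def ac_simps)
  qed
qed

lemma Rm_Sm5: "gcover p \<Longrightarrow> Rm (Sm 0 1 p) = Sm 0 1 ((Rm ^^ 5) p)"
proof -
  assume p: "gcover p"
  have "(Rm ^^ (4 + 1)) p = (Rm ^^ 4) ((Rm ^^ 1) p)" by (simp only: funpow_add o_apply)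
  hence *: "(Rm ^^ 5) p = (Rm ^^ 4) (Rm p)" by simp
  show ?thesis unfolding * Rm4[OF gcover_Rm[OF p]] by (simp add: Rm_def Sm_def fun_eq_iff ac_simps)
qed

definition sgn_s :: "int \<Rightarrow> Omega" where "sgn_s u = (if u \<in> {3, 7} then 1 else 0)"
definition sgn_d :: "int \<Rightarrow> Omega" where "sgn_d u = (if u \<in> {3, 5} then 1 else 0)"

definition Um :: "int \<Rightarrow> env \<Rightarrow> env" where "Um u = Sm (sgn_s u) (sgn_d u)"

definition act :: "int \<times> int \<Rightarrow> env \<Rightarrow> env" where
  "act g p = Um (snd g) ((Rm ^^ nat (fst g)) p)"

lemma gcover_Um: "gcover p \<Longrightarrow> gcover (Um u p)"
  unfolding Um_def by (rule gcover_Sm) (auto simp: sgn_s_def sgn_d_def)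

lemma gcover_act: "gcover p \<Longrightarrow> gcover (act g p)"
  unfolding act_def by (intro gcover_Um gcover_Rm_iter)

lemma Sm_Sm: "Sm j k (Sm j' k' p) = Sm (j + j') (k + k') p"
  by (simp add: Sm_def fun_eq_iff ac_simps)

lemma Um_Um:
  assumes "u \<in> {1, 3, 5, 7}" "v \<in> {1, 3, 5, 7}"
  shows "Um v (Um u p) = Um (u * v mod 8) p"
proof -
  have "Sm 0 0 p = p" for p by (simp add: Sm_def fun_eq_iff)
  thus ?thesis using assms unfolding Um_def Sm_Sm by (auto simp: sgn_s_def sgn_d_def)
qed

lemma Rm_Um:
  assumes "gcover p" "u \<in> {1, 3, 5, 7}"
  shows "Rm (Um u p) = Um u ((Rm ^^ nat u) p)"
proof -
  have S0: "Sm 0 0 p = p" for p by (simp add: Sm_def fun_eq_iff)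
  have 3: "Rm (Sm 1 1 p) = Sm 1 1 ((Rm ^^ 3) p)"
  proof -
    have "Rm (Sm 1 1 p) = Rm (Sm 1 0 (Sm 0 1 p))" by (simp add: Sm_Sm)
    also have "\<dots> = Sm 1 0 ((Rm ^^ 7) (Sm 0 1 p))" using assms(1) by (intro Rm_Sm7 gcover_Sm) auto
    also have "(Rm ^^ n) (Sm 0 1 p) = Sm 0 1 ((Rm ^^ (5 * n)) p)" for n
    proof (induction n)
      case (Suc n)
      have "(Rm ^^ Suc n) (Sm 0 1 p) = Rm (Sm 0 1 ((Rm ^^ (5 * n)) p))" using Suc by simp
      also have "\<dots> = Sm 0 1 ((Rm ^^ 5) ((Rm ^^ (5 * n)) p))" by (rule Rm_Sm5[OF gcover_Rm_iter[OF assms(1)]])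
      also have "(Rm ^^ 5) ((Rm ^^ (5 * n)) p) = (Rm ^^ (5 * Suc n)) p"
        by (simp only: mult_Suc_right funpow_add o_apply)
      finally show ?case .
    qed simp
    \<comment> \<open>3 = 5 times 7 modulo 8.\<close>
    also have "(Rm ^^ (5 * 7)) p = (Rm ^^ 3) p" using Rm_mod8[OF assms(1), of "5 * 7"] by simp
    finally show ?thesis by (simp add: Sm_Sm)
  qed
  from assms(2) consider "u = 1" | "u = 3" | "u = 5" | "u = 7" by auto
  thus ?thesis
    using 3 Rm_Sm5[OF assms(1)] Rm_Sm7[OF assms(1)] S0
    by cases (simp_all add: Um_def sgn_s_def sgn_d_def)
qed

lemma Rm_iter_Um:
  assumes "gcover p" "u \<in> {1, 3, 5, 7}"
  shows "(Rm ^^ n) (Um u p) = Um u ((Rm ^^ (nat u * n)) p)"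
proof (induction n)
  case (Suc n)
  have "(Rm ^^ Suc n) (Um u p) = Rm (Um u ((Rm ^^ (nat u * n)) p))" using Suc by simp
  also have "\<dots> = Um u ((Rm ^^ nat u) ((Rm ^^ (nat u * n)) p))"
    by (rule Rm_Um[OF gcover_Rm_iter[OF assms(1)] assms(2)])
  also have "(Rm ^^ nat u) ((Rm ^^ (nat u * n)) p) = (Rm ^^ (nat u * Suc n)) p"
    by (simp only: mult_Suc_right funpow_add o_apply)
  finally show ?case .
qed simp

text \<open>A right action: (a,u) followed by (b,v) acts as their product in this order. Passing
  from points to automorphisms reverses the order again, so that \<Phi> becomes a
  homomorphism.\<close>

lemma act_act:
  assumes p: "gcover p" and a: "a \<in> {0..7}" and b: "b \<in> {0..7}" and u: "u \<in> {1, 3, 5, 7}" and v: "v \<in> {1, 3, 5, 7}"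
  shows "act (b, v) (act (a, u) p) = act ((a + u * b) mod 8, u * v mod 8) p"
proof -
  have "act (b, v) (act (a, u) p) = Um v ((Rm ^^ nat b) (Um u ((Rm ^^ nat a) p)))" by (simp add: act_def)
  also have "(Rm ^^ nat b) (Um u ((Rm ^^ nat a) p)) = Um u ((Rm ^^ (nat u * nat b)) ((Rm ^^ nat a) p))"
    by (rule Rm_iter_Um[OF gcover_Rm_iter[OF p] u])
  also have "(Rm ^^ (nat u * nat b)) ((Rm ^^ nat a) p) = (Rm ^^ (nat u * nat b + nat a)) p"
    by (simp only: funpow_add o_apply)
  also have "\<dots> = (Rm ^^ ((nat u * nat b + nat a) mod 8)) p" using Rm_mod8[OF p] by simp
  also have "(nat u * nat b + nat a) mod 8 = nat ((a + u * b) mod 8)"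
  proof -
    have "0 \<le> u * b" using u b by auto
    hence "nat (a + u * b) = nat u * nat b + nat a" using u a b by (auto simp: nat_add_distrib nat_mult_distrib)
    moreover have "nat ((a + u * b) mod 8) = nat (a + u * b) mod 8"
      using \<open>0 \<le> u * b\<close> a by (subst nat_mod_distrib) auto
    ultimately show ?thesis by simp
  qed
  also have "Um v (Um u q) = Um (u * v mod 8) q" for q by (rule Um_Um[OF u v])
  finally show ?thesis by (simp add: act_def)
qed

lemma act_0: "act g p 0 = p 0"
proof -
  have "(Rm ^^ n) p 0 = p 0" for n by (induction n) (auto simp: Rm_def)
  thus ?thesis by (simp add: act_def Um_def Sm_def)
qed

lemma act_other: "i \<notin> {3, 5, 4, 2, 6, 0} \<Longrightarrow> act g p i = p i"
proof -
  assume i: "i \<notin> {3, 5, 4, 2, 6, 0}"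
  have "(Rm ^^ n) p i = p i" for n by (induction n) (use i in \<open>auto simp: Rm_def\<close>)
  thus ?thesis using i by (auto simp: act_def Um_def Sm_def)
qed

lemma PF_act:
  assumes "i \<in> {3, 5, 4, 2, 6, 0}" shows "(\<lambda>p. act g p i) \<in> PF {3, 5, 4, 2, 6, 0}"
proof -
  have R: "(\<lambda>p. (Rm ^^ n) p i) \<in> PF {3, 5, 4, 2, 6, 0}" if "i \<in> {3, 5, 4, 2, 6, 0}" for n i
    using that
  proof (induction n arbitrary: i)
    case (Suc n)
    have *: "(\<lambda>p. Rm p i) \<in> PF {3, 5, 4, 2, 6, 0}"
      using Suc.prems by (auto simp: Rm_def)
    have "(\<lambda>p. Rm ((Rm ^^ n) p) i) \<in> PF {3, 5, 4, 2, 6, 0}"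
      by (rule PF_subst[OF *, of "\<lambda>p. (Rm ^^ n) p"]) (rule Suc.IH)
    thus ?case by simp
  qed (simp only: funpow.simps id_apply PF_var)
  have c: "sgn_s u = 0 \<or> sgn_s u = 1" "sgn_d u = 0 \<or> sgn_d u = 1" for u by (auto simp: sgn_s_def sgn_d_def)
  have s: "(\<lambda>p. sgn_s (snd g)) \<in> PF {3, 5, 4, 2, 6, 0}" using c(1)[of "snd g"] by auto
  have d: "(\<lambda>p. sgn_d (snd g)) \<in> PF {3, 5, 4, 2, 6, 0}" using c(2)[of "snd g"] by auto
  show ?thesis
    using R[OF assms, of "nat (fst g)"] PF_add[OF R[of 4 "nat (fst g)"] s] PF_add[OF R[of 5 "nat (fst g)"] d]
    by (cases "i = 4"; cases "i = 5") (simp_all add: act_def Um_def Sm_def)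
qed

text \<open>The coordinates are matched one Artin-Schreier root at a time: w by the parity of a
  translation, s and d by a unit, y by translation by 2, x by translation by 4, each fixing what was
  matched before.\<close>

lemma act_transitive:
  assumes p: "gcover p" and q: "gcover q" and 0: "p 0 = q 0" and other: "\<And>i. i \<notin> {3, 5, 4, 2, 6, 0} \<Longrightarrow> p i = q i"
  shows "\<exists>a\<in>{0..7}. \<exists>u\<in>{1, 3, 5, 7}. q = act (a, u) p"
proof -
  have "\<exists>n. (Rm ^^ n) p 6 = q 6"
  proof -
    have "q 6 = p 6 \<or> q 6 = p 6 + 1" by (rule AS_roots[OF gcover_D(1)[OF p] gcover_D(1)[OF q]])
    moreover have "(Rm ^^ 0) p 6 = p 6" "(Rm ^^ 1) p 6 = p 6 + 1" by (simp_all add: Rm_def)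
    ultimately show ?thesis by metis
  qed
  then obtain n where n: "(Rm ^^ n) p 6 = q 6" by blast
  define p1 where "p1 = (Rm ^^ n) p"
  have p1: "gcover p1" "p1 6 = q 6" "p1 0 = q 0" using gcover_Rm_iter[OF p] n act_0[of "(int n, 1)" p] 0
    by (simp_all add: p1_def act_def Um_def Sm_def)
  have "\<exists>u\<in>{1, 3, 5, 7}. Um u p1 4 = q 4 \<and> Um u p1 5 = q 5"
  proof -
    have "q 4 = p1 4 \<or> q 4 = p1 4 + 1" by (rule AS_roots[OF gcover_D(4)[OF p1(1)]]) (simp add: p1(3) gcover_D(4)[OF q])
    moreover have "q 5 = p1 5 \<or> q 5 = p1 5 + 1" by (rule AS_roots[OF gcover_D(5)[OF p1(1)]]) (simp add: p1(3) gcover_D(5)[OF q])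
    ultimately show ?thesis by (auto simp: Um_def Sm_def sgn_s_def sgn_d_def)
  qed
  then obtain u where u: "u \<in> {1, 3, 5, 7}" "Um u p1 4 = q 4" "Um u p1 5 = q 5" by blast
  define p2 where "p2 = Um u p1"
  have p2: "gcover p2" "p2 6 = q 6" "p2 0 = q 0" "p2 4 = q 4" "p2 5 = q 5"
    using gcover_Um[OF p1(1)] p1(2,3) u(2,3) by (simp_all add: p2_def) (simp_all add: Um_def Sm_def)
  have "\<exists>m. let r = (Rm ^^ m) p2 in r 2 = q 2 \<and> r 6 = q 6 \<and> r 0 = q 0 \<and> r 4 = q 4 \<and> r 5 = q 5"
  proof -
    have "q 2 = p2 2 \<or> q 2 = p2 2 + 1" by (rule AS_roots[OF gcover_D(2)[OF p2(1)]]) (simp add: p2 gcover_D(2)[OF q])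
    thus ?thesis
    proof
      assume "q 2 = p2 2" thus ?thesis using p2 by (intro exI[of _ 0]) simp
    next
      assume "q 2 = p2 2 + 1" thus ?thesis using p2 Rm_Rm[OF p2(1)] by (intro exI[of _ 2]) (simp add: numeral_2_eq_2)
    qed
  qed
  then obtain m where m: "(Rm ^^ m) p2 2 = q 2" "(Rm ^^ m) p2 6 = q 6" "(Rm ^^ m) p2 0 = q 0"
    "(Rm ^^ m) p2 4 = q 4" "(Rm ^^ m) p2 5 = q 5" by (auto simp: Let_def)
  define p3 where "p3 = (Rm ^^ m) p2"
  have p3: "gcover p3" using gcover_Rm_iter[OF p2(1)] by (simp add: p3_def)
  have "\<exists>l. let r = (Rm ^^ l) p3 in r 3 = q 3 \<and> r 2 = q 2 \<and> r 6 = q 6 \<and> r 0 = q 0 \<and> r 4 = q 4 \<and> r 5 = q 5"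
  proof -
    have "q 3 = p3 3 \<or> q 3 = p3 3 + 1" by (rule AS_roots[OF gcover_D(3)[OF p3]]) (simp add: m p3_def gcover_D(3)[OF q])
    thus ?thesis
    proof
      assume "q 3 = p3 3" thus ?thesis using m by (intro exI[of _ 0]) (simp add: p3_def)
    next
      assume "q 3 = p3 3 + 1" thus ?thesis using m Rm4[OF p3] by (intro exI[of _ 4]) (simp add: p3_def)
    qed
  qed
  then obtain l where l: "(Rm ^^ l) p3 3 = q 3" "(Rm ^^ l) p3 2 = q 2" "(Rm ^^ l) p3 6 = q 6"
    "(Rm ^^ l) p3 0 = q 0" "(Rm ^^ l) p3 4 = q 4" "(Rm ^^ l) p3 5 = q 5" by (auto simp: Let_def)
  have "(Rm ^^ l) p3 = (Rm ^^ (l + m)) (Um u ((Rm ^^ n) p))" by (simp add: p3_def p2_def p1_def funpow_add)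
  also have "\<dots> = Um u ((Rm ^^ (nat u * (l + m))) ((Rm ^^ n) p))" by (rule Rm_iter_Um[OF gcover_Rm_iter[OF p] u(1)])
  also have "\<dots> = Um u ((Rm ^^ (nat u * (l + m) + n)) p)" by (simp only: funpow_add o_apply)
  also have "\<dots> = act (int ((nat u * (l + m) + n) mod 8), u) p" using Rm_mod8[OF p] by (simp add: act_def)
  finally have eq: "(Rm ^^ l) p3 = act (int ((nat u * (l + m) + n) mod 8), u) p" .
  have "q = (Rm ^^ l) p3"
  proof
    fix i show "q i = (Rm ^^ l) p3 i"
      using l other[of i] act_other[of i _ p] unfolding eq[symmetric]
      by (cases "i \<in> {3, 5, 4, 2, 6, 0}") (auto simp: eq)
  qed
  moreover have "int ((nat u * (l + m) + n) mod 8) \<in> {0..7}" by auto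
  ultimately show ?thesis using eq u(1) by metis
qed

text \<open>w detects odd translations; for even ones s and d detect the unit. Among the even
  translations, 2 and 6 move y, and 4 moves x.\<close>

lemma act_trivial:
  assumes p: "gcover p" and g: "a \<in> {0..7}" "u \<in> {1, 3, 5, 7}" and eq: "act (a, u) p = p"
  shows "a = 0 \<and> u = 1"
proof -
  define n where "n = nat a"
  have iter: "(Rm ^^ n) p 6 = p 6 + of_nat n \<and> (Rm ^^ n) p 4 = p 4 + of_nat n \<and> (Rm ^^ n) p 5 = p 5" for n
    by (induction n) (auto simp: Rm_def ac_simps)
  have "act (a, u) p 6 = p 6 + of_nat n" using iter by (simp add: act_def Um_def Sm_def n_def)
  hence n0: "(of_nat n :: Omega) = 0" by (simp add: eq)
  have "act (a, u) p 4 = p 4 + of_nat n + sgn_s u" "act (a, u) p 5 = p 5 + sgn_d u"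
    using iter by (simp_all add: act_def Um_def Sm_def n_def)
  hence "sgn_s u = 0" "sgn_d u = 0" using n0 by (simp_all add: eq)
  hence u: "u = 1" using g(2) by (auto simp: sgn_s_def sgn_d_def)
  have "even n"
  proof (rule ccontr)
    assume "odd n"
    then obtain m where "n = 2 * m + 1" by (rule oddE)
    thus False using n0 by simp
  qed
  moreover have "n \<le> 7" using g(1) by (auto simp: n_def)
  ultimately consider "n = 0" | "n = 2" | "n = 4" | "n = 6" by (auto elim!: evenE) linarith
  thus ?thesis
  proof cases
    case 2
    have "act (a, u) p 2 = p 2 + 1" using Rm_Rm[OF p] 2 u
      by (simp add: act_def Um_def Sm_def n_def[symmetric] numeral_2_eq_2 sgn_s_def)
    thus ?thesis using eq by simp
  next
    case 3
    have "act (a, u) p 3 = p 3 + 1" using Rm4[OF p] 3 u by (simp add: act_def Um_def Sm_def n_def[symmetric])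
    thus ?thesis using eq by simp
  next
    case 4
    have "(Rm ^^ (4 + 2)) p = (Rm ^^ 4) ((Rm ^^ 2) p)" by (simp only: funpow_add o_apply)
    hence "(Rm ^^ 6) p 2 = p 2 + 1" using Rm4[OF gcover_Rm_iter[OF p, of 2]] Rm_Rm[OF p] by (simp add: numeral_2_eq_2)
    hence "act (a, u) p 2 = p 2 + 1" using 4 u by (simp add: act_def Um_def Sm_def n_def[symmetric] sgn_s_def)
    thus ?thesis using eq by simp
  qed (use g u in \<open>auto simp: n_def\<close>)
qed

section \<open>Galois theory of the generic fibre\<close>

lemma poly_prod_roots: "finite S \<Longrightarrow> poly (\<Prod>y\<in>S. [:y, 1:]) z = 0 \<longleftrightarrow> (z::Omega) \<in> S"
  by (auto simp: poly_prod)

lemma lead_coeff_prod_roots: "lead_coeff (\<Prod>y\<in>S. [:y, 1::Omega:]) = 1"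
  by (simp add: lead_coeff_prod)

lemma degree_prod_roots: "degree (\<Prod>y\<in>S. [:y, 1::Omega:]) = card S"
  by (simp add: degree_prod_eq_sum_degree)

lemma rsquarefree_prod_roots:
  assumes "finite S" shows "rsquarefree (\<Prod>y\<in>S. [:y, 1::Omega:])"
  unfolding rsquarefree_def
proof (intro conjI allI)
  show nz: "(\<Prod>y\<in>S. [:y, 1::Omega:]) \<noteq> 0" using assms by simp
  fix a
  show "order a (\<Prod>y\<in>S. [:y, 1::Omega:]) = 0 \<or> order a (\<Prod>y\<in>S. [:y, 1::Omega:]) = 1"
  proof (cases "a \<in> S")
    case True
    have eq: "(\<Prod>y\<in>S. [:y, 1::Omega:]) = [:-a, 1:] ^ 1 * (\<Prod>y\<in>S - {a}. [:y, 1::Omega:])"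
      using prod.remove[OF assms True, of "\<lambda>y. [:y, 1::Omega:]"] by simp
    have "order a (\<Prod>y\<in>S. [:y, 1::Omega:]) = order a ([:-a, 1:] ^ 1) + order a (\<Prod>y\<in>S - {a}. [:y, 1::Omega:])"
      using nz unfolding eq by (rule order_mult)
    also have "order a ([:-a, 1:] ^ 1) = 1" by (rule order_power_n_n)
    also have "order a (\<Prod>y\<in>S - {a}. [:y, 1::Omega:]) = 0"
      by (rule order_0I) (simp add: poly_prod_roots assms)
    finally show ?thesis by simp
  next
    case False
    thus ?thesis using order_0I[of "\<Prod>y\<in>S. [:y, 1::Omega:]" a] by (simp add: poly_prod_roots assms)
  qed
qed

lemma hom_on_inverse:
  assumes N: "is_subfield N" and h: "hom_on N \<tau>" and z: "z \<in> N" "z \<noteq> 0"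
  shows "\<tau> z \<noteq> 0"
proof
  assume "\<tau> z = 0"
  moreover have "\<tau> (z * inverse z) = \<tau> z * \<tau> (inverse z)"
    using hom_onD(3)[OF h z(1) is_subfieldD(5)[OF N z(1)]] .
  ultimately show False using z hom_onD(1)[OF h] by simp
qed

lemma hom_on_inj:
  assumes N: "is_subfield N" and h: "hom_on N \<tau>"
  shows "inj_on \<tau> N"
proof (rule inj_onI)
  fix a b assume ab: "a \<in> N" "b \<in> N" "\<tau> a = \<tau> b"
  have "\<tau> (a + b) = 0" using hom_onD(2)[OF h ab(1,2)] ab(3) by simp
  thus "a = b" using hom_on_inverse[OF N h, of "a + b"] is_subfieldD(3)[OF N ab(1,2)] by auto
qed

lemma hom_on_coeff_prod:
  assumes N: "is_subring N" and h: "hom_on N \<tau>" and S: "finite S" "S \<subseteq> N" and inj: "inj_on \<tau> N"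
  shows "(\<Prod>y\<in>S. [:y, 1:]) \<in> polys N \<and>
    (\<forall>i. \<tau> (coeff (\<Prod>y\<in>S. [:y, 1:]) i) = coeff (\<Prod>y\<in>\<tau> ` S. [:y, 1:]) i)"
proof -
  have "(\<Prod>y\<in>\<tau> ` S. [:y, 1:]) = (\<Prod>y\<in>S. [:\<tau> y, 1:])"
    by (rule prod.reindex_cong[of \<tau>]) (use inj_on_subset[OF inj S(2)] in auto)
  moreover have "(\<Prod>y\<in>S. [:y, 1:]) \<in> polys N \<and>
    (\<forall>i. \<tau> (coeff (\<Prod>y\<in>S. [:y, 1:]) i) = coeff (\<Prod>y\<in>S. [:\<tau> y, 1:]) i)"
    using S
  proof (induction S)
    case empty
    have "\<tau> 0 = 0" "\<tau> 1 = 1" using hom_onD(4)[OF h is_subringD(1)[OF N]] hom_onD(1)[OF h] by auto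
    thus ?case by (auto simp: polys_closed(2)[OF N] coeff_1)
  next
    case (insert a S)
    let ?P = "\<Prod>y\<in>S. [:y, 1:]" and ?Q = "\<Prod>y\<in>S. [:\<tau> y, 1:]"
    have IH: "?P \<in> polys N" "\<And>i. \<tau> (coeff ?P i) = coeff ?Q i" and a: "a \<in> N" using insert by auto
    have "\<tau> (coeff ([:a, 1:] * ?P) i) = coeff ([:\<tau> a, 1:] * ?Q) i" for i
    proof -
      have c: "coeff ?P i \<in> N" for i using IH(1) by (simp add: polys_def)
      have ac: "a * coeff ?P i \<in> N" using a c is_subringD(4)[OF N] by blast
      have e1: "\<tau> (a * coeff ?P i) = \<tau> a * coeff ?Q i" using hom_onD(3)[OF h a c] IH(2) by simp
      show ?thesis
      proof (cases i)
        case 0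
        thus ?thesis using e1 by simp
      next
        case (Suc j)
        have "\<tau> (a * coeff ?P i + coeff ?P j) = \<tau> a * coeff ?Q i + coeff ?Q j"
          using hom_onD(2)[OF h ac c] e1 IH(2) by simp
        thus ?thesis using Suc by simp
      qed
    qed
    moreover have "[:a, 1:] * ?P \<in> polys N"
      using IH(1) a is_subringD[OF N] by (intro polys_closed N)
    ultimately show ?case using insert(1,2) by simp
  qed
  ultimately show ?thesis by simp
qed

lemma hom_on_poly:
  assumes N: "is_subring N" and h: "hom_on N \<tau>" and q: "q \<in> polys N" "\<And>i. \<tau> (coeff q i) = coeff q i" and z: "z \<in> N"
  shows "\<tau> (poly q z) = poly q (\<tau> z)"
proof -
  have cN: "coeff q i \<in> N" and zp: "z ^ i \<in> N" for i
    using q(1) is_subring_power[OF N z] by (auto simp: polys_def)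
  have "\<tau> (\<Sum>i\<le>n. coeff q i * z ^ i) = (\<Sum>i\<le>n. coeff q i * \<tau> z ^ i)" for n
  proof (induction n)
    case 0
    show ?case using q(2) by simp
  next
    case (Suc n)
    have 1: "(\<Sum>i\<le>n. coeff q i * z ^ i) \<in> N" by (intro is_subring_sum N is_subringD(4)[OF N] cN zp)
    have 2: "coeff q (Suc n) * z ^ Suc n \<in> N" using is_subringD(4)[OF N cN zp] .
    have "\<tau> (coeff q (Suc n) * z ^ Suc n) = coeff q (Suc n) * \<tau> z ^ Suc n"
      unfolding hom_onD(3)[OF h cN zp] q(2) hom_on_power[OF N h z] ..
    thus ?case using hom_onD(2)[OF h 1 2] Suc by simp
  qed
  thus ?thesis by (simp add: poly_altdef)
qed

lemma hom_on_iff_ring_hom: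
  "\<sigma> \<in> ring_hom (sub_of A) (sub_of B) \<longleftrightarrow> \<sigma> \<in> A \<rightarrow> B \<and> hom_on A \<sigma>"
  by (auto simp: ring_hom_def hom_on_def)

text \<open>The denominator depends on coordinate 0 only, so it keeps its nonzero value at a point
  with the same coordinate 0, and the quotient can be carried over.\<close>

definition sg :: "nat set \<Rightarrow> env \<Rightarrow> env \<Rightarrow> Omega \<Rightarrow> Omega" where
  "sg I e p z = (SOME r. \<exists>f\<in>PF I. \<exists>h\<in>PF {0}. h e \<noteq> 0 \<and> z = f e / h e \<and> r = f p / h p)"

context generic_point
begin

abbreviation "I6 \<equiv> {3, 5, 4, 2, 6, 0::nat}"
abbreviation "N \<equiv> Fr I6 e"

lemma N_subfield: "is_subfield N" using towerD(4)[OF towers(6)] .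

lemmas N_closed = is_subfieldD[OF N_subfield]

text \<open>Points correspond to the automorphisms of \<open>N\<close> over \<open>Fr J e\<close>;
  agreement with e outside the six coordinates makes equality of functions the right equality of
  points.\<close>

definition Pts :: "nat set \<Rightarrow> env set" where
  "Pts J = {p. gcover p \<and> (\<forall>i. i \<in> J \<or> i \<notin> I6 \<longrightarrow> p i = e i)}"

definition gal :: "env \<Rightarrow> Omega \<Rightarrow> Omega" where "gal = sg I6 e"

lemma PtsD: "p \<in> Pts J \<Longrightarrow> gcover p" "p \<in> Pts J \<Longrightarrow> i \<in> J \<Longrightarrow> p i = e i" "p \<in> Pts J \<Longrightarrow> i \<notin> I6 \<Longrightarrow> p i = e i"
  by (auto simp: Pts_def)

lemma Pts_mono: "J' \<subseteq> J \<Longrightarrow> Pts J \<subseteq> Pts J'" by (auto simp: Pts_def)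

lemma PF0_at: "h \<in> PF {0} \<Longrightarrow> p \<in> Pts {0} \<Longrightarrow> h p = h e"
  by (erule PF_cong) (simp add: PtsD)

lemma gal_eq:
  assumes p: "p \<in> Pts {0}" and f: "f \<in> PF I6" and h: "h \<in> PF {0}" "h e \<noteq> 0"
  shows "gal p (f e / h e) = f p / h e"
proof -
  have "\<exists>f'\<in>PF I6. \<exists>h'\<in>PF {0}. h' e \<noteq> 0 \<and> f e / h e = f' e / h' e \<and> gal p (f e / h e) = f' p / h' p"
    unfolding gal_def sg_def by (rule someI[of _ "f p / h p"]) (use f h in blast)
  then obtain f' h' where *: "f' \<in> PF I6" "h' \<in> PF {0}" "h' e \<noteq> 0" "f e / h e = f' e / h' e"
    "gal p (f e / h e) = f' p / h' p" by blast
  have h6: "h \<in> PF I6" "h' \<in> PF I6" using PF_mono[OF h(1), of I6] PF_mono[OF *(2), of I6] by simp_all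
  have "f e * h' e + f' e * h e = 0" using *(3,4) h(2) by (simp add: field_simps)
  moreover have "(\<lambda>q. f q * h' q + f' q * h q) \<in> PF I6" using f h6 *(1) by simp
  ultimately have "f p * h' p + f' p * h p = 0"
    using towerD(3)[OF towers(6) _ _ PtsD(1)[OF p], of "\<lambda>q. f q * h' q + f' q * h q"] by blast
  hence "f p * h' e = f' p * h e" using PF0_at[OF h(1) p] PF0_at[OF *(2) p] by simp
  hence "f p / h e = f' p / h' e" using *(3) h(2) by (simp add: field_simps)
  thus ?thesis using *(5) PF0_at[OF *(2) p] by simp
qed

lemma N_E:
  assumes "z \<in> N"
  obtains f h where "f \<in> PF I6" "h \<in> PF {0}" "h e \<noteq> 0" "z = f e / h e"
  using assms by (auto simp: Fr_def Rv_def)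

lemma gal_PF: "p \<in> Pts {0} \<Longrightarrow> f \<in> PF I6 \<Longrightarrow> gal p (f e) = f p"
  using gal_eq[of p f "\<lambda>_. 1"] by simp

lemma gal_var: "p \<in> Pts {0} \<Longrightarrow> i \<in> I6 \<Longrightarrow> gal p (e i) = p i"
  using gal_PF[of p "\<lambda>p. p i"] by simp

lemma gal_hom:
  assumes p: "p \<in> Pts {0}" shows "hom_on N (gal p)"
  unfolding hom_on_def
proof (intro conjI ballI)
  show "gal p 1 = 1" using gal_PF[OF p, of "\<lambda>_. 1"] by simp
  fix a b assume "a \<in> N" "b \<in> N"
  then obtain f h f' h' where *: "f \<in> PF I6" "h \<in> PF {0}" "h e \<noteq> 0" "a = f e / h e"
    "f' \<in> PF I6" "h' \<in> PF {0}" "h' e \<noteq> 0" "b = f' e / h' e" by (auto elim!: N_E)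
  have h6: "h \<in> PF I6" "h' \<in> PF I6" using PF_mono[OF *(2), of I6] PF_mono[OF *(6), of I6] by simp_all
  have ab: "gal p a = f p / h e" "gal p b = f' p / h' e"
    using gal_eq[OF p *(1,2,3)] gal_eq[OF p *(5,6,7)] *(4,8) by simp_all
  have hh: "(\<lambda>p. h p * h' p) \<in> PF {0}" "h e * h' e \<noteq> 0" using * by auto
  have "a + b = (f e * h' e + f' e * h e) / (h e * h' e)" using * by (simp add: field_simps)
  hence "gal p (a + b) = (f p * h' p + f' p * h p) / (h e * h' e)"
    using gal_eq[OF p _ hh, of "\<lambda>p. f p * h' p + f' p * h p"] h6 * by simp
  also have "\<dots> = f p / h e + f' p / h' e"
    unfolding PF0_at[OF *(2) p] PF0_at[OF *(6) p] add_divide_distrib using *(3,7) by simp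
  finally show "gal p (a + b) = gal p a + gal p b" by (simp only: ab)
  have "gal p ((f e * f' e) / (h e * h' e)) = (f p * f' p) / (h e * h' e)"
    using gal_eq[OF p _ hh, of "\<lambda>p. f p * f' p"] * by simp
  thus "gal p (a * b) = gal p a * gal p b" unfolding ab by (simp add: *(4,8))
qed

lemma gal_fix:
  assumes p: "p \<in> Pts J" and J: "0 \<in> J" "J \<subseteq> I6" and z: "z \<in> Fr J e"
  shows "gal p z = z"
proof -
  from z obtain f h where *: "f \<in> PF J" "h \<in> PF {0}" "h e \<noteq> 0" "z = f e / h e"
    by (auto simp: Fr_def Rv_def)
  have "p \<in> Pts {0}" using Pts_mono[of "{0}" J] J p by auto
  moreover have "f \<in> PF I6" using PF_mono[OF *(1) J(2)] .
  moreover have "f p = f e" using *(1) by (rule PF_cong) (use PtsD(2)[OF p] in auto)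
  ultimately show ?thesis using gal_eq[of p f h] * by simp
qed

lemma e_Pts: "e \<in> Pts J" using U by (auto simp: Pts_def)

lemma gal_e: "z \<in> N \<Longrightarrow> gal e z = z" using gal_fix[OF e_Pts[of I6]] by simp

lemma act_Pts: "act g e \<in> Pts {0}"
  using gcover_act[OF U] act_0 act_other by (auto simp: Pts_def)

lemma Pts_act:
  assumes "p \<in> Pts {0}" obtains a u where "a \<in> {0..7}" "u \<in> {1, 3, 5, 7}" "p = act (a, u) e"
  using act_transitive[OF U PtsD(1)[OF assms]] PtsD(2,3)[OF assms] that by (metis insertI1)

lemma finite_Pts: "0 \<in> J \<Longrightarrow> finite (Pts J)"
proof (rule finite_subset)
  assume "0 \<in> J"
  hence "Pts J \<subseteq> Pts {0}" by (intro Pts_mono) simp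
  thus "Pts J \<subseteq> (\<lambda>g. act g e) ` ({0..7} \<times> {1, 3, 5, 7})" by (blast elim!: Pts_act)
qed simp

lemma gal_act:
  assumes z: "z \<in> N" and p: "p \<in> Pts {0}"
  shows "gal (act g e) z \<in> N" "gal p (gal (act g e) z) = gal (act g p) z"
proof -
  obtain f h where *: "f \<in> PF I6" "h \<in> PF {0}" "h e \<noteq> 0" "z = f e / h e" by (rule N_E[OF z])
  have f': "(\<lambda>p. f (act g p)) \<in> PF I6" by (rule PF_subst[OF *(1) PF_act])
  have gz: "gal (act g e) z = f (act g e) / h e" unfolding *(4) by (rule gal_eq[OF act_Pts *(1,2,3)])
  show "gal (act g e) z \<in> N" unfolding gz by (rule FrI[OF f' *(2,3)])
  have "act g p \<in> Pts {0}" using gcover_act[OF PtsD(1)[OF p]] PtsD(2,3)[OF p] act_0 act_other by (auto simp: Pts_def)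
  from gal_eq[OF this *(1,2,3)] gal_eq[OF p f' *(2,3)]
  show "gal p (gal (act g e) z) = gal (act g p) z" unfolding gz by (simp add: *(4))
qed

lemma gal_N: "z \<in> N \<Longrightarrow> p \<in> Pts {0} \<Longrightarrow> gal p z \<in> N"
  using gal_act(1) by (metis Pts_act)

lemma gal_comp:
  assumes J: "0 \<in> J" "J \<subseteq> I6" and p: "p \<in> Pts J" and q: "q \<in> Pts J"
  shows "\<exists>r\<in>Pts J. \<forall>z\<in>N. gal q (gal p z) = gal r z"
proof -
  have p0: "p \<in> Pts {0}" and q0: "q \<in> Pts {0}" using Pts_mono[of "{0}" J] J p q by auto
  obtain g where g: "p = act g e" using Pts_act[OF p0] by blast
  have "act g q i = e i" if "i \<in> J" for i
  proof -
    have "i \<in> I6" using that J by blast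
    hence "act g q i = gal q (act g e i)" using gal_PF[OF q0 PF_act] by simp
    also have "act g e i = e i" using PtsD(2)[OF p that] g by simp
    also have "gal q (e i) = e i" using gal_var[OF q0 \<open>i \<in> I6\<close>] PtsD(2)[OF q that] by simp
    finally show ?thesis .
  qed
  hence "act g q \<in> Pts J" using gcover_act[OF PtsD(1)[OF q]] PtsD(3)[OF q] act_other by (auto simp: Pts_def)
  thus ?thesis using gal_act(2)[OF _ q0, of _ g] g by blast
qed

text \<open>With z = u + v (e j), the automorphism fixes u and v and sends z to z + v, so v =
  0.\<close>

lemma fixed_descend:
  assumes step: "AS_step J gcover e j h" and J: "insert j J \<subseteq> I6"
    and q: "q \<in> Pts J" "q j = e j + 1" and z: "z \<in> Fr (insert j J) e" "gal q z = z"
  shows "z \<in> Fr J e"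
proof -
  interpret AS_step J gcover e j h by (rule step)
  have q0: "q \<in> Pts {0}" using Pts_mono[of "{0}" J] zero q by auto
  from z(1) obtain u v where uv: "z = u + v * e j" "u \<in> Fr J e" "v \<in> Fr J e" by (auto simp: Fr_insert)
  have JI: "J \<subseteq> I6" and j: "j \<in> I6" using J by auto
  have N: "u \<in> N" "v \<in> N" "e j \<in> N"
    using uv Fr_mono[OF JI, of e] Rv_var[OF j, of e] Rv_subset_Fr[of I6 e] by blast+
  note h = hom_onD[OF gal_hom[OF q0]]
  have vj: "v * e j \<in> N" using N_closed(4)[OF N(2,3)] .
  have "gal q z = gal q u + gal q v * gal q (e j)"
    unfolding uv(1) h(2)[OF N(1) vj] h(3)[OF N(2,3)] ..
  also have "\<dots> = u + v * (e j + 1)"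
    unfolding gal_fix[OF q(1) zero JI uv(2)] gal_fix[OF q(1) zero JI uv(3)] gal_var[OF q0 j] q(2) ..
  finally have "z = z + v" using z(2) uv(1) by (simp add: algebra_simps)
  hence "v = 0" by simp
  thus ?thesis using uv by simp
qed

lemma fixed_field:
  assumes J: "J = {0} \<or> J = {6, 0}" and z: "z \<in> N" and fx: "\<And>q. q \<in> Pts J \<Longrightarrow> gal q z = z"
  shows "z \<in> Fr J e"
proof -
  have UD: "gcover p" if "p 0 = e 0" "p 6 = e 6" "p 2 = e 2" "p 3 = e 3 \<or> p 3 = e 3 + 1"
    "p 4 = e 4 \<or> p 4 = e 4 + 1" "p 5 = e 5 \<or> p 5 = e 5 + 1" for p
    using that gcover_D[OF U] flip_root[OF gcover_D(3)[OF U]] flip_root[OF gcover_D(4)[OF U]] flip_root[OF gcover_D(5)[OF U]]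
    by (auto intro!: gcover_I)
  have "e(3 := e 3 + 1) \<in> Pts {5, 4, 2, 6, 0}" "e(5 := e 5 + 1) \<in> Pts {4, 2, 6, 0}"
     "e(4 := e 4 + 1) \<in> Pts {2, 6, 0}"
    unfolding Pts_def by (auto intro!: UD)
  note flips = this
  have Pm: "Pts {5, 4, 2, 6, 0} \<subseteq> Pts J" "Pts {4, 2, 6, 0} \<subseteq> Pts J" "Pts {2, 6, 0} \<subseteq> Pts J" "Pts {6, 0} \<subseteq> Pts J"
    using J by (auto intro!: Pts_mono)
  have z5: "z \<in> Fr {5, 4, 2, 6, 0} e"
    by (rule fixed_descend[OF steps(5) _ flips(1) _ z]) (use fx flips(1) Pm in auto)
  have z4: "z \<in> Fr {4, 2, 6, 0} e"
    by (rule fixed_descend[OF steps(4) _ flips(2) _ z5]) (use fx flips(2) Pm in auto)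
  have z2: "z \<in> Fr {2, 6, 0} e"
    by (rule fixed_descend[OF steps(3) _ flips(3) _ z4]) (use fx flips(3) Pm in auto)
  \<comment> \<open>Unlike x, d and s, the root y cannot be flipped alone, since x depends on it.
    The square of \<open>Rm\<close> flips y and adjusts x; \<open>Rm\<close> does the same for
    w.\<close>
  have R2: "Rm (Rm e) \<in> Pts {6, 0}" "Rm (Rm e) 2 = e 2 + 1"
    using gcover_Rm[OF gcover_Rm[OF U]] unfolding Pts_def Rm_Rm[OF U] by auto
  have z6: "z \<in> Fr {6, 0} e"
    by (rule fixed_descend[OF steps(2) _ R2 z2]) (use fx R2(1) Pm in auto)
  have R: "Rm e \<in> Pts {0}" "Rm e 6 = e 6 + 1"
    using gcover_Rm[OF U] unfolding Pts_def by (auto simp: Rm_def)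
  show ?thesis
  proof (cases "J = {0}")
    case True
    have "z \<in> Fr {0} e"
      by (rule fixed_descend[OF steps(1) _ R z6]) (use fx R(1) True in auto)
    thus ?thesis using True by simp
  qed (use J z6 in auto)
qed

lemma gal_root:
  assumes J: "0 \<in> J" "J \<subseteq> I6" and p: "p \<in> Pts J" and q: "q \<in> polys (Fr J e)" and z: "z \<in> N" "poly q z = 0"
  shows "poly q (gal p z) = 0"
proof -
  have p0: "p \<in> Pts {0}" using Pts_mono[of "{0}" J] p J by auto
  have "q \<in> polys N" using q polys_mono[OF Fr_mono[OF J(2)]] by blast
  moreover have "gal p (coeff q i) = coeff q i" for i using gal_fix[OF p J] q by (simp add: polys_def)
  ultimately have "gal p (poly q z) = poly q (gal p z)"
    using hom_on_poly[OF N_closed(7) gal_hom[OF p0]] z(1) by blast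
  thus ?thesis using z gal_PF[OF p0, of "\<lambda>_. 0"] by simp
qed

text \<open>The product of X + r over the orbit of z has coefficients in the fixed field, and every
  polynomial over that field with root z vanishes on the orbit. So it is the minimal polynomial, has
  simple roots and splits in \<open>N\<close>: separability and normality come together.\<close>

lemma min_poly_N:
  assumes J: "J = {0} \<or> J = {6, 0}" and z: "z \<in> N"
  shows "\<exists>p. is_min_poly (Fr J e) z p \<and> rsquarefree p \<and> (\<forall>r. poly p r = 0 \<longrightarrow> r \<in> N)"
proof -
  have J': "0 \<in> J" "J \<subseteq> I6" using J by auto
  have P0: "Pts J \<subseteq> Pts {0}" using J' by (intro Pts_mono) simp
  define S where "S = (\<lambda>q. gal q z) ` Pts J"
  have fin: "finite S" unfolding S_def using finite_Pts[OF J'(1)] by (rule finite_imageI)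
  have ON: "S \<subseteq> N" unfolding S_def using gal_N[OF z] P0 by blast
  have Jr: "is_subring (Fr J e)" using is_subring_Fr[OF J'(1)] .
  define P where "P = (\<Prod>r\<in>S. [:r, 1:])"
  have inj: "inj_on (gal q) N" if "q \<in> Pts J" for q
    using hom_on_inj[OF N_subfield gal_hom] that P0 by blast
  have image: "gal q ` S = S" if q: "q \<in> Pts J" for q
  proof (rule endo_inj_surj[OF fin])
    show "gal q ` S \<subseteq> S"
    proof
      fix r assume "r \<in> gal q ` S"
      then obtain p where p: "p \<in> Pts J" "r = gal q (gal p z)" by (auto simp: S_def)
      thus "r \<in> S" using gal_comp[OF J' p(1) q] z unfolding S_def by force
    qed
    show "inj_on (gal q) S" using inj_on_subset[OF inj[OF q] ON] .
  qed
  have "coeff P i \<in> Fr J e" for i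
  proof (rule fixed_field[OF J])
    note * = hom_on_coeff_prod[OF N_closed(7) gal_hom fin ON inj]
    show "coeff P i \<in> N" using * e_Pts P0 by (force simp: P_def polys_def)
    fix q assume q: "q \<in> Pts J"
    have "gal q (coeff P i) = coeff (\<Prod>r\<in>gal q ` S. [:r, 1:]) i" using *[of q] q P0 by (force simp: P_def)
    thus "gal q (coeff P i) = coeff P i" unfolding image[OF q] by (simp add: P_def)
  qed
  hence P: "P \<in> polys (Fr J e)" by (simp add: polys_def)
  have "card S \<le> degree q" if q: "q \<in> polys (Fr J e)" "q \<noteq> 0" "poly q z = 0" for q
  proof -
    have "poly q r = 0" if "r \<in> S" for r
      using that gal_root[OF J' _ q(1) z q(3)] unfolding S_def by blast
    hence "S \<subseteq> {r. poly q r = 0}" by blast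
    hence "card S \<le> card {r. poly q r = 0}" by (rule card_mono[OF poly_roots_finite[OF q(2)]])
    also have "\<dots> \<le> degree q" using q(2) by (rule card_poly_roots_bound)
    finally show ?thesis .
  qed
  moreover have "z \<in> S" unfolding S_def using e_Pts gal_e[OF z] by (metis image_eqI)
  ultimately have "is_min_poly (Fr J e) z P"
    unfolding is_min_poly_def set_coeffs_subset_iff[OF Jr]
    using P fin lead_coeff_prod_roots[of S] by (auto simp: P_def poly_prod_roots degree_prod_roots)
  moreover have "rsquarefree P" unfolding P_def using fin by (rule rsquarefree_prod_roots)
  moreover have "\<forall>r. poly P r = 0 \<longrightarrow> r \<in> N" using ON fin by (auto simp: P_def poly_prod_roots)
  ultimately show ?thesis by blast
qed

lemma separable_N: "J = {0} \<or> J = {6, 0} \<Longrightarrow> z \<in> N \<Longrightarrow> separable_elt (Fr J e) z"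
  using min_poly_N unfolding separable_elt_def by blast

lemma normal_N: "normal_over (Fr {0} e) N"
  using min_poly_N unfolding normal_over_def by blast

lemma normal_gal:
  assumes N': "normal_over (Fr {0} e) N'" and z: "z \<in> N'" "z \<in> N" and p: "p \<in> Pts {0}"
  shows "gal p z \<in> N'"
proof -
  obtain Q where Q: "is_min_poly (Fr {0} e) z Q" "\<forall>r. poly Q r = 0 \<longrightarrow> r \<in> N'"
    using N' z(1) unfolding normal_over_def by blast
  have "Q \<in> polys (Fr {0} e)" "poly Q z = 0"
    using Q(1) set_coeffs_subset_iff[OF is_subring_Fr[of "{0}" e], of Q] by (auto simp: is_min_poly_def)
  hence "poly Q (gal p z) = 0" using gal_root[OF _ _ p _ z(2)] by simp
  thus ?thesis using Q by blast
qed

text \<open>Conjugating by \<open>Rm\<close> adds s + 1 to y and a term containing d to x, so a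
  normal field with w, y and x + c d also contains s, d and x.\<close>

lemma N_subset_normal:
  assumes N': "is_subfield N'" "normal_over (Fr {0} e) N'" and c: "c = 0 \<or> c = 1"
    and mem: "e 0 \<in> N'" "e 6 \<in> N'" "e 2 \<in> N'" "e 3 + c * e 5 \<in> N'"
  shows "N \<subseteq> N'"
proof -
  note N'c = is_subfieldD[OF N'(1)]
  have R: "Rm e \<in> Pts {0}" using gcover_Rm[OF U] unfolding Pts_def by (auto simp: Rm_def)
  have var: "(\<lambda>p. p i) \<in> PF I6" if "i \<in> I6" for i using that by simp
  have "e 2 \<in> N" using RvI[OF var[of 2], of e] Rv_subset_Fr[of I6 e] by auto
  from normal_gal[OF N'(2) mem(3) this R] have "e 2 + e 4 + 1 \<in> N'"
    using gal_var[OF R, of 2] by (simp add: Rm_def)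
  hence "(e 2 + e 4 + 1) + (e 2 + 1) \<in> N'" using N'c(3)[OF _ N'c(3)[OF mem(3) N'c(2)]] by blast
  also have "(e 2 + e 4 + 1) + (e 2 + 1) = e 4" by (simp add: ac_simps)
  finally have s: "e 4 \<in> N'" .
  have f: "(\<lambda>p. p 3 + c * p 5) \<in> PF I6" using c by auto
  have "e 3 + c * e 5 \<in> N" using RvI[OF f, of e] Rv_subset_Fr[of I6 e] by auto
  from normal_gal[OF N'(2) mem(4) this R] have "Rm e 3 + c * e 5 \<in> N'"
    using gal_PF[OF R f] by (simp add: Rm_def)
  moreover have "(e 4 + 1) * e 2 + e 2 ^ 2 + (e 4 + 1) ^ 3 \<in> N'"
    using mem s by (intro N'c(3,4) is_subring_power N'c(2,7))
  ultimately have "(Rm e 3 + c * e 5) + ((e 3 + c * e 5) + ((e 4 + 1) * e 2 + e 2 ^ 2 + (e 4 + 1) ^ 3)) \<in> N'"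
    using N'c(3)[OF _ N'c(3)[OF mem(4)]] by blast
  also have "(Rm e 3 + c * e 5) + ((e 3 + c * e 5) + ((e 4 + 1) * e 2 + e 2 ^ 2 + (e 4 + 1) ^ 3)) = e 5"
    by (simp add: Rm_def ac_simps)
  finally have d: "e 5 \<in> N'" .
  have "c \<in> N'" using c N'c(1,2) by auto
  hence "(e 3 + c * e 5) + c * e 5 \<in> N'" using N'c(3)[OF mem(4) N'c(4)] d by blast
  hence x: "e 3 \<in> N'" by (simp add: add.assoc)
  show ?thesis using mem s d x by (intro Fr_least N'(1)) auto
qed

lemma galois_closure_eq:
  assumes K: "K \<subseteq> N" and c: "c = 0 \<or> c = 1"
    and mem: "e 0 \<in> K" "e 6 \<in> K" "e 2 \<in> K" "e 3 + c * e 5 \<in> K"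
  shows "galois_closure (Fr {0} e) K = N"
proof
  show "galois_closure (Fr {0} e) K \<subseteq> N"
    unfolding galois_closure_def using N_subfield K normal_N by (auto simp: subfield_amb_iff)
  show "N \<subseteq> galois_closure (Fr {0} e) K"
    unfolding galois_closure_def
  proof (rule Inter_greatest)
    fix N' assume "N' \<in> {N. subfield N amb \<and> K \<subseteq> N \<and> normal_over (Fr {0} e) N}"
    thus "N \<subseteq> N'" using mem by (intro N_subset_normal[OF _ _ c]) (auto simp: subfield_amb_iff)
  qed
qed

subsection \<open>The Galois group\<close>

text \<open>Every unit modulo 8 is its own inverse.\<close>

lemma act_inverse:
  assumes "a \<in> {0..7}" "u \<in> {1, 3, 5, 7}"
  shows "act ((- (u * a)) mod 8, u) (act (a, u) e) = e"
proof -
  have "act ((- (u * a)) mod 8, u) (act (a, u) e) = act ((a + u * ((- (u * a)) mod 8)) mod 8, u * u mod 8) e"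
    using assms by (intro act_act[OF U]) auto
  also have "(a + u * ((- (u * a)) mod 8)) mod 8 = 0"
  proof -
    from assms(2) consider "u = 1" | "u = 3" | "u = 5" | "u = 7" by auto
    thus ?thesis by cases (simp_all, presburger+)
  qed
  also have "u * u mod 8 = 1" using assms(2) by auto
  finally have "act ((- (u * a)) mod 8, u) (act (a, u) e) = act (0, 1) e" .
  also have "\<dots> = e" by (rule HOL.ext) (simp add: act_def Um_def Sm_def sgn_s_def sgn_d_def)
  finally show ?thesis .
qed

definition affine8 :: "(int \<times> int) set" where "affine8 = {0..7} \<times> {1, 3, 5, 7}"

definition affine8_mult :: "int \<times> int \<Rightarrow> int \<times> int \<Rightarrow> int \<times> int" where
  "affine8_mult g h = ((fst g + snd g * fst h) mod 8, snd g * snd h mod 8)"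

lemma affine8_mult_closed: "g \<in> affine8 \<Longrightarrow> h \<in> affine8 \<Longrightarrow> affine8_mult g h \<in> affine8"
  unfolding affine8_def affine8_mult_def by auto

lemma act_affine8_mult: "gcover p \<Longrightarrow> g \<in> affine8 \<Longrightarrow> h \<in> affine8 \<Longrightarrow> act h (act g p) = act (affine8_mult g h) p"
  using act_act[of p "fst g" "fst h" "snd g" "snd h"] by (cases g; cases h) (auto simp: affine8_def affine8_mult_def)

lemma act_inverse': "g \<in> affine8 \<Longrightarrow> \<exists>h\<in>affine8. act h (act g e) = e"
  using act_inverse[of "fst g" "snd g"] unfolding affine8_def
  by (intro bexI[of _ "((- (snd g * fst g)) mod 8, snd g)"]) auto

lemma act_inj:
  assumes g: "g \<in> affine8" "g' \<in> affine8" "act g e = act g' e"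
  shows "g = g'"
proof -
  obtain h where h: "h \<in> affine8" "act h (act g e) = e" using act_inverse'[OF g(1)] by blast
  have *: "(fst f + snd f * fst h) mod 8 = 0 \<and> snd f * snd h mod 8 = 1"
    if f: "f \<in> affine8" "act h (act f e) = e" for f
  proof -
    have "act (affine8_mult f h) e = e" using act_affine8_mult[OF U f(1) h(1)] f(2) by simp
    thus ?thesis using act_trivial[OF U, of "fst (affine8_mult f h)" "snd (affine8_mult f h)"] affine8_mult_closed[OF f(1) h(1)]
      by (auto simp: affine8_def affine8_mult_def)
  qed
  have 1: "(fst g + snd g * fst h) mod 8 = 0 \<and> snd g * snd h mod 8 = 1"
    and 2: "(fst g' + snd g' * fst h) mod 8 = 0 \<and> snd g' * snd h mod 8 = 1"
    using *[OF g(1) h(2)] *[OF g(2)] h(2) g(3) by simp_all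
  have "snd g \<in> {1,3,5,7}" "snd g' \<in> {1,3,5,7}" "snd h \<in> {1,3,5,7}" using g h by (auto simp: affine8_def)
  hence s: "snd g = snd g'" using 1 2 by auto
  have mod8: "i = j" if "(i + k) mod 8 = 0" "(j + k) mod 8 = 0" "0 \<le> i" "i \<le> 7" "0 \<le> j" "j \<le> 7" for i j k :: int
    using that by presburger
  have "fst g = fst g'" using mod8[of "fst g" "snd g' * fst h" "fst g'"] 1 2 g unfolding s by (auto simp: affine8_def)
  with s show ?thesis by (simp add: prod_eq_iff)
qed

definition \<Phi> :: "int \<times> int \<Rightarrow> Omega \<Rightarrow> Omega" where
  "\<Phi> g = restrict (gal (act g e)) N"

lemma \<Phi>_mult:
  assumes "g \<in> affine8" "h \<in> affine8"
  shows "\<Phi> (affine8_mult g h) = compose N (\<Phi> g) (\<Phi> h)"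
proof (rule ext)
  fix z
  show "\<Phi> (affine8_mult g h) z = compose N (\<Phi> g) (\<Phi> h) z"
    using gal_act[of z "act g e" h] act_Pts act_affine8_mult[OF U assms] by (auto simp: \<Phi>_def compose_def)
qed

lemma \<Phi>_in:
  assumes g: "g \<in> affine8"
  shows "\<Phi> g \<in> carrier (aut_group (Fr {0} e) N)"
proof -
  have hom: "hom_on N (\<Phi> g)"
    using gal_hom[OF act_Pts, of g] N_closed unfolding hom_on_def \<Phi>_def by auto
  obtain h where h: "h \<in> affine8" "act h (act g e) = e" using act_inverse'[OF g] by blast
  have into: "\<Phi> g ` N \<subseteq> N" using gal_act(1)[OF _ act_Pts, of _ g] by (auto simp: \<Phi>_def)
  have "N \<subseteq> \<Phi> g ` N"
  proof
    fix z assume z: "z \<in> N"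
    have "\<Phi> g (gal (act h e) z) = gal e z"
      using gal_act[OF z act_Pts] h(2) by (simp add: \<Phi>_def)
    thus "z \<in> \<Phi> g ` N" using gal_act(1)[OF z act_Pts] gal_e[OF z] by (metis image_eqI)
  qed
  hence "bij_betw (\<Phi> g) N N" using into hom_on_inj[OF N_subfield hom] by (auto simp: bij_betw_def)
  moreover have "\<Phi> g \<in> extensional N" by (simp add: \<Phi>_def)
  moreover have "\<Phi> g z = z" if "z \<in> Fr {0} e" for z
    using gal_fix[OF act_Pts _ _ that] Fr_mono[of "{0}" I6 e] that by (auto simp: \<Phi>_def)
  ultimately show ?thesis using hom into
    unfolding aut_group_def Bij_def by (auto simp: hom_on_iff_ring_hom)
qed

lemma \<Phi>_inj: "inj_on \<Phi> affine8"
proof (rule inj_onI)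
  fix g h assume g: "g \<in> affine8" "h \<in> affine8" and eq: "\<Phi> g = \<Phi> h"
  have "act g e i = act h e i" for i
  proof (cases "i \<in> I6")
    case True
    have "e i \<in> N" using Rv_var[OF True, of e] Rv_subset_Fr[of I6 e] by blast
    hence "gal (act g e) (e i) = gal (act h e) (e i)" using fun_cong[OF eq, of "e i"] by (simp add: \<Phi>_def)
    thus ?thesis using gal_var[OF act_Pts True] by simp
  next
    case False
    thus ?thesis using act_other by metis
  qed
  thus "g = h" using act_inj[OF g] by blast
qed

text \<open>An automorphism is determined by the images of the generators. These satisfy the same
  equations, so they form a point of the cover, and transitivity of the action provides the group
  element.\<close>

lemma \<Phi>_surj:
  assumes "\<tau> \<in> carrier (aut_group (Fr {0} e) N)"
  shows "\<tau> \<in> \<Phi> ` affine8"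
proof -
  have ext: "\<tau> \<in> extensional N" and hom: "hom_on N \<tau>" and fx: "\<And>z. z \<in> Fr {0} e \<Longrightarrow> \<tau> z = z"
    using assms by (auto simp: aut_group_def Bij_def hom_on_iff_ring_hom)
  define p where "p = (\<lambda>i. if i \<in> I6 then \<tau> (e i) else e i)"
  have PFN: "f e \<in> N" if "f \<in> PF I6" for f using RvI[OF that, of e] Rv_subset_Fr[of I6 e] by blast
  have PF: "\<tau> (f e) = f p" if "f \<in> PF I6" for f
    using that
  proof (induction f rule: PF.induct)
    case PF_0
    show ?case using hom_onD(4)[OF hom N_closed(1)] .
  next
    case PF_1
    show ?case using hom_onD(1)[OF hom] .
  next
    case (PF_var i)
    thus ?case by (simp add: p_def)
  next
    case (PF_add f g)
    thus ?case using hom_onD(2)[OF hom PFN PFN] by simp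
  next
    case (PF_mult f g)
    thus ?case using hom_onD(3)[OF hom PFN PFN] by simp
  qed
  have eqs: "f p = g p" if "f \<in> PF I6" "g \<in> PF I6" "f e = g e" for f g
    using PF[OF that(1)] PF[OF that(2)] that(3) by simp
  have UUp: "gcover p"
  proof (rule gcover_I)
    show "p 6 ^ 2 + p 6 = 1" by (rule eqs[of "\<lambda>p. p 6 ^ 2 + p 6" "\<lambda>_. 1"]) (simp_all add: gcover_D(1)[OF U])
    show "p 2 ^ 2 + p 2 = p 6 * p 0"
      by (rule eqs[of "\<lambda>p. p 2 ^ 2 + p 2" "\<lambda>p. p 6 * p 0"]) (simp_all add: gcover_D(2)[OF U])
    show "p 3 ^ 2 + p 3 = (p 6 * p 0 + p 0 ^ 2) * p 2"
      by (rule eqs[of "\<lambda>p. p 3 ^ 2 + p 3" "\<lambda>p. (p 6 * p 0 + p 0 ^ 2) * p 2"]) (simp_all add: gcover_D(3)[OF U])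
    show "p 4 ^ 2 + p 4 = p 0"
      by (rule eqs[of "\<lambda>p. p 4 ^ 2 + p 4" "\<lambda>p. p 0"]) (simp_all add: gcover_D(4)[OF U])
    show "p 5 ^ 2 + p 5 = p 0 ^ 3"
      by (rule eqs[of "\<lambda>p. p 5 ^ 2 + p 5" "\<lambda>p. p 0 ^ 3"]) (simp_all add: gcover_D(5)[OF U])
  qed
  have p0: "p 0 = e 0" using fx[of "e 0"] Rv_var[of 0 "{0}" e] Rv_subset_Fr[of "{0}" e] by (auto simp: p_def)
  have pP: "p \<in> Pts {0}" using UUp p0 by (auto simp: Pts_def p_def)
  obtain a u where au: "a \<in> {0..7}" "u \<in> {1, 3, 5, 7}" "p = act (a, u) e" using Pts_act[OF pP] .
  have "\<tau> = \<Phi> (a, u)"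
  proof (rule HOL.ext)
  fix z show "\<tau> z = \<Phi> (a, u) z"
  proof (cases "z \<in> N")
    case False
    thus ?thesis using ext by (simp add: \<Phi>_def extensional_def)
  next
    case True
    then obtain f h where *: "f \<in> PF I6" "h \<in> PF {0}" "h e \<noteq> 0" "z = f e / h e" by (rule N_E)
    have hN: "h e \<in> N" "\<tau> (h e) = h e"
      using fx[of "h e"] RvI[OF *(2), of e] Rv_subset_Fr[of "{0}" e] Fr_mono[of "{0}" I6 e] by auto
    have "z * h e = f e" using *(3,4) by simp
    hence "\<tau> z * h e = f p" using hom_onD(3)[OF hom True hN(1)] hN(2) PF[OF *(1)] by simp
    hence "\<tau> z = f p / h e" using *(3) by (simp add: field_simps)
    also have "\<dots> = gal p z" unfolding *(4) using gal_eq[OF pP *(1,2,3)] ..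
    finally show ?thesis using True by (simp add: \<Phi>_def au(3))
  qed
  qed
  moreover have "(a, u) \<in> affine8" using au by (simp add: affine8_def)
  ultimately show ?thesis by blast
qed

end

lemma Units_residue_ring_8: "Units (residue_ring 8) = {1, 3, 5, 7}"
proof -
  interpret residues "8::int" "residue_ring 8" by unfold_locales auto
  have "coprime i 8 \<longleftrightarrow> odd i" for i :: int
    using coprime_power_right_iff[of i 2 3] by (simp add: coprime_commute[of i 2])
  hence "Units (residue_ring 8) = {i \<in> {0<..<8}. odd i}" using res_units_eq by auto
  also have "{i \<in> {0<..<8}. odd i} = {1, 3, 5, 7::int}"
  proof -
    have "{0<..<8} = {1..7::int}" by auto
    also have "\<dots> = {1, 2, 3, 4, 5, 6, 7}" by (auto simp: atLeastAtMost_iff)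
    finally show ?thesis by auto
  qed
  finally show ?thesis .
qed

context generic_point
begin

lemma aut_group_iso: "aut_group (Fr {0} e) N \<cong> affine_group_mod 8"
proof -
  let ?G = "aut_group (Fr {0} e) N" and ?A = "affine_group_mod 8"
  have carr: "carrier ?A = affine8"
    unfolding affine_group_mod_def Let_def Units_residue_ring_8 by (simp add: residue_ring_def affine8_def)
  have mult: "g \<otimes>\<^bsub>?A\<^esub> h = affine8_mult g h" for g h
    unfolding affine_group_mod_def Let_def by (cases g; cases h) (simp add: residue_ring_def affine8_mult_def mod_simps)
  have bij: "bij_betw \<Phi> affine8 (carrier ?G)"
    unfolding bij_betw_def using \<Phi>_inj \<Phi>_in \<Phi>_surj by auto
  have Gm: "\<sigma> \<otimes>\<^bsub>?G\<^esub> \<tau> = compose N \<sigma> \<tau>" if "\<sigma> \<in> carrier ?G" "\<tau> \<in> carrier ?G" for \<sigma> \<tau>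
    using that by (simp add: aut_group_def BijGroup_def)
  let ?\<Psi> = "inv_into affine8 \<Phi>"
  have "?\<Psi> \<in> hom ?G ?A"
    unfolding hom_def carr mult
  proof (intro CollectI conjI funcsetI ballI)
    fix \<sigma> assume \<sigma>: "\<sigma> \<in> carrier ?G"
    show in1: "?\<Psi> \<sigma> \<in> affine8" using bij \<sigma> by (metis bij_betw_def inv_into_into)
    fix \<tau> assume \<tau>: "\<tau> \<in> carrier ?G"
    have in2: "?\<Psi> \<tau> \<in> affine8" using bij \<tau> by (metis bij_betw_def inv_into_into)
    have "\<Phi> (affine8_mult (?\<Psi> \<sigma>) (?\<Psi> \<tau>)) = compose N \<sigma> \<tau>"
      unfolding \<Phi>_mult[OF in1 in2] using bij \<sigma> \<tau> by (simp add: bij_betw_inv_into_right)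
    thus "?\<Psi> (\<sigma> \<otimes>\<^bsub>?G\<^esub> \<tau>) = affine8_mult (?\<Psi> \<sigma>) (?\<Psi> \<tau>)"
      unfolding Gm[OF \<sigma> \<tau>] using inv_into_f_f[OF \<Phi>_inj affine8_mult_closed[OF in1 in2]] by simp
  qed
  moreover have "bij_betw ?\<Psi> (carrier ?G) (carrier ?A)" unfolding carr using bij by (rule bij_betw_inv_into)
  ultimately show ?thesis unfolding is_iso_def iso_def by blast
qed

end

section \<open>The fields generated by the roots\<close>

lemma Fr0_T: "e 0 = T \<Longrightarrow> Fr {0} e = rat_subfield F2 T"
  by (simp add: Fr0_eq GF2_eq rat_subfield_eq_Rat[OF is_subring_F2])

lemma (in AS_step) finite_dimension_insert: "ring.finite_dimension amb (Fr I e) (Fr (insert j I) e)"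
proof -
  have "Fr (insert j I) e = amb.Span (Fr I e) [1, e j]"
  proof (intro equalityI subsetI)
    fix z assume "z \<in> Fr (insert j I) e"
    then obtain u v where "z = u + v * e j" "u \<in> Fr I e" "v \<in> Fr I e" by (auto simp: Fr_insert)
    thus "z \<in> amb.Span (Fr I e) [1, e j]" by (force simp: amb.line_extension_mem_iff)
  next
    fix z assume "z \<in> amb.Span (Fr I e) [1, e j]"
    then obtain u v where "u \<in> Fr I e" "v \<in> Fr I e" "z = u + v * e j" by (auto simp: amb.line_extension_mem_iff)
    thus "z \<in> Fr (insert j I) e" unfolding Fr_insert by blast
  qed
  thus ?thesis using amb.Span_finite_dimension[of "Fr I e" "[1, e j]"] Fr_field by (simp add: subfield_amb_iff)
qed

lemma finite_dimension_trans:
  assumes "is_subfield k" "is_subfield F" "ring.finite_dimension amb k F" "ring.finite_dimension amb F E"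
  shows "ring.finite_dimension (amb::Omega ring) k E"
  using amb.telescopic_base_dim(1)[of k F E] assms by (simp add: subfield_amb_iff)

lemma Fr_cong:
  assumes "0 \<in> I" "\<And>i. i \<in> I \<Longrightarrow> e i = e' i" shows "Fr I e = Fr I e'"
proof -
  have "Rv J e = Rv J e'" if "J \<subseteq> I" for J
    unfolding Rv_def
  proof (rule image_cong[OF refl])
    fix f assume "f \<in> PF J"
    thus "f e = f e'" by (rule PF_cong) (use that assms(2) in blast)
  qed
  from this[of I] this[of "{0}"] show ?thesis unfolding Fr_def using assms(1) by simp
qed

text \<open>For \<beta> = (w t + t^2) y the equation of y becomes quadratic in \<beta>, and its
  coefficients reduce to expressions linear in w. Solving for w recovers it from \<beta>.\<close>

lemma w_linear_relation:
  assumes "(w::Omega)\<^sup>2 + w = 1" "y\<^sup>2 + y = w * t"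
  shows "w * (t ^ 5 + t * ((w * t + t\<^sup>2) * y)) =
    ((w * t + t\<^sup>2) * y)\<^sup>2 + t\<^sup>2 * ((w * t + t\<^sup>2) * y) + t ^ 3"
  by (simp add: numeral_eq_Suc algebra_simps AS_rule[OF assms(1)] AS_rule[OF assms(2)])

context covering_point
begin

lemma Fr60_T: "Fr {6, 0} e = rat_subfield F4 T"
proof -
  note F = is_subring_F4
  have "Fr {6, 0} e = Rat F4 T"
  proof
    show "Fr {6, 0} e \<subseteq> Rat F4 T"
      using Pol_contains[OF F, of T] Pol_subset_Rat[OF F, of T] w_in_F4[OF cover_D(1)[OF V]]
      by (intro Fr_least is_subfield_Rat F) (auto simp: eT)
    have "Pol F4 T \<subseteq> Fr {6, 0} e"
      using Rv60_eq[of e, OF cover_D(1)[OF V]] Rv_subset_Fr[of "{6, 0}" e] by (simp add: eT)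
    thus "Rat F4 T \<subseteq> Fr {6, 0} e"
      using Pol_contains[OF F, of T] by (intro Rat_least towerD(4)[OF tow(2)]) blast+
  qed
  thus ?thesis by (simp add: rat_subfield_eq_Rat[OF F])
qed

lemma K_subfield: "is_subfield K" using towerD(4)[OF tow(4)] .

lemma var_in_K: "i \<in> {3, 2, 6, 0} \<Longrightarrow> e i \<in> K"
  using Rv_var[of i "{3, 2, 6, 0}" e] Rv_subset_Fr[of "{3, 2, 6, 0}" e] by blast

lemma generic_extension:
  obtains e' where "generic_point e'" "Fr {0} e' = Fr {0} e" "Fr {6, 0} e' = Fr {6, 0} e"
    "K \<subseteq> Fr {3, 5, 4, 2, 6, 0} e'" "e' 0 \<in> K" "e' 6 \<in> K" "e' 2 \<in> K" "e' 3 + c * e' 5 \<in> K"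
proof -
  obtain e' where e': "gcover e'" "e' 0 = e 0" "e' 6 = e 6" "e' 2 = e 2" "e 3 = e' 3 + c * e' 5"
    using extend_point[OF V c] .
  interpret g: generic_point e' by (rule generic_point.intro) (simp_all add: e'(1,2) eT)
  have i: "e' i \<in> g.N" if "i \<in> g.I6" for i
    using Rv_var[OF that, of e'] Rv_subset_Fr[of g.I6 e'] by blast
  have "c \<in> g.N" using c g.N_closed(1,2) by auto
  hence "e 3 \<in> g.N" unfolding e'(5) using i[of 3] i[of 5] by (intro g.N_closed(3,4)) auto
  hence "K \<subseteq> g.N" using i[of 0] i[of 6] i[of 2] e' by (intro Fr_least g.N_subfield) auto
  moreover have "Fr {0} e' = Fr {0} e" "Fr {6, 0} e' = Fr {6, 0} e"
    by (rule Fr_cong; use e' in auto)+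
  ultimately show ?thesis
    using var_in_K[of 0] var_in_K[of 6] var_in_K[of 2] var_in_K[of 3] e' g.generic_point_axioms
    by (intro that[of e']) auto
qed

lemma finite_separable_K:
  "finite_separable (rat_subfield F2 T) K" "finite_separable (rat_subfield F4 T) K"
proof -
  obtain e' where e': "generic_point e'" "Fr {0} e' = Fr {0} e" "Fr {6, 0} e' = Fr {6, 0} e"
    "K \<subseteq> Fr {3, 5, 4, 2, 6, 0} e'" by (rule generic_extension)
  interpret g: generic_point e' by (rule e'(1))
  note sf = towerD(4)[OF tow(1)] towerD(4)[OF tow(2)] towerD(4)[OF tow(3)] K_subfield
  have d1: "ring.finite_dimension amb (Fr {6, 0} e) K"
    using finite_dimension_trans[OF sf(2,3) AS_step.finite_dimension_insert[OF tow(6)]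
      AS_step.finite_dimension_insert[OF tow(7)]] .
  have d0: "ring.finite_dimension amb (Fr {0} e) K"
    using finite_dimension_trans[OF sf(1,2) AS_step.finite_dimension_insert[OF tow(5)] d1] .
  have "separable_elt (Fr J e) z" if "J = {0} \<or> J = {6, 0}" "z \<in> K" for J z
    using g.separable_N[OF that(1), of z] that e' by auto
  moreover have "Fr {0} e \<subseteq> K" "Fr {6, 0} e \<subseteq> K" by (intro Fr_mono; simp)+
  ultimately have "finite_separable (Fr {0} e) K" "finite_separable (Fr {6, 0} e) K"
    unfolding finite_separable_def using d0 d1 sf by (simp_all add: subfield_amb_iff)
  thus "finite_separable (rat_subfield F2 T) K" "finite_separable (rat_subfield F4 T) K"
    by (simp_all add: Fr60_T Fr0_T eT)
qed

lemma galois_group_K: "galois_group (rat_subfield F2 T) K \<cong> affine_group_mod 8"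
proof -
  obtain e' where e': "generic_point e'" "Fr {0} e' = Fr {0} e"
    "K \<subseteq> Fr {3, 5, 4, 2, 6, 0} e'" "e' 0 \<in> K" "e' 6 \<in> K" "e' 2 \<in> K" "e' 3 + c * e' 5 \<in> K"
    by (rule generic_extension)
  interpret g: generic_point e' by (rule e'(1))
  show ?thesis
    unfolding galois_group_def Fr0_T[of e, OF eT, symmetric] e'(2)[symmetric] g.galois_closure_eq[OF e'(3) c e'(4-7)]
    by (rule g.aut_group_iso)
qed

lemma not_geometric_K: "\<not> geometric F2 K"
proof
  assume "geometric F2 K"
  moreover have "e 6 \<in> field_of_constants F2 K"
  proof -
    have "[1, 1, 1] \<in> carrier (univ_poly (amb :: Omega ring) F2)"
      by (simp add: univ_poly_def polynomial_def GF2_eq)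
    hence "ring.algebraic amb F2 (e 6)"
      by (rule amb.algebraicI[unfolded over_def]) (use cover_D(1)[OF V] in \<open>simp_all add: power2_eq_square ac_simps\<close>)
    thus ?thesis using var_in_K[of 6] by (simp add: field_of_constants_def)
  qed
  ultimately have "e 6 \<in> {0, 1}" by (simp add: geometric_def GF2_eq)
  thus False using cover_D(1)[OF V] by auto
qed

text \<open>These guarantee that the divisions recovering w and y from a root are allowed.\<close>

lemma T_ineqs: "T ^ 8 + T ^ 6 + T ^ 3 \<noteq> 0" "T \<noteq> 0" "e 6 \<noteq> T"
proof -
  have t: "transc F4 T" by (rule transc_T[OF is_subfield_F4 finite_F4])
  note F = is_subring_F4 and F01 = is_subfieldD(1,2)[OF is_subfield_F4]
  have "monom 1 8 + monom 1 6 + monom 1 3 \<in> polys F4" using F01 by (intro polys_closed F)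
  moreover have "coeff (monom 1 8 + monom 1 6 + monom (1::Omega) 3) 8 \<noteq> coeff 0 8" by simp
  hence "monom 1 8 + monom 1 6 + monom (1::Omega) 3 \<noteq> 0" by metis
  ultimately have "poly (monom 1 8 + monom 1 6 + monom 1 3) T \<noteq> 0" using t by (auto simp: transc_def)
  thus "T ^ 8 + T ^ 6 + T ^ 3 \<noteq> 0" by (simp add: poly_monom)
  thus "T \<noteq> 0" by auto
  have "e 6 \<in> F4" using w_in_F4[OF cover_D(1)[OF V]] .
  hence "[:e 6, 1:] \<in> polys F4" using F01 by (intro polys_closed F)
  hence "poly [:e 6, 1:] T \<noteq> 0" using t by (auto simp: transc_def)
  thus "e 6 \<noteq> T" by auto
qed

lemma A_nonzero: "e 6 * T + T\<^sup>2 \<noteq> 0"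
  using T_ineqs(2,3) by (auto simp: power2_eq_square)

text \<open>The root x gives \<beta> = (w T + T^2) y, the linear relation gives w from \<beta>, and
  a division gives y.\<close>

lemma K_eq_generated: "K = generate_field amb (insert (e 3) (rat_subfield F2 T))" (is "_ = ?E")
proof
  have E: "is_subfield ?E" by (rule is_subfield_generate_field)
  note Ec = is_subfieldD[OF E]
  have x: "e 3 \<in> ?E" and k: "Fr {0} e \<subseteq> ?E"
    by (auto simp: Fr0_T eT intro: generate_field.incl)
  have T: "T \<in> ?E" using Rv_var[of 0 "{0}" e] Rv_subset_Fr[of "{0}" e] k eT by auto
  have cE: "c \<in> ?E" using c Ec(1,2) by auto
  define \<beta> where "\<beta> = e 3 ^ 2 + e 3 + c * T ^ 3"
  have \<beta>E: "\<beta> \<in> ?E" unfolding \<beta>_def using x T cE by (intro Ec(3,4) is_subring_power Ec(7))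
  have \<beta>: "\<beta> = (e 6 * T + T\<^sup>2) * e 2" unfolding \<beta>_def cover_D(3)[OF V] eT by (simp add: ac_simps)
  have eq: "e 6 * (T ^ 5 + T * \<beta>) = \<beta>\<^sup>2 + T\<^sup>2 * \<beta> + T ^ 3"
    unfolding \<beta> by (rule w_linear_relation[OF cover_D(1)[OF V] cover_D(2)[OF V, unfolded eT]])
  have "T ^ 5 + T * \<beta> \<noteq> 0"
  proof
    assume 0: "T ^ 5 + T * \<beta> = 0"
    hence "T * (T ^ 4 + \<beta>) = 0" by (simp add: algebra_simps numeral_eq_Suc)
    hence "\<beta> = T ^ 4" using T_ineqs(2) by simp
    \<comment> \<open>The right-hand side of \<open>eq\<close> at \<beta> = T^4.\<close>
    hence "T ^ 8 + T ^ 6 + T ^ 3 = 0" using eq 0 by (simp flip: power_mult power_add)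
    thus False using T_ineqs(1) by blast
  qed
  hence w: "e 6 = (\<beta>\<^sup>2 + T\<^sup>2 * \<beta> + T ^ 3) / (T ^ 5 + T * \<beta>)" using eq by (simp add: field_simps)
  have wE: "e 6 \<in> ?E" unfolding w using \<beta>E T by (intro Ec(3,4,6) is_subring_power Ec(7))
  have y: "e 2 = \<beta> / (e 6 * T + T\<^sup>2)" using A_nonzero by (simp add: \<beta>)
  have "e 2 \<in> ?E" unfolding y using \<beta>E T wE by (intro Ec(3,4,6) is_subring_power Ec(7))
  thus "K \<subseteq> ?E" using x T wE eT by (intro Fr_least E) auto
  show "?E \<subseteq> K" using Fr_mono[of "{0}" "{3, 2, 6, 0}" e] var_in_K[of 3]
    by (intro generate_field_least K_subfield) (auto simp: Fr0_T eT)
qed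

end

section \<open>Factorisation of the octics over F_4(T)\<close>

lemma cube_root_exists: obtains w :: Omega where "w\<^sup>2 + w = 1" using alg_closed_AS by blast

text \<open>The norm from F_4 to F_2 of a quadratic polynomial with coefficients linear in w;
  conjugation is w -> w + 1.\<close>

lemma norm_quadratic:
  assumes w: "(w::Omega)\<^sup>2 + w = 1"
  shows "(\<beta>\<^sup>2 + (w * t + r) * \<beta> + (a + w * b)) * (\<beta>\<^sup>2 + ((w + 1) * t + r) * \<beta> + (a + (w + 1) * b)) =
    \<beta> ^ 4 + t * \<beta> ^ 3 + (t\<^sup>2 + t * r + r\<^sup>2 + b) * \<beta>\<^sup>2 + (t * a + r * b) * \<beta> + (a\<^sup>2 + a * b + b\<^sup>2)"
  by (simp add: power2_eq_square power3_eq_cube power4_eq_xxxx algebra_simps AS_rule[OF w])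

lemma constant_coeff_reduce:
  assumes w: "(w::Omega)\<^sup>2 + w = 1"
  shows "(w * t + t\<^sup>2)\<^sup>2 * (w * t) = t ^ 3 + w * t ^ 5"
  by (simp add: numeral_eq_Suc algebra_simps AS_rule[OF w])

lemma poly_octic:
  "poly [:c0, c1, c2, c3, c4, c5, c6, 0, 1:] (\<alpha>::Omega) =
    \<alpha> ^ 8 + c6 * \<alpha> ^ 6 + c5 * \<alpha> ^ 5 + c4 * \<alpha> ^ 4 + c3 * \<alpha> ^ 3 + c2 * \<alpha> ^ 2 + c1 * \<alpha> + c0"
  by (simp add: numeral_eq_Suc algebra_simps)

lemma AS_powers:
  assumes "\<beta> = \<alpha>\<^sup>2 + \<alpha> + (h::Omega)"
  shows "\<beta>\<^sup>2 = \<alpha> ^ 4 + \<alpha>\<^sup>2 + h\<^sup>2" "\<beta> ^ 4 = \<alpha> ^ 8 + \<alpha> ^ 4 + h ^ 4"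
    "\<beta> ^ 3 = \<alpha> ^ 6 + \<alpha> ^ 5 + (1 + h) * \<alpha> ^ 4 + \<alpha> ^ 3 + (h + h\<^sup>2) * \<alpha>\<^sup>2 + h\<^sup>2 * \<alpha> + h ^ 3"
  unfolding assms by (simp_all add: numeral_eq_Suc algebra_simps)

text \<open>\<open>P v\<close> is the equation y^2 + y = v T multiplied by (v T + T^2)^2 and written
  in \<beta> = (v T + T^2) y. Each octic is the product of the two conjugate quadratics, with
  \<beta> = x^2 + x for \<open>polK\<close> and \<beta> = x^2 + x + T^3 for
  \<open>polK'\<close>.\<close>

lemma polK_factors:
  assumes w: "w\<^sup>2 + w = 1"
  defines "P \<equiv> \<lambda>v \<beta>. \<beta>\<^sup>2 + (v * T + T\<^sup>2) * \<beta> + (v * T + T\<^sup>2)\<^sup>2 * (v * T)"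
  shows "poly polK \<alpha> = P w (\<alpha>\<^sup>2 + \<alpha>) * P (w + 1) (\<alpha>\<^sup>2 + \<alpha>)"
    "poly polK' \<alpha> = P w (\<alpha>\<^sup>2 + \<alpha> + T ^ 3) * P (w + 1) (\<alpha>\<^sup>2 + \<alpha> + T ^ 3)"
proof -
  have prod: "P w \<beta> * P (w + 1) \<beta> =
    \<beta> ^ 4 + T * \<beta> ^ 3 + (T ^ 2 + T ^ 3 + T ^ 4 + T ^ 5) * \<beta>\<^sup>2 + (T ^ 4 + T ^ 7) * \<beta> + (T ^ 6 + T ^ 8 + T ^ 10)" for \<beta>
    unfolding P_def constant_coeff_reduce[OF w] constant_coeff_reduce[OF flip_root[OF w]] norm_quadratic[OF w]
    by (simp flip: power_Suc power_Suc2 power_mult power_add)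
  show "poly polK \<alpha> = P w (\<alpha>\<^sup>2 + \<alpha>) * P (w + 1) (\<alpha>\<^sup>2 + \<alpha>)"
  proof -
    have \<beta>: "\<alpha>\<^sup>2 + \<alpha> = \<alpha>\<^sup>2 + \<alpha> + 0" by simp
    show ?thesis unfolding prod polK_def poly_octic unfolding AS_powers[OF \<beta>] by (simp add: algebra_simps)
  qed
  show "poly polK' \<alpha> = P w (\<alpha>\<^sup>2 + \<alpha> + T ^ 3) * P (w + 1) (\<alpha>\<^sup>2 + \<alpha> + T ^ 3)"
    unfolding prod polK'_def poly_octic unfolding AS_powers[OF refl]
    by (simp add: algebra_simps numeral_eq_Suc)
qed

text \<open>Dividing \<beta> by w T + T^2 produces the coordinate y belonging to the given
  root.\<close>

lemma root_covering_point:
  assumes c: "c = 0 \<or> c = 1" and w: "w\<^sup>2 + w = 1"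
    and 0: "(\<alpha>\<^sup>2 + \<alpha> + c * T ^ 3)\<^sup>2 + (w * T + T\<^sup>2) * (\<alpha>\<^sup>2 + \<alpha> + c * T ^ 3) + (w * T + T\<^sup>2)\<^sup>2 * (w * T) = 0"
  shows "\<exists>e. covering_point c e \<and> e 3 = \<alpha>"
proof -
  define \<beta> where "\<beta> = \<alpha>\<^sup>2 + \<alpha> + c * T ^ 3"
  define A where "A = w * T + T\<^sup>2"
  \<comment> \<open>Auxiliary coordinates for a generic point with this w, from which w T + T^2
    \<noteq> 0 is taken; the y belonging to the root is defined afterwards.\<close>
  obtain y0 x0 where y0: "y0\<^sup>2 + y0 = w * T" and x0: "x0\<^sup>2 + x0 = A * y0 + c * T ^ 3" using alg_closed_AS by metis
  interpret a: covering_point c "cpt T w y0 x0"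
    by unfold_locales (use c w y0 x0 in \<open>auto simp: cover_def A_def\<close>)
  have A: "A \<noteq> 0" using a.A_nonzero by (simp add: A_def)
  define y where "y = \<beta> / A"
  have \<beta>: "\<beta> = A * y" using A by (simp add: y_def)
  have "(A * y)\<^sup>2 + A * (A * y) + A\<^sup>2 * (w * T) = 0" using 0 unfolding \<beta>_def[symmetric] A_def[symmetric] \<beta> .
  moreover have "(A * y)\<^sup>2 + A * (A * y) + A\<^sup>2 * (w * T) = A\<^sup>2 * (y\<^sup>2 + y + w * T)"
    by (simp only: power2_eq_square distrib_left ac_simps)
  ultimately have "A\<^sup>2 * (y\<^sup>2 + y + w * T) = 0" by (simp only:)
  hence y: "y\<^sup>2 + y = w * T" using A by simp
  have "\<alpha>\<^sup>2 + \<alpha> = \<beta> + c * T ^ 3" by (simp add: \<beta>_def add.assoc)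
  hence x: "\<alpha>\<^sup>2 + \<alpha> = A * y + c * T ^ 3" by (simp add: \<beta>)
  have "covering_point c (cpt T w y \<alpha>)"
    by unfold_locales (use c w y x in \<open>auto simp: cover_def A_def\<close>)
  thus ?thesis by (intro exI[of _ "cpt T w y \<alpha>"]) simp
qed

lemma roots_covering_point:
  "poly polK \<alpha> = 0 \<Longrightarrow> \<exists>e. covering_point 0 e \<and> e 3 = \<alpha>"
  "poly polK' \<alpha> = 0 \<Longrightarrow> \<exists>e. covering_point 1 e \<and> e 3 = \<alpha>"
proof -
  obtain w :: Omega where w: "w\<^sup>2 + w = 1" by (rule cube_root_exists)
  have w': "(w + 1)\<^sup>2 + (w + 1) = 1" by (rule flip_root[OF w])
  note f = polK_factors[OF w, of \<alpha>]
  show "\<exists>e. covering_point 0 e \<and> e 3 = \<alpha>" if 0: "poly polK \<alpha> = 0"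
  proof -
    from 0 f(1) consider
      "(\<alpha>\<^sup>2 + \<alpha>)\<^sup>2 + (w * T + T\<^sup>2) * (\<alpha>\<^sup>2 + \<alpha>) + (w * T + T\<^sup>2)\<^sup>2 * (w * T) = 0" |
      "(\<alpha>\<^sup>2 + \<alpha>)\<^sup>2 + ((w + 1) * T + T\<^sup>2) * (\<alpha>\<^sup>2 + \<alpha>) + ((w + 1) * T + T\<^sup>2)\<^sup>2 * ((w + 1) * T) = 0"
      by (metis mult_eq_0_iff)
    thus ?thesis using root_covering_point[of 0 w \<alpha>] root_covering_point[of 0 "w + 1" \<alpha>] w w' by cases simp_all
  qed
  show "\<exists>e. covering_point 1 e \<and> e 3 = \<alpha>" if 0: "poly polK' \<alpha> = 0"
  proof -
    from 0 f(2) consider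
      "(\<alpha>\<^sup>2 + \<alpha> + T ^ 3)\<^sup>2 + (w * T + T\<^sup>2) * (\<alpha>\<^sup>2 + \<alpha> + T ^ 3) + (w * T + T\<^sup>2)\<^sup>2 * (w * T) = 0" |
      "(\<alpha>\<^sup>2 + \<alpha> + T ^ 3)\<^sup>2 + ((w + 1) * T + T\<^sup>2) * (\<alpha>\<^sup>2 + \<alpha> + T ^ 3) + ((w + 1) * T + T\<^sup>2)\<^sup>2 * ((w + 1) * T) = 0"
      by (metis mult_eq_0_iff)
    thus ?thesis using root_covering_point[of 1 w \<alpha>] root_covering_point[of 1 "w + 1" \<alpha>] w w' by cases simp_all
  qed
qed

lemma generated_by_roots:
  "generated_by_root (rat_subfield F2 T) polK K \<Longrightarrow> \<exists>e. covering_point 0 e \<and> K = Fr {3, 2, 6, 0} e"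
  "generated_by_root (rat_subfield F2 T) polK' K \<Longrightarrow> \<exists>e. covering_point 1 e \<and> K = Fr {3, 2, 6, 0} e"
  unfolding generated_by_root_def
  using roots_covering_point covering_point.K_eq_generated by metis+

lemma arith_equivalent_refl: "arith_equivalent F t K K"
  unfolding arith_equivalent_def has_dirichlet_density_def by (intro exI[of _ "{}"]) simp

text \<open>The image of the root is again a root. The preimage of the field it generates is a
  subfield containing k and the root, hence all of \<open>K\<close>, so that field is all of
  \<open>L\<close>.\<close>

lemma isomorphic_generated_by_root:
  fixes k K L :: "Omega set"
  assumes k: "is_subring k" and K: "is_subfield K" "is_subfield L" "k \<subseteq> K" and f: "f \<in> polys k"
    and gen: "generated_by_root k f K" and iso: "isomorphic_over k K L"
  shows "generated_by_root k f L"
proof -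
  obtain \<alpha> where \<alpha>: "poly f \<alpha> = 0" "K = generate_field amb (insert \<alpha> k)"
    using gen by (auto simp: generated_by_root_def)
  obtain \<phi> where "\<phi> \<in> ring_iso (sub_of K) (sub_of L)" and fx: "\<And>x. x \<in> k \<Longrightarrow> \<phi> x = x"
    using iso by (auto simp: isomorphic_over_def)
  hence h: "hom_on K \<phi>" and bij: "bij_betw \<phi> K L"
    by (auto simp: ring_iso_def hom_on_iff_ring_hom)
  note Kc = is_subfieldD[OF K(1)]
  have \<alpha>K: "\<alpha> \<in> K" unfolding \<alpha>(2) by (rule generate_field.incl) simp
  let ?E = "generate_field amb (insert (\<phi> \<alpha>) k)"
  have E: "is_subfield ?E" by (rule is_subfield_generate_field)
  note Ec = is_subfieldD[OF E]
  have "\<phi> (poly f \<alpha>) = poly f (\<phi> \<alpha>)"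
    using f polys_mono[OF K(3)] fx by (intro hom_on_poly[OF Kc(7) h _ _ \<alpha>K]) (auto simp: polys_def)
  hence root: "poly f (\<phi> \<alpha>) = 0" using \<alpha>(1) hom_onD(4)[OF h \<alpha>K] by simp
  have "?E \<subseteq> L"
  proof (intro generate_field_least K(2))
    have "\<phi> ` k = k" using fx by force
    thus "insert (\<phi> \<alpha>) k \<subseteq> L" using bij \<alpha>K K(3) by (auto simp: bij_betw_def)
  qed
  moreover have "L \<subseteq> ?E"
  proof -
    let ?S = "{z \<in> K. \<phi> z \<in> ?E}"
    have "is_subfield ?S"
      unfolding is_subfield_def is_subring_def
    proof (intro conjI ballI)
      show "0 \<in> ?S" "1 \<in> ?S" using Kc(1,2) Ec(1,2) hom_onD(1)[OF h] hom_onD(4)[OF h \<alpha>K] by auto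
      fix a b assume "a \<in> ?S" "b \<in> ?S"
      thus "a + b \<in> ?S" "a * b \<in> ?S" using hom_onD(2,3)[OF h] Kc(3,4) Ec(3,4) by auto
    next
      fix a assume a: "a \<in> ?S"
      show "inverse a \<in> ?S"
      proof (cases "a = 0")
        case False
        have "\<phi> a * \<phi> (inverse a) = 1" using hom_onD(3)[OF h, of a "inverse a"] hom_onD(1)[OF h] Kc(5)[of a] a False by simp
        hence "\<phi> (inverse a) = inverse (\<phi> a)" by (metis inverse_unique)
        thus ?thesis using a Kc(5) Ec(5) by simp
      qed (use a in simp)
    qed
    moreover have "insert \<alpha> k \<subseteq> ?S" using \<alpha>K K(3) fx by (auto intro: generate_field.incl)
    ultimately have "K \<subseteq> ?S" unfolding \<alpha>(2) by (rule generate_field_least)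
    thus ?thesis using bij by (auto simp: bij_betw_def)
  qed
  ultimately show ?thesis using root unfolding generated_by_root_def by blast
qed

lemma polK_coeffs: "polK \<in> polys (rat_subfield F2 T)"
proof -
  have F: "is_subfield (rat_subfield F2 T)" unfolding rat_subfield_def by (rule is_subfield_generate_field)
  have "T \<in> rat_subfield F2 T" unfolding rat_subfield_def by (rule generate_field.incl) simp
  thus ?thesis unfolding polK_def by (intro polys_closed is_subfieldD(1,2,3,7)[OF F] is_subring_power)
qed

text \<open>The existence clauses keep the universal part from being vacuous. The universal part
  covers every choice of roots, including those that give the two fields different values of
  w.\<close>

theorem theorem6:
  shows "(\<exists>K. generated_by_root (rat_subfield F2 T) polK K) \<and>
    (\<exists>K'. generated_by_root (rat_subfield F2 T) polK' K') \<and>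
    (\<forall>K K'. generated_by_root (rat_subfield F2 T) polK K \<longrightarrow>
            generated_by_root (rat_subfield F2 T) polK' K' \<longrightarrow>
       arith_equivalent_siblings F2 T K K' \<and>
       \<not> geometric F2 K \<and> \<not> geometric F2 K' \<and>
       galois_group (rat_subfield F2 T) K \<cong> affine_group_mod 8 \<and>
       galois_group (rat_subfield F2 T) K' \<cong> affine_group_mod 8 \<and>
       finite_separable (rat_subfield F4 T) K \<and>
       finite_separable (rat_subfield F4 T) K' \<and>
       \<not> arith_equivalent F4 T K K')"
proof (intro conjI allI impI)
  have "\<exists>\<alpha>. poly polK \<alpha> = 0" "\<exists>\<alpha>. poly polK' \<alpha> = 0"
    by (rule alg_closed_imp_poly_has_root, simp add: polK_def polK'_def)+
  thus "\<exists>K. generated_by_root (rat_subfield F2 T) polK K" "\<exists>K'. generated_by_root (rat_subfield F2 T) polK' K'"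
    unfolding generated_by_root_def by blast+
next
  let ?k = "rat_subfield F2 T"
  fix K K' assume gen: "generated_by_root ?k polK K" "generated_by_root ?k polK' K'"
  obtain e where e: "covering_point 0 e" "K = Fr {3, 2, 6, 0} e" using generated_by_roots(1)[OF gen(1)] by blast
  obtain e' where e': "covering_point 1 e'" "K' = Fr {3, 2, 6, 0} e'" using generated_by_roots(2)[OF gen(2)] by blast
  interpret K: covering_point 0 e by (rule e(1))
  interpret K': covering_point 1 e' by (rule e'(1))
  show "\<not> arith_equivalent F4 T K K'" unfolding e(2) e'(2) by (rule not_arith_equivalent_F4[OF e(1) e'(1)])
  show "finite_separable (rat_subfield F4 T) K" "finite_separable (rat_subfield F4 T) K'"
    unfolding e(2) e'(2) using K.finite_separable_K(2) K'.finite_separable_K(2) .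
  show "galois_group ?k K \<cong> affine_group_mod 8" "galois_group ?k K' \<cong> affine_group_mod 8"
    unfolding e(2) e'(2) using K.galois_group_K K'.galois_group_K .
  show "\<not> geometric F2 K" "\<not> geometric F2 K'"
    unfolding e(2) e'(2) using K.not_geometric_K K'.not_geometric_K .
  have "\<not> isomorphic_over ?k K K'"
  proof
    assume iso: "isomorphic_over ?k K K'"
    have "generated_by_root ?k polK K'"
    proof (rule isomorphic_generated_by_root[OF _ _ _ _ polK_coeffs gen(1) iso])
      show "is_subring ?k" unfolding rat_subfield_def using is_subfieldD(7)[OF is_subfield_generate_field] .
      show "?k \<subseteq> K" using Fr_mono[of "{0}" "{3, 2, 6, 0}" e] Fr0_T[of e] K.eT by (simp add: e(2))
    qed (simp_all add: e(2) e'(2) K.K_subfield K'.K_subfield)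
    then obtain e'' where e'': "covering_point 0 e''" "K' = Fr {3, 2, 6, 0} e''"
      using generated_by_roots(1) by blast
    have "\<not> arith_equivalent F4 T K' K'"
      using not_arith_equivalent_F4[OF e''(1) e'(1)] by (simp flip: e''(2) e'(2))
    thus False using arith_equivalent_refl by blast
  qed
  thus "arith_equivalent_siblings F2 T K K'"
    unfolding arith_equivalent_siblings_def
    using K.finite_separable_K(1) K'.finite_separable_K(1) arith_equivalent_F2[OF e(1) e'(1)]
    by (simp add: e(2) e'(2))
qed

end
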